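(* Let $q$ be a (conservative stable) $Q$-function on the nonempty Borel space $S$, let $c\in[0,\infty)$, and let $f$ be a $c$-drift function with respect to $q$. Then for $$\mathbb E_x^q[g(X_t)]-g(x)=\int_0^t\mathbb E_x^q\left[\int_Sg(z)q(dz|X_s,s)\right]ds=\mathbb E_x^q\left[\int_0^t\left(\int_Sg(z)q(dz|X_s,s)\right)ds\right]\quad\forall x\in S,\ t\ge0$$ to hold for each $f$-bounded function $g$ on $S$ satisfying $$\int_0^t\mathbb E_x^q\left[\left|\int_Sg(z)q(dz|X_s,s)\right|\right]ds<\infty\quad\forall x\in S,\ t\ge0,$$ it is necessary and sufficient that one of the following equivalent conditions holds: (a) $\mathbb E_x^q[f(X_t)]-f(x)=\int_0^t\mathbb E_x^q\left[\int_Sf(y)q(dy|X_s,s)\right]ds$ for all $x\in S$, $t\in[0,\infty)$; (b) the Markov pure jump process with transition function $P_{q^f}$ (on $S_\delta$) is nonexplosive.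
   Context: $S$ is a nonempty Borel space with Borel $\sigma$-algebra $\mathcal B(S)$; measurability means Borel measurability. A (conservative stable) $Q$-function on $S$ is a Borel-measurable signed kernel $q(dy|x,s)$ on $\mathcal B(S)$ from $S\times[0,\infty)$ such that (1) $0\le q(\Gamma|x,s)<\infty$ whenever $x\notin\Gamma\in\mathcal B(S)$, (2) $q(S|x,s)=0$ for all $(x,s)$, (3) $\sup_{s\ge0}q(S\setminus\{x\}|x,s)<\infty$ for each $x\in S$. Put $\tilde q(\Gamma|x,s):=q(\Gamma\setminus\{x\}|x,s)$ and $q_x(s):=-q(\{x\}|x,s)$. The $q$-transition function is $P_q:=\sum_{n\ge0}P_q^{(n)}$, where for $0\le s\le t<\infty$, $P_q^{(0)}(s,x,t,\Gamma)=\delta_x(\Gamma)e^{-\int_s^tq_x(v)dv}$ and $P_q^{(n+1)}(s,x,t,\Gamma)=\int_s^te^{-\int_s^uq_x(v)dv}\left(\int_SP_q^{(n)}(u,z,t,\Gamma)\tilde q(dz|x,u)\right)du$. These constructions apply to a $Q$-function on any Borel space. The Markov pure jump process $(X_t)$ with transition function $P_q$ and initial state $x\in S$ (law $\mathbb P^q_x$, expectation $\mathbb E^q_x$): $x_0=x$, $t_0=0$, and, given the past up to the jump moment $t_n<\infty$ with post-jump state $x_n\in S$, the next pair $(t_{n+1},x_{n+1})$ has conditional law $e^{-\int_{t_n}^tq_{x_n}(v)dv}\tilde q(dy|x_n,t)\,dt$ on $(t_n,\infty)\times S$, the remaining mass being put on $t_{n+1}=\infty$, $x_{n+1}=x_\infty$,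 where $x_\infty$ is an isolated cemetery point outside the state space; $X_t=x_n$ for $t_n\le t<t_{n+1}$ and $X_t=x_\infty$ for $t\ge t_\infty:=\lim_nt_n$. The process is nonexplosive if $\mathbb P_x^q(t_\infty=\infty)=1$ for every initial state $x$. Functions on $S$ are extended by $0$ at $x_\infty$, so $\mathbb E^q_x[h(X_t)]=\int_Sh(y)P_q(0,x,t,dy)$. A $c$-drift function with respect to $q$ is a $(0,\infty)$-valued measurable function $f$ on $S$ such that for all $x\in S$, $s\ge0$: $\int_Sf(y)\tilde q(dy|x,s)<\infty$ and $\int_Sf(y)q(dy|x,s):=\int_Sf(y)\tilde q(dy|x,s)-q_x(s)f(x)\le cf(x)$. (For such $f$, the positive part of $\int_S f(y)q(dy|X_s,s)$ is integrable, so the right-hand side in (a) is well defined.) A real-valued function $g$ on $S$ is $f$-bounded if it is measurable and $\sup_{x\in S}|g(x)|/f(x)<\infty$. The $f$-transformed $Q$-function $q^f$ is the conservative stable $Q$-function on $S_\delta:=S\cup\{\delta\}$, $\delta\notin S$ an isolated point ($\delta\neq x_\infty$), given by $q^f(\Gamma|x,s)=\frac1{f(x)}\int_\Gamma f(y)q(dy|x,s)$ for $x\in S$, $\Gamma\in\mathcal B(S)$, $x\notin\Gamma$; $q^f(\{\delta\}|x,s)=c-\frac1{f(x)}\int_Sf(y)q(dy|x,s)$ for $x\in S$; and $q^f(S|\delta,s)=0$ ($\delta$ is absorbing). Hence $q^f_x(s)=c+q_x(s)$ for $x\in S$. *)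

theory Defs
  imports "HOL-Probability.Probability"
begin

text \<open>
  Adjoining an isolated point \<^term>\<open>None\<close> to a measurable space. It serves both for the absorbing
  state of the transformed process and for the value of an embedded chain that has stopped jumping.
\<close>

definition option_space :: "'a measure \<Rightarrow> 'a option measure" where
  "option_space M =
    sigma (insert None (Some ` space M)) {A. A \<subseteq> insert None (Some ` space M) \<and> Some -` A \<in> sets M}"

text \<open>Extension of a function on the state space by 0 at the cemetery \<^term>\<open>None\<close>.\<close>

definition ext0 :: "('a \<Rightarrow> real) \<Rightarrow> 'a option \<Rightarrow> real" where
  "ext0 h z = (case z of None \<Rightarrow> 0 | Some y \<Rightarrow> h y)"

text \<open>
  The Lebesgue integral with values in \<open>[-\<infinity>, \<infinity>]\<close>; it is meaningful as soon as the positive or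
  the negative part has a finite integral.
\<close>

definition extended_integral :: "'a measure \<Rightarrow> ('a \<Rightarrow> ereal) \<Rightarrow> ereal" where
  "extended_integral N h =
    enn2ereal (\<integral>\<^sup>+ w. e2ennreal (h w) \<partial>N) - enn2ereal (\<integral>\<^sup>+ w. e2ennreal (- h w) \<partial>N)"

text \<open>Time runs through \<open>[0, \<infinity>)\<close>; values of a Q-function at negative times are irrelevant.\<close>

abbreviation time_space :: "real measure" where
  "time_space \<equiv> restrict_space borel {0..}"

text \<open>
  \<open>q x s \<Gamma>\<close> stands for \<open>q(\<Gamma>|x,s)\<close>. Real values are no restriction: conditions (1) and (2) below
  make \<open>q(\<cdot>|x,s)\<close> a finite signed measure.
\<close>

definition signed_kernel :: "'a measure \<Rightarrow> ('a \<Rightarrow> real \<Rightarrow> 'a set \<Rightarrow> real) \<Rightarrow> bool" where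
  "signed_kernel M q \<longleftrightarrow>
    (\<forall>x\<in>space M. \<forall>s\<ge>0. \<forall>A :: nat \<Rightarrow> 'a set. range A \<subseteq> sets M \<longrightarrow> disjoint_family A \<longrightarrow>
      (\<lambda>n. q x s (A n)) sums q x s (\<Union>n. A n)) \<and>
    (\<forall>\<Gamma>\<in>sets M. (\<lambda>(x, s). q x s \<Gamma>) \<in> borel_measurable (M \<Otimes>\<^sub>M time_space))"

definition Q_function :: "'a measure \<Rightarrow> ('a \<Rightarrow> real \<Rightarrow> 'a set \<Rightarrow> real) \<Rightarrow> bool" where
  "Q_function M q \<longleftrightarrow> signed_kernel M q \<and>
    (\<forall>x\<in>space M. \<forall>s\<ge>0. \<forall>\<Gamma>\<in>sets M. x \<notin> \<Gamma> \<longrightarrow> 0 \<le> q x s \<Gamma>) \<and>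
    (\<forall>x\<in>space M. \<forall>s\<ge>0. q x s (space M) = 0) \<and>
    (\<forall>x\<in>space M. bdd_above ((\<lambda>s. q x s (space M - {x})) ` {0..}))"

definition q_tilde :: "'a measure \<Rightarrow> ('a \<Rightarrow> real \<Rightarrow> 'a set \<Rightarrow> real) \<Rightarrow> 'a \<Rightarrow> real \<Rightarrow> 'a measure" where
  "q_tilde M q x s = measure_of (space M) (sets M) (\<lambda>\<Gamma>. ennreal (q x s (\<Gamma> - {x})))"

definition q_rate :: "('a \<Rightarrow> real \<Rightarrow> 'a set \<Rightarrow> real) \<Rightarrow> 'a \<Rightarrow> real \<Rightarrow> real" where
  "q_rate q x s = - q x s {x}"

text \<open>The integral of \<open>h\<close> with respect to the signed measure \<open>q(\<cdot>|x,s)\<close>.\<close>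

definition q_integral ::
    "'a measure \<Rightarrow> ('a \<Rightarrow> real \<Rightarrow> 'a set \<Rightarrow> real) \<Rightarrow> ('a \<Rightarrow> real) \<Rightarrow> real \<Rightarrow> 'a \<Rightarrow> real" where
  "q_integral M q h s x = (LINT y|q_tilde M q x s. h y) - q_rate q x s * h x"

text \<open>
  A path is encoded by its embedded chain: \<open>\<omega> n = Some (t\<^sub>n, x\<^sub>n)\<close> if the \<open>n\<close>-th jump takes place,
  and \<open>\<omega> n = None\<close> encodes \<open>t\<^sub>n = \<infinity>\<close>, \<open>x\<^sub>n = x\<^sub>\<infinity>\<close>.
\<close>

type_synonym 'a chain = "nat \<Rightarrow> (real \<times> 'a) option"

abbreviation chain_space :: "'a measure \<Rightarrow> (real \<times> 'a) option measure" where
  "chain_space M \<equiv> option_space (time_space \<Otimes>\<^sub>M M)"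

definition survival :: "('a \<Rightarrow> real \<Rightarrow> 'a set \<Rightarrow> real) \<Rightarrow> 'a \<Rightarrow> real \<Rightarrow> real \<Rightarrow> real" where
  "survival q x t u = exp (- (LBINT v:{t..u}. q_rate q x v))"

text \<open>Conditional law of the next jump time and post-jump state, given the current ones.\<close>

definition jump_kernel ::
    "'a measure \<Rightarrow> ('a \<Rightarrow> real \<Rightarrow> 'a set \<Rightarrow> real) \<Rightarrow> (real \<times> 'a) option \<Rightarrow> (real \<times> 'a) option measure" where
  "jump_kernel M q z = (case z of
     None \<Rightarrow> return (chain_space M) None
   | Some (t, x) \<Rightarrow>
       (let jump = (\<lambda>A. \<integral>\<^sup>+u\<in>{t<..}. ennreal (survival q x t u) *
              emeasure (q_tilde M q x u) {y \<in> space M. Some (u, y) \<in> A} \<partial>lborel)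
        in measure_of (space (chain_space M)) (sets (chain_space M))
             (\<lambda>A. jump A + (1 - jump (space (chain_space M))) * indicator A None)))"

text \<open>
  The law of the embedded chain started from \<open>t\<^sub>0 = 0\<close>, \<open>x\<^sub>0 = x\<close>, provided by the Ionescu-Tulcea
  theorem on the sequence space. The law of \<open>X\<^sub>t\<close> below, restricted to the state space, is the
  transition function \<open>P\<^sub>q(0, x, t, \<cdot>)\<close>; expectations are taken on paths, so \<open>P\<^sub>q\<close> itself is not needed.
\<close>

definition jump_law ::
    "'a measure \<Rightarrow> ('a \<Rightarrow> real \<Rightarrow> 'a set \<Rightarrow> real) \<Rightarrow> 'a \<Rightarrow> 'a chain measure" where
  "jump_law M q x = projective_family.lim UNIV
     (Ionescu_Tulcea.CI
        (\<lambda>n \<omega>. case n of 0 \<Rightarrow> return (chain_space M) (Some (0, x)) | Suc m \<Rightarrow> jump_kernel M q (\<omega> m))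
        (\<lambda>_. chain_space M))
     (\<lambda>_. chain_space M)"

definition jump_time :: "'a chain \<Rightarrow> nat \<Rightarrow> ereal" where
  "jump_time \<omega> n = (case \<omega> n of None \<Rightarrow> \<infinity> | Some (t, _) \<Rightarrow> ereal t)"

definition explosion_time :: "'a chain \<Rightarrow> ereal" where
  "explosion_time \<omega> = lim (jump_time \<omega>)"

text \<open>
  The state \<open>X\<^sub>t\<close>, where \<^term>\<open>None\<close> is the cemetery. Almost surely the jump times increase strictly
  as long as they are finite, so the index \<open>n\<close> is unique if it exists, and it exists exactly when
  \<open>t\<close> is below the explosion time.
\<close>

definition jump_state :: "'a chain \<Rightarrow> real \<Rightarrow> 'a option" where
  "jump_state \<omega> t =
    (let now = (\<lambda>n. jump_time \<omega> n \<le> ereal t \<and> ereal t < jump_time \<omega> (Suc n))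
     in if \<exists>n. now n then map_option snd (\<omega> (LEAST n. now n)) else None)"

definition nonexplosive :: "'a measure \<Rightarrow> ('a \<Rightarrow> real \<Rightarrow> 'a set \<Rightarrow> real) \<Rightarrow> bool" where
  "nonexplosive M q \<longleftrightarrow> (\<forall>x\<in>space M. AE \<omega> in jump_law M q x. explosion_time \<omega> = \<infinity>)"

definition drift_function ::
    "'a measure \<Rightarrow> ('a \<Rightarrow> real \<Rightarrow> 'a set \<Rightarrow> real) \<Rightarrow> real \<Rightarrow> ('a \<Rightarrow> real) \<Rightarrow> bool" where
  "drift_function M q c f \<longleftrightarrow> f \<in> borel_measurable M \<and> (\<forall>x\<in>space M. 0 < f x) \<and>
    (\<forall>x\<in>space M. \<forall>s\<ge>0.
      (\<integral>\<^sup>+y. ennreal (f y) \<partial>q_tilde M q x s) < \<infinity> \<and> q_integral M q f s x \<le> c * f x)"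

definition f_bounded :: "'a measure \<Rightarrow> ('a \<Rightarrow> real) \<Rightarrow> ('a \<Rightarrow> real) \<Rightarrow> bool" where
  "f_bounded M f g \<longleftrightarrow> g \<in> borel_measurable M \<and> bdd_above ((\<lambda>x. \<bar>g x\<bar> / f x) ` space M)"

text \<open>
  The transformed Q-function on \<^term>\<open>option_space M\<close>, with \<^term>\<open>None\<close> as the absorbing point
  \<open>\<delta>\<close>. The last summand is the value at the current state forced by conservativeness.
\<close>

definition f_transform ::
    "'a measure \<Rightarrow> ('a \<Rightarrow> real \<Rightarrow> 'a set \<Rightarrow> real) \<Rightarrow> real \<Rightarrow> ('a \<Rightarrow> real)
      \<Rightarrow> 'a option \<Rightarrow> real \<Rightarrow> 'a option set \<Rightarrow> real" where
  "f_transform M q c f z s \<Gamma> = (case z of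
     None \<Rightarrow> 0
   | Some x \<Rightarrow> (LINT y:(Some -` \<Gamma>)|q_tilde M q x s. f y) / f x
       + (c - q_integral M q f s x / f x) * indicator \<Gamma> None
       - (c + q_rate q x s) * indicator \<Gamma> (Some x))"

text \<open>The identity between the three expressions for \<open>g\<close>, at all initial states and times.\<close>

definition forward_identity ::
    "'a measure \<Rightarrow> ('a \<Rightarrow> real \<Rightarrow> 'a set \<Rightarrow> real) \<Rightarrow> ('a \<Rightarrow> real) \<Rightarrow> bool" where
  "forward_identity M q g \<longleftrightarrow> (\<forall>x\<in>space M. \<forall>t\<ge>0.
     (LINT \<omega>|jump_law M q x. ext0 g (jump_state \<omega> t)) - g x =
       (LBINT s:{0..t}. (LINT \<omega>|jump_law M q x. ext0 (q_integral M q g s) (jump_state \<omega> s))) \<and>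
     (LBINT s:{0..t}. (LINT \<omega>|jump_law M q x. ext0 (q_integral M q g s) (jump_state \<omega> s))) =
       (LINT \<omega>|jump_law M q x. (LBINT s:{0..t}. ext0 (q_integral M q g s) (jump_state \<omega> s))))"

definition forward_integrable ::
    "'a measure \<Rightarrow> ('a \<Rightarrow> real \<Rightarrow> 'a set \<Rightarrow> real) \<Rightarrow> ('a \<Rightarrow> real) \<Rightarrow> bool" where
  "forward_integrable M q g \<longleftrightarrow> (\<forall>x\<in>space M. \<forall>t\<ge>0.
     (\<integral>\<^sup>+s\<in>{0..t}. (\<integral>\<^sup>+\<omega>. ennreal \<bar>ext0 (q_integral M q g s) (jump_state \<omega> s)\<bar> \<partial>jump_law M q x) \<partial>lborel) < \<infinity>)"

text \<open>
  Condition (a). For a drift function only the positive part of the integrand on the right is known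
  to be integrable beforehand, so the right-hand side is a priori in \<open>[-\<infinity>, \<infinity>)\<close>.
\<close>

definition drift_identity ::
    "'a measure \<Rightarrow> ('a \<Rightarrow> real \<Rightarrow> 'a set \<Rightarrow> real) \<Rightarrow> ('a \<Rightarrow> real) \<Rightarrow> bool" where
  "drift_identity M q f \<longleftrightarrow> (\<forall>x\<in>space M. \<forall>t\<ge>0.
     extended_integral (jump_law M q x) (\<lambda>\<omega>. ereal (ext0 f (jump_state \<omega> t))) - ereal (f x) =
       extended_integral (restrict_space lborel {0..t}) (\<lambda>s.
         extended_integral (jump_law M q x)
           (\<lambda>\<omega>. ereal (ext0 (q_integral M q f s) (jump_state \<omega> s)))))"

end

theory Submission
  imports Defs
begin

text \<open>
  Let \<open>WP b n t h\<close> be the expectation of \<open>exp (- b t\<^sub>n) h(x\<^sub>n)\<close> on the event that the \<open>n\<close>-th jump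
  occurs up to time \<open>t\<close>, and \<open>Pn n s h\<close> that of \<open>h(X\<^sub>s)\<close> on the event of exactly \<open>n\<close> jumps up to \<open>s\<close>.
  The Markov property of the embedded chain gives, for every \<open>b \<ge> 0\<close> and \<open>h \<ge> 0\<close>,
  \<open>WP b n t h = exp (- b t) Pn n t h + \<integral>\<^sub>0\<^sup>t exp (- b s) Pn n s ((b + q\<^sub>x(s)) h) ds\<close> and
  \<open>WP b (n + 1) t h = \<integral>\<^sub>0\<^sup>t exp (- b s) Pn n s (\<integral> h dq') ds\<close>, where \<open>q'\<close> is the jump part of \<open>q\<close>.
  For the drift function \<open>f\<close> and \<open>b = c\<close> these telescope and bound all quantities involved; for
  \<open>b = 0\<close> they telescope to Dynkin's formula, in which \<open>lim WP 0 n t f\<close> is the only defect. Its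
  vanishing therefore is equivalent to (a), and by domination it yields the identity for every
  \<open>f\<close>-bounded \<open>g\<close>. Finally \<open>exp (- c t\<^sub>n) f(x\<^sub>n) / f(x)\<close> is the likelihood ratio between the
  transformed chain that has not been killed and the original one, so that \<open>WP c n t f / f(x)\<close> is the
  probability that the transformed process jumps \<open>n\<close> times up to \<open>t\<close> without being killed; it tends
  to \<open>0\<close> precisely if the transformed process does not explode.
\<close>

section \<open>Adjoining an isolated point\<close>

text \<open>Identities are kept in \<open>ennreal\<close> with every negative term moved to the
  other side: at the start the negative part of the drift of \<open>f\<close> is uncontrolled,
  whereas nonnegative terms can be summed over jumps and interchanged freely. Real numbers enter
  only after finiteness has been proved. The discount rate \<open>c\<close> is chosen because the
  drift inequality makes the rate term for \<open>b = c\<close> dominate the jump gain of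
  \<open>f\<close>; the telescoped sum then consists of nonnegative terms bounded by
  \<open>f x\<close>. For \<open>b = 0\<close> the same surplus leaves a source term
  \<open>c f\<close>, which is finite by the discounted estimate. Both versions of the defect vanish
  together, since the discount of a jump time up to \<open>t\<close> lies between
  \<open>exp (- c t)\<close> and 1. Necessity comes from the test function \<open>g = f\<close>,
  whose drift is absolutely integrable along the process in all cases. The rate is merely measurable
  in time, so its primitive need not be differentiable everywhere and the basic survival identity
  needs a proof of its own.\<close>

lemma sigma_algebra_option:
  "sigma_algebra (insert None (Some ` space M)) {A. A \<subseteq> insert None (Some ` space M) \<and> Some -` A \<in> sets M}"
  unfolding sigma_algebra_iff2
proof (intro conjI allI ballI impI)
  fix A assume "A \<in> {A. A \<subseteq> insert None (Some ` space M) \<and> Some -` A \<in> sets M}"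
  moreover have "Some -` (insert None (Some ` space M) - A) = space M - Some -` A" by auto
  ultimately show "insert None (Some ` space M) - A
      \<in> {A. A \<subseteq> insert None (Some ` space M) \<and> Some -` A \<in> sets M}"
    by auto
next
  fix A :: "nat \<Rightarrow> 'a option set"
  assume A: "range A \<subseteq> {A. A \<subseteq> insert None (Some ` space M) \<and> Some -` A \<in> sets M}"
  have "Some -` (\<Union>i. A i) = (\<Union>i. Some -` A i)" by auto
  also have "\<dots> \<in> sets M" using A by (intro sets.countable_UN) auto
  finally show "(\<Union>i. A i) \<in> {A. A \<subseteq> insert None (Some ` space M) \<and> Some -` A \<in> sets M}"
    using A by auto
qed auto

lemma space_option_space [simp]: "space (option_space M) = insert None (Some ` space M)"
  unfolding option_space_def by (rule space_measure_of) auto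

lemma sets_option_space:
  "sets (option_space M) = {A. A \<subseteq> insert None (Some ` space M) \<and> Some -` A \<in> sets M}"
proof -
  interpret sigma_algebra "insert None (Some ` space M)"
    "{A. A \<subseteq> insert None (Some ` space M) \<and> Some -` A \<in> sets M}"
    by (rule sigma_algebra_option)
  show ?thesis unfolding option_space_def by (rule sets_measure_of_eq)
qed

lemma measurable_Some [measurable]: "Some \<in> M \<rightarrow>\<^sub>M option_space M"
  by (rule measurableI) (auto simp: sets_option_space Int_absorb2 dest: sets.sets_into_space)

text \<open>A set of the option space is measurable as soon as its \<open>Some\<close> part is, so
  \<open>None\<close> only has to be mapped into the target. This reduces measurability over chain
  states to functions of time and state.\<close>

lemma measurable_option_space_iff:
  "F \<in> option_space M \<rightarrow>\<^sub>M N \<longleftrightarrow> F None \<in> space N \<and> (\<lambda>x. F (Some x)) \<in> M \<rightarrow>\<^sub>M N"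
proof safe
  assume F: "F \<in> option_space M \<rightarrow>\<^sub>M N"
  then show "F None \<in> space N" by (auto dest: measurable_space)
  show "(\<lambda>x. F (Some x)) \<in> M \<rightarrow>\<^sub>M N" using measurable_compose[OF measurable_Some F] .
next
  assume *: "F None \<in> space N" "(\<lambda>x. F (Some x)) \<in> M \<rightarrow>\<^sub>M N"
  show "F \<in> option_space M \<rightarrow>\<^sub>M N"
  proof (rule measurableI)
    fix A assume "A \<in> sets N"
    have "Some -` (F -` A \<inter> space (option_space M)) = (\<lambda>x. F (Some x)) -` A \<inter> space M" by auto
    also have "\<dots> \<in> sets M" using *(2) \<open>A \<in> sets N\<close> by (rule measurable_sets)
    finally show "F -` A \<inter> space (option_space M) \<in> sets (option_space M)"
      by (auto simp: sets_option_space)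
  qed (use * in \<open>auto dest: measurable_space\<close>)
qed

lemma sets_singleton_None [measurable]: "{None} \<in> sets (option_space M)"
  by (auto simp: sets_option_space vimage_def)

lemma measurable_is_None [measurable]: "Measurable.pred (option_space M) (\<lambda>z. z = None)"
  by (simp add: measurable_option_space_iff)

text \<open>The branches are separated by an \<open>if\<close> on the measurable event
  \<open>g w = None\<close>; off this event the content of \<open>g w\<close> is extracted by a
  total function, which requires some default point of \<open>M\<close>. If \<open>M\<close> is
  empty, \<open>g\<close> is constantly \<open>None\<close>.\<close>

lemma measurable_case_option' [measurable (raw)]:
  assumes [measurable]: "g \<in> L \<rightarrow>\<^sub>M option_space M" "a \<in> L \<rightarrow>\<^sub>M N" "case_prod b \<in> L \<Otimes>\<^sub>M M \<rightarrow>\<^sub>M N"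
  shows "(\<lambda>w. case g w of None \<Rightarrow> a w | Some y \<Rightarrow> b w y) \<in> L \<rightarrow>\<^sub>M N"
proof (cases "space M = {}")
  case True
  then have "w \<in> space L \<Longrightarrow> g w = None" for w using measurable_space[OF assms(1)] by auto
  then show ?thesis by (subst measurable_cong[where g=a]) auto
next
  case False
  then obtain y0 where y0: "y0 \<in> space M" by auto
  define e where "e = case_option y0 id"
  have [measurable]: "e \<in> option_space M \<rightarrow>\<^sub>M M"
    by (simp add: measurable_option_space_iff e_def y0 id_def)
  have "(\<lambda>w. case g w of None \<Rightarrow> a w | Some y \<Rightarrow> b w y)
      = (\<lambda>w. if g w = None then a w else case_prod b (w, e (g w)))"
    by (auto simp: e_def fun_eq_iff split: option.split)
  also have "\<dots> \<in> L \<rightarrow>\<^sub>M N" by measurable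
  finally show ?thesis .
qed

text \<open>Supplies the standing assumption on the diagonal for the transformed process, whose
  state space has the extra point \<open>None\<close>.\<close>

lemma sets_diagonal_option:
  assumes diag: "{p \<in> space (M \<Otimes>\<^sub>M M). fst p = snd p} \<in> sets (M \<Otimes>\<^sub>M M)"
  shows "{p \<in> space (option_space M \<Otimes>\<^sub>M option_space M). fst p = snd p}
    \<in> sets (option_space M \<Otimes>\<^sub>M option_space M)"
proof -
  have [measurable]: "Measurable.pred (M \<Otimes>\<^sub>M M) (\<lambda>p. fst p = snd p)"
    using diag by (simp add: pred_def)
  have *: "(\<lambda>p. fst p = snd p) = (\<lambda>p. case fst p of None \<Rightarrow> snd p = None
     | Some x \<Rightarrow> (case snd p of None \<Rightarrow> False | Some y \<Rightarrow> fst (x, y) = snd (x, y)))"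
    by (auto simp: fun_eq_iff split: option.split)
  have "Measurable.pred (option_space M \<Otimes>\<^sub>M option_space M) (\<lambda>p. fst p = snd p)"
    unfolding * by measurable
  then show ?thesis by (simp add: pred_def)
qed

section \<open>The integral of a rate against its survival function\<close>

lemma set_integrable_bounded:
  fixes r :: "real \<Rightarrow> real"
  assumes [measurable]: "set_borel_measurable lborel {u..t} r"
    and "\<And>s. s \<in> {u..t} \<Longrightarrow> \<bar>r s\<bar> \<le> B"
  shows "set_integrable lborel {u..t} r"
  unfolding set_integrable_def
proof (rule Bochner_Integration.integrable_bound[where f="\<lambda>s. indicator {u..t} s *\<^sub>R B"])
  show "integrable lborel (\<lambda>s. indicator {u..t} s *\<^sub>R B)"
    by (cases "u \<le> t") auto
qed (use assms in \<open>auto simp: set_borel_measurable_def intro!: AE_I2 order_trans[OF _ abs_ge_self]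
    split: split_indicator\<close>)

lemma set_lebesgue_integral_lborel_point: "(LBINT s:{u..u::real}. (r s :: real)) = 0"
proof -
  have "AE s in lborel. indicator {u..u} s *\<^sub>R r s = 0"
    using AE_lborel_singleton[of u] by eventually_elim (simp add: indicator_def)
  then show ?thesis unfolding set_lebesgue_integral_def by (rule integral_eq_zero_AE)
qed

text \<open>The increments of the difference of both sides are of second order, since the primitive
  \<open>R\<close> is Lipschitz; hence its derivative vanishes everywhere, not only almost everywhere.\<close>

lemma integral_rate_times_survival:
  fixes r :: "real \<Rightarrow> real"
  assumes meas: "set_borel_measurable lborel {u..T} r"
    and bound: "\<And>s. s \<in> {u..T} \<Longrightarrow> 0 \<le> r s \<and> r s \<le> B"
    and uT: "u \<le> T"
  defines "R \<equiv> \<lambda>t. LBINT s:{u..t}. r s"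
  shows "set_integrable lborel {u..T} (\<lambda>s. r s * exp (- R s))"
    and "(LBINT s:{u..T}. r s * exp (- R s)) = 1 - exp (- R T)"
proof -
  have B0: "0 \<le> B" using bound[of u] uT by auto
  have meas': "set_borel_measurable lborel {a..b} r" if "u \<le> a" "b \<le> T" for a b
    by (rule set_borel_measurable_subset[OF meas]) (use that in auto)
  have int: "set_integrable lborel {a..b} r" if "u \<le> a" "b \<le> T" for a b
    by (rule set_integrable_bounded[where B=B]) (use bound meas' that in auto)
  \<comment> \<open>The two intervals overlap in the point \<open>a\<close>, a null set.\<close>
  have split: "R b = R a + (LBINT s:{a..b}. r s)" if "u \<le> a" "a \<le> b" "b \<le> T" for a b
  proof -
    have "(LBINT s:{u..b}. r s) = (LBINT s:{u..a} \<union> {a..b}. r s)"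
      using that by (intro arg_cong2[where f="set_lebesgue_integral lborel"]) auto
    also have "\<dots> = R a + (LBINT s:{a..b}. r s)" unfolding R_def
    proof (rule set_integral_Un_AE)
      show "AE x in lborel. \<not> (x \<in> {u..a} \<and> x \<in> {a..b})"
        using AE_lborel_singleton[of a] by eventually_elim auto
    qed (use that int in auto)
    finally show ?thesis by (simp add: R_def)
  qed
  have inc: "0 \<le> (LBINT s:{a..b}. r s)" "(LBINT s:{a..b}. r s) \<le> B * (b - a)"
    if "u \<le> a" "a \<le> b" "b \<le> T" for a b
  proof -
    show "0 \<le> (LBINT s:{a..b}. r s)"
      unfolding set_lebesgue_integral_def using bound that
      by (intro Bochner_Integration.integral_nonneg) (auto split: split_indicator)
    have "(LBINT s:{a..b}. r s) \<le> (LBINT s:{a..b}. B)"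
      using that bound by (intro set_integral_mono int) (auto simp: set_integrable_def)
    then show "(LBINT s:{a..b}. r s) \<le> B * (b - a)"
      using that by (simp add: set_lebesgue_integral_def mult.commute)
  qed
  have mono: "R a \<le> R b" if "u \<le> a" "a \<le> b" "b \<le> T" for a b
    using split[OF that] inc(1)[OF that] by simp
  have Ru: "R u = 0" unfolding R_def by (rule set_lebesgue_integral_lborel_point)
  \<comment> \<open>Continuity makes \<open>exp (- R s)\<close> measurable on the interval.\<close>
  have cont: "continuous_on {u..T} R"
  proof (rule continuous_on_def[THEN iffD2], rule ballI)
    show "(R \<longlongrightarrow> R x) (at x within {u..T})" if "x \<in> {u..T}" for x
    proof (rule Lim_null[THEN iffD2], rule tendsto_rabs_zero_cancel)
      have "((\<lambda>y. B * \<bar>y - x\<bar>) \<longlongrightarrow> B * \<bar>x - x\<bar>) (at x within {u..T})"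
        by (intro tendsto_intros)
      then have lim: "((\<lambda>y. B * \<bar>y - x\<bar>) \<longlongrightarrow> 0) (at x within {u..T})" by simp
      have "\<bar>R y - R x\<bar> \<le> B * \<bar>y - x\<bar>" if "y \<in> {u..T}" for y
        using split[of x y] split[of y x] inc[of x y] inc[of y x] that \<open>x \<in> {u..T}\<close>
        by (cases "x \<le> y") auto
      then show "((\<lambda>y. \<bar>R y - R x\<bar>) \<longlongrightarrow> 0) (at x within {u..T})"
        by (intro tendsto_sandwich[OF _ _ tendsto_const lim]) (auto simp: eventually_at_filter)
    qed
  qed
  have Rmeas: "set_borel_measurable lborel {u..T} (\<lambda>s. exp (- R s))"
    using borel_measurable_continuous_on_indicator[OF _ continuous_on_exp[OF continuous_on_minus[OF cont]]]
    by (simp add: set_borel_measurable_def)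
  have smeas: "set_borel_measurable lborel {u..T} (\<lambda>s. r s * exp (- R s))"
  proof -
    have "(\<lambda>s. (indicator {u..T} s *\<^sub>R r s) * (indicator {u..T} s *\<^sub>R exp (- R s))) \<in> borel_measurable lborel"
      using meas Rmeas unfolding set_borel_measurable_def by (rule borel_measurable_times)
    also have "(\<lambda>s. (indicator {u..T} s *\<^sub>R r s) * (indicator {u..T} s *\<^sub>R exp (- R s)))
      = (\<lambda>s. indicator {u..T} s *\<^sub>R (r s * exp (- R s)))"
      by (auto split: split_indicator)
    finally show ?thesis by (simp add: set_borel_measurable_def)
  qed
  have sint: "set_integrable lborel {a..b} (\<lambda>s. r s * exp (- R s))" if "u \<le> a" "b \<le> T" for a b
  proof (rule set_integrable_bounded[where B=B])
    show "set_borel_measurable lborel {a..b} (\<lambda>s. r s * exp (- R s))"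
      by (rule set_borel_measurable_subset[OF smeas]) (use that in auto)
    show "\<bar>r s * exp (- R s)\<bar> \<le> B" if "s \<in> {a..b}" for s
    proof -
      have s: "u \<le> s" "s \<le> T" using that \<open>u \<le> a\<close> \<open>b \<le> T\<close> by auto
      then have "0 \<le> R s" using mono[of u s] Ru by simp
      then have "r s * exp (- R s) \<le> B * 1" using bound[of s] s B0 by (intro mult_mono) auto
      then show ?thesis using bound[of s] s by (simp add: abs_mult)
    qed
  qed
  show "set_integrable lborel {u..T} (\<lambda>s. r s * exp (- R s))" by (rule sint) auto
  \<comment> \<open>The integral up to \<open>t\<close> plus the survival value at \<open>t\<close>;
    the claim is that this stays at its initial value 1.\<close>
  define \<phi> where "\<phi> t = (LBINT s:{u..t}. r s * exp (- R s)) + exp (- R t)" for t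
  have incr: "\<bar>\<phi> b - \<phi> a\<bar> \<le> B\<^sup>2 * (b - a)\<^sup>2" if ab: "u \<le> a" "a \<le> b" "b \<le> T" for a b
  proof -
    define D where "D = (LBINT s:{a..b}. r s)"
    define I where "I = (LBINT s:{a..b}. r s * exp (- R s))"
    have D: "0 \<le> D" "D \<le> B * (b - a)" "R b = R a + D"
      using inc[OF ab] split[OF ab] by (auto simp: D_def)
    have "(LBINT s:{u..b}. r s * exp (- R s)) = (LBINT s:{u..a} \<union> {a..b}. r s * exp (- R s))"
      using that by (intro arg_cong2[where f="set_lebesgue_integral lborel"]) auto
    also have "\<dots> = (LBINT s:{u..a}. r s * exp (- R s)) + I" unfolding I_def
    proof (rule set_integral_Un_AE)
      show "AE x in lborel. \<not> (x \<in> {u..a} \<and> x \<in> {a..b})"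
        using AE_lborel_singleton[of a] by eventually_elim auto
    qed (use that sint in auto)
    finally have \<phi>: "\<phi> b - \<phi> a = I - (exp (- R a) - exp (- R b))"
      by (simp add: \<phi>_def)
    \<comment> \<open>By monotonicity of \<open>R\<close>, freezing \<open>exp (- R s)\<close> at
      either endpoint puts \<open>I\<close> between \<open>D * exp (- R b)\<close> and
      \<open>D * exp (- R a)\<close>. Below, \<open>e1\<close> and \<open>e2\<close> put the
      decrease \<open>exp (- R a) - exp (- R b)\<close> between the same bounds.\<close>
    have I1: "I \<le> D * exp (- R a)"
    proof -
      have "I \<le> (LBINT s:{a..b}. r s * exp (- R a))"
        unfolding I_def
        using ab bound mono by (intro set_integral_mono sint set_integrable_mult_left int)
          (auto intro!: mult_left_mono)
      then show ?thesis by (simp add: D_def)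
    qed
    have I2: "D * exp (- R b) \<le> I"
    proof -
      have "(LBINT s:{a..b}. r s * exp (- R b)) \<le> I"
        unfolding I_def
        using ab bound mono by (intro set_integral_mono sint set_integrable_mult_left int)
          (auto intro!: mult_left_mono)
      then show ?thesis by (simp add: D_def)
    qed
    have eb: "exp (- R b) = exp (- R a) * exp (- D)" by (simp add: D(3) exp_add[symmetric])
    have 1: "1 - exp (- D) \<le> D" using exp_ge_add_one_self[of "- D"] by simp
    have 2: "D * exp (- D) \<le> 1 - exp (- D)"
    proof -
      have "(1 + D) * exp (- D) \<le> exp D * exp (- D)"
        by (rule mult_right_mono[OF exp_ge_add_one_self]) simp
      also have "\<dots> = 1" by (simp add: exp_add[symmetric])
      finally show ?thesis by (simp add: algebra_simps)
    qed
    have e1: "exp (- R a) - exp (- R b) \<le> D * exp (- R a)"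
      using mult_left_mono[OF 1, of "exp (- R a)"] by (simp add: eb algebra_simps)
    have e2: "D * exp (- R b) \<le> exp (- R a) - exp (- R b)"
      using mult_left_mono[OF 2, of "exp (- R a)"] by (simp add: eb algebra_simps)
    \<comment> \<open>Two numbers in the same interval differ by at most its length, which is
      \<open>D\<close> times a decrease of \<open>exp (- R s)\<close> that is itself at most
      \<open>D\<close>.\<close>
    have "\<bar>\<phi> b - \<phi> a\<bar> \<le> D * exp (- R a) - D * exp (- R b)"
      using \<phi> I1 I2 e1 e2 by linarith
    also have "\<dots> = D * (exp (- R a) - exp (- R b))" by (simp add: algebra_simps)
    also have "\<dots> \<le> D * D"
    proof (rule mult_left_mono)
      have "0 \<le> R a" using mono[of u a] ab Ru by simp
      then have "D * exp (- R a) \<le> D * 1" using D by (intro mult_left_mono) auto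
      then show "exp (- R a) - exp (- R b) \<le> D" using e1 by simp
    qed (use D in auto)
    also have "\<dots> \<le> (B * (b - a)) * (B * (b - a))"
      using D by (intro mult_mono) auto
    finally show ?thesis by (simp add: power2_eq_square algebra_simps)
  qed
  have "\<phi> T = \<phi> u"
  proof (cases "u = T")
    case False
    have der: "(\<phi> has_real_derivative 0) (at x within {u..T})" if "x \<in> {u..T}" for x
    proof -
      have "((\<lambda>y. B\<^sup>2 * \<bar>y - x\<bar>) \<longlongrightarrow> B\<^sup>2 * \<bar>x - x\<bar>) (at x within {u..T})"
        by (intro tendsto_intros)
      then have lim: "((\<lambda>y. B\<^sup>2 * \<bar>y - x\<bar>) \<longlongrightarrow> 0) (at x within {u..T})" by simp
      have "norm ((\<phi> y - \<phi> x) / (y - x)) \<le> B\<^sup>2 * \<bar>y - x\<bar>" if "y \<in> {u..T}" "y \<noteq> x" for y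
      proof -
        have "\<bar>\<phi> y - \<phi> x\<bar> \<le> B\<^sup>2 * (y - x)\<^sup>2"
          using incr[of x y] incr[of y x] that \<open>x \<in> {u..T}\<close>
          by (cases "x \<le> y") (auto simp: abs_minus_commute power2_commute)
        also have "\<dots> = (B\<^sup>2 * \<bar>y - x\<bar>) * \<bar>y - x\<bar>" by (simp add: power2_eq_square[of "y - x"] abs_mult_self_eq)
        finally show ?thesis using that by (simp add: divide_le_eq abs_divide)
      qed
      then have "((\<lambda>y. (\<phi> y - \<phi> x) / (y - x)) \<longlongrightarrow> 0) (at x within {u..T})"
        by (intro Lim_null_comparison[OF _ lim]) (auto simp: eventually_at_filter)
      then show ?thesis by (simp add: has_field_derivative_iff)
    qed
    have "\<exists>k. \<forall>x\<in>{u..T}. \<phi> x = k"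
      by (rule has_field_derivative_zero_constant) (use der in auto)
    then show ?thesis using uT by auto
  qed simp
  also have "\<phi> u = 1" by (simp add: \<phi>_def Ru set_lebesgue_integral_lborel_point del: atLeastAtMost_singleton)
  finally show "(LBINT s:{u..T}. r s * exp (- R s)) = 1 - exp (- R T)"
    by (simp add: \<phi>_def)
qed

section \<open>Integration against the jump kernel of a Q-function\<close>

text \<open>The measure that goes with \<open>time_space\<close>. Integrands built from
  \<open>q\<close> are known to be measurable at nonnegative times only, and integrating over the
  half-line avoids extending them.\<close>

abbreviation halfline :: "real measure" where
  "halfline \<equiv> restrict_space lborel {0..}"

interpretation halfline: sigma_finite_measure halfline
  by (rule sigma_finite_measure_restrict_space) (auto intro: lborel.sigma_finite_measure_axioms)

lemma sets_halfline: "sets halfline = sets time_space"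
  by (rule sets_restrict_space_cong) simp

lemma space_time [simp]: "space time_space = {0..}"
  by (simp add: space_restrict_space)

lemma borel_measurable_nn_integral_halfline:
  assumes "(\<lambda>(w, s). k w s) \<in> borel_measurable (L \<Otimes>\<^sub>M time_space)"
  shows "(\<lambda>w. \<integral>\<^sup>+s. k w s \<partial>halfline) \<in> borel_measurable L"
  by (rule halfline.borel_measurable_nn_integral)
     (use assms in \<open>simp add: measurable_cong_sets[OF sets_pair_measure_cong[OF refl sets_halfline] refl]\<close>)

lemma borel_measurable_halfline:
  "k \<in> borel_measurable time_space \<Longrightarrow> k \<in> borel_measurable halfline"
  by (simp add: measurable_cong_sets[OF sets_halfline refl])

lemma nn_integral_halfline_mono:
  "(\<And>s. 0 \<le> s \<Longrightarrow> f s \<le> g s) \<Longrightarrow> (\<integral>\<^sup>+s. f s \<partial>halfline) \<le> (\<integral>\<^sup>+s. g s \<partial>halfline)"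
  by (intro nn_integral_mono) (simp add: space_restrict_space)

lemma nn_integral_halfline_cong:
  "(\<And>s. 0 \<le> s \<Longrightarrow> f s = g s) \<Longrightarrow> (\<integral>\<^sup>+s. f s \<partial>halfline) = (\<integral>\<^sup>+s. g s \<partial>halfline)"
  by (intro nn_integral_cong) (simp add: space_restrict_space)

lemma nn_integral_halfline_restrict:
  assumes "A \<subseteq> {0..}"
  shows "(\<integral>\<^sup>+s. f s * indicator A s \<partial>halfline) = (\<integral>\<^sup>+s\<in>A. f s \<partial>lborel)"
  using assms by (subst nn_integral_restrict_space) (auto intro!: nn_integral_cong split: split_indicator)

text \<open>Truncation at 0 turns a real number into an admissible time. It extends the rate to the
  whole line where an integral with respect to \<open>lborel\<close> has to be measurable.\<close>

lemma measurable_max_time [measurable (raw)]: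
  "f \<in> borel_measurable L \<Longrightarrow> (\<lambda>w. max 0 (f w :: real)) \<in> L \<rightarrow>\<^sub>M time_space"
  by (rule measurable_restrict_space2) auto

lemma measurable_time_borel [measurable_dest]:
  "f \<in> L \<rightarrow>\<^sub>M time_space \<Longrightarrow> f \<in> borel_measurable L"
  by (simp add: measurable_restrict_space2_iff)

lemma measurable_ident_time [measurable]: "(\<lambda>s. s) \<in> borel_measurable time_space"
  by (rule measurable_restrict_space1) simp

lemma measurable_fst_time [measurable]: "fst \<in> borel_measurable (time_space \<Otimes>\<^sub>M N)"
  by (rule measurable_time_borel) measurable

lemma measurable_snd_time [measurable]: "snd \<in> borel_measurable (N \<Otimes>\<^sub>M time_space)"
  by (rule measurable_time_borel) measurable

text \<open>The measurable diagonal is what is used of the Borel structure of the state space: it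
  makes singletons measurable and lets \<open>{x}\<close> vary measurably with \<open>x\<close>. The
  locale is instantiated a second time with the transformed Q-function on
  \<open>option_space M\<close>.\<close>

locale jump_process =
  fixes M :: "'a measure" and q :: "'a \<Rightarrow> real \<Rightarrow> 'a set \<Rightarrow> real"
  assumes Q: "Q_function M q" and nonempty: "space M \<noteq> {}"
    and diagonal: "{p \<in> space (M \<Otimes>\<^sub>M M). fst p = snd p} \<in> sets (M \<Otimes>\<^sub>M M)"
begin

section \<open>Additivity, sections and rates of a Q-function\<close>

lemma q_sums:
  "x \<in> space M \<Longrightarrow> 0 \<le> s \<Longrightarrow> range A \<subseteq> sets M \<Longrightarrow> disjoint_family A \<Longrightarrow> (\<lambda>n::nat. q x s (A n)) sums q x s (\<Union>n. A n)"
  using Q unfolding Q_function_def signed_kernel_def by blast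

lemma q_measurable: "\<Gamma> \<in> sets M \<Longrightarrow> (\<lambda>(x, s). q x s \<Gamma>) \<in> borel_measurable (M \<Otimes>\<^sub>M time_space)"
  using Q unfolding Q_function_def signed_kernel_def by blast

lemma q_nonneg: "x \<in> space M \<Longrightarrow> 0 \<le> s \<Longrightarrow> \<Gamma> \<in> sets M \<Longrightarrow> x \<notin> \<Gamma> \<Longrightarrow> 0 \<le> q x s \<Gamma>"
  using Q unfolding Q_function_def by blast

lemma q_space: "x \<in> space M \<Longrightarrow> 0 \<le> s \<Longrightarrow> q x s (space M) = 0"
  using Q unfolding Q_function_def by blast

text \<open>Countable additivity for the sequence of empty sets gives a convergent constant series,
  which forces the value 0.\<close>

lemma q_empty: "q x s {} = 0" if "x \<in> space M" "0 \<le> s"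
  using q_sums[OF that, of "\<lambda>_. {}"] by (auto simp: disjoint_family_on_def summable_const_iff dest!: sums_summable)

lemma q_Un:
  assumes "x \<in> space M" "0 \<le> s" "A \<in> sets M" "B \<in> sets M" "A \<inter> B = {}"
  shows "q x s (A \<union> B) = q x s A + q x s B"
proof -
  have "(\<lambda>n. q x s (binaryset A B n)) sums q x s (\<Union>n. binaryset A B n)"
    using assms by (intro q_sums) (auto simp: range_binaryset_eq disjoint_family_on_def binaryset_def)
  moreover have "(\<lambda>n. q x s (binaryset A B n)) sums (q x s A + q x s B)"
    by (rule binaryset_sums) (rule q_empty[OF assms(1,2)])
  ultimately show ?thesis by (simp add: UN_binaryset_eq sums_unique2)
qed

lemma q_compl: "x \<in> space M \<Longrightarrow> 0 \<le> s \<Longrightarrow> A \<in> sets M \<Longrightarrow> q x s (space M - A) = - q x s A"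
  using q_Un[of x s A "space M - A"] q_space[of x s] sets.sets_into_space[of A M]
  by (simp add: Un_absorb1)

lemma sets_singleton: "{x} \<in> sets M" if "x \<in> space M"
proof -
  have "Pair x -` {p \<in> space (M \<Otimes>\<^sub>M M). fst p = snd p} \<in> sets M"
    by (rule sets_Pair1[OF diagonal])
  also have "Pair x -` {p \<in> space (M \<Otimes>\<^sub>M M). fst p = snd p} = {x}"
    using that by (auto simp: space_pair_measure)
  finally show ?thesis .
qed

lemma measurable_eq_diagonal:
  assumes "f \<in> L \<rightarrow>\<^sub>M M" "g \<in> L \<rightarrow>\<^sub>M M"
  shows "Measurable.pred L (\<lambda>w. f w = g w)"
proof -
  have "Measurable.pred (M \<Otimes>\<^sub>M M) (\<lambda>p. fst p = snd p)"
    using diagonal by (simp add: pred_def)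
  from measurable_compose[OF measurable_Pair[OF assms] this] show ?thesis by simp
qed

text \<open>The evaluated set may move with the point, as needed for \<open>{x}\<close> and
  \<open>\<Gamma> - {x}\<close>. Rectangles form an intersection-stable generator; since the total
  mass is 0, passing to complements is just a change of sign.\<close>

lemma q_section_measurable:
  assumes a: "a \<in> L \<rightarrow>\<^sub>M M" and b: "b \<in> L \<rightarrow>\<^sub>M time_space" and A: "A \<in> sets (L \<Otimes>\<^sub>M M)"
  shows "(\<lambda>w. q (a w) (b w) (Pair w -` A)) \<in> borel_measurable L"
proof -
  have ab: "a w \<in> space M" "0 \<le> b w" if "w \<in> space L" for w
    using measurable_space[OF a that] measurable_space[OF b that] by auto
  have base: "(\<lambda>w. q (a w) (b w) B) \<in> borel_measurable L" if "B \<in> sets M" for B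
    using measurable_compose[OF measurable_Pair[OF a b] q_measurable[OF that]] by simp
  show ?thesis
    using Int_stable_pair_measure_generator pair_measure_closed A
    unfolding sets_pair_measure
  proof (induct rule: sigma_sets_induct_disjoint)
    case (basic A)
    then obtain B C where A: "A = B \<times> C" "B \<in> sets L" "C \<in> sets M" by auto
    have "(\<lambda>w. q (a w) (b w) (Pair w -` A)) \<in> borel_measurable L \<longleftrightarrow>
      (\<lambda>w. q (a w) (b w) C * indicator B w) \<in> borel_measurable L"
      using ab by (intro measurable_cong) (auto simp: A q_empty split: split_indicator)
    then show ?case using base[OF A(3)] A(2) by simp
  next
    case empty
    have "(\<lambda>w. q (a w) (b w) {}) \<in> borel_measurable L" by (rule base) auto
    then show ?case by simp
  next
    case (compl A)
    then have A: "A \<in> sets (L \<Otimes>\<^sub>M M)" by (simp add: sets_pair_measure)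
    have "(\<lambda>w. q (a w) (b w) (Pair w -` (space L \<times> space M - A))) \<in> borel_measurable L \<longleftrightarrow>
      (\<lambda>w. - q (a w) (b w) (Pair w -` A)) \<in> borel_measurable L"
    proof (rule measurable_cong)
      fix w assume w: "w \<in> space L"
      then have "Pair w -` (space L \<times> space M - A) = space M - Pair w -` A" by auto
      then show "q (a w) (b w) (Pair w -` (space L \<times> space M - A)) = - q (a w) (b w) (Pair w -` A)"
        using ab[OF w] sets_Pair1[OF A] by (simp add: q_compl)
    qed
    then show ?case using compl by simp
  next
    case (union F)
    have F: "F i \<in> sets (L \<Otimes>\<^sub>M M)" for i using union by (auto simp: sets_pair_measure)
    have "(\<lambda>w. q (a w) (b w) (Pair w -` (\<Union>i. F i))) \<in> borel_measurable L \<longleftrightarrow>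
      (\<lambda>w. \<Sum>i. q (a w) (b w) (Pair w -` F i)) \<in> borel_measurable L"
    proof (rule measurable_cong)
      fix w assume w: "w \<in> space L"
      have "(\<lambda>i. q (a w) (b w) (Pair w -` F i)) sums q (a w) (b w) (\<Union>i. Pair w -` F i)"
        using ab[OF w] sets_Pair1[OF F] union(1)
        by (intro q_sums disjoint_family_on_vimageI) auto
      then show "q (a w) (b w) (Pair w -` (\<Union>i. F i)) = (\<Sum>i. q (a w) (b w) (Pair w -` F i))"
        by (simp add: vimage_UN sums_iff)
    qed
    then show ?case using union by (simp add: borel_measurable_suminf)
  qed
qed

lemma sets_q_tilde [simp, measurable_cong]: "sets (q_tilde M q x s) = sets M"
  unfolding q_tilde_def by (simp add: sets.sets_measure_of_eq)

lemma space_q_tilde [simp]: "space (q_tilde M q x s) = space M"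
  by (rule sets_eq_imp_space_eq) simp

lemma emeasure_q_tilde:
  assumes x: "x \<in> space M" "0 \<le> s" and "\<Gamma> \<in> sets M"
  shows "emeasure (q_tilde M q x s) \<Gamma> = ennreal (q x s (\<Gamma> - {x}))"
  unfolding q_tilde_def
proof (rule emeasure_measure_of_sigma)
  show "sigma_algebra (space M) (sets M)" by (rule sets.sigma_algebra_axioms)
  show "positive (sets M) (\<lambda>\<Gamma>. ennreal (q x s (\<Gamma> - {x})))"
    using q_empty[OF x] by (simp add: positive_def)
  show "countably_additive (sets M) (\<lambda>\<Gamma>. ennreal (q x s (\<Gamma> - {x})))"
  proof (rule countably_additiveI)
    fix A :: "nat \<Rightarrow> 'a set"
    assume A: "range A \<subseteq> sets M" "disjoint_family A" "(\<Union>i. A i) \<in> sets M"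
    have "(\<lambda>n. q x s (A n - {x})) sums q x s (\<Union>n. A n - {x})"
      using A sets_singleton[OF x(1)] by (intro q_sums x) (auto simp: disjoint_family_on_def)
    moreover have "0 \<le> q x s (A n - {x})" for n
      using A sets_singleton[OF x(1)] by (intro q_nonneg x) auto
    ultimately show "(\<Sum>i. ennreal (q x s (A i - {x}))) = ennreal (q x s ((\<Union>i. A i) - {x}))"
      by (subst suminf_ennreal_eq) auto
  qed
qed fact

lemma q_rate_eq: "x \<in> space M \<Longrightarrow> 0 \<le> s \<Longrightarrow> q_rate q x s = q x s (space M - {x})"
  using q_compl[of x s "{x}"] sets_singleton[of x] by (simp add: q_rate_def)

lemma q_rate_nonneg: "x \<in> space M \<Longrightarrow> 0 \<le> s \<Longrightarrow> 0 \<le> q_rate q x s"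
  using sets_singleton[of x] by (auto simp: q_rate_eq intro!: q_nonneg)

lemma q_rate_bounded: "\<exists>B. \<forall>s\<ge>0. q_rate q x s \<le> B" if "x \<in> space M"
proof -
  have "bdd_above ((\<lambda>s. q x s (space M - {x})) ` {0..})"
    using Q that by (simp add: Q_function_def)
  then show ?thesis using q_rate_eq[OF that] unfolding bdd_above_def by fastforce
qed

lemma emeasure_q_tilde_space:
  "x \<in> space M \<Longrightarrow> 0 \<le> s \<Longrightarrow> emeasure (q_tilde M q x s) (space M) = ennreal (q_rate q x s)"
  by (simp add: emeasure_q_tilde q_rate_eq)

lemma q_rate_measurable [measurable (raw)]:
  assumes a[measurable]: "a \<in> L \<rightarrow>\<^sub>M M" and b: "b \<in> L \<rightarrow>\<^sub>M time_space"
  shows "(\<lambda>w. q_rate q (a w) (b w)) \<in> borel_measurable L"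
proof -
  \<comment> \<open>The graph of \<open>a\<close>, whose section at \<open>w\<close> is
    \<open>{a w}\<close>.\<close>
  define A where "A = {p \<in> space (L \<Otimes>\<^sub>M M). a (fst p) = snd p}"
  have "Measurable.pred (L \<Otimes>\<^sub>M M) (\<lambda>p. a (fst p) = snd p)"
    by (rule measurable_eq_diagonal) auto
  then have "A \<in> sets (L \<Otimes>\<^sub>M M)" by (simp add: A_def pred_def)
  from q_section_measurable[OF a b this]
  have "(\<lambda>w. - q (a w) (b w) (Pair w -` A)) \<in> borel_measurable L" by simp
  also have "?this \<longleftrightarrow> (\<lambda>w. q_rate q (a w) (b w)) \<in> borel_measurable L"
  proof (rule measurable_cong)
    fix w assume "w \<in> space L"
    then have "Pair w -` A = {a w}"
      using measurable_space[OF a] by (auto simp: A_def space_pair_measure)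
    then show "- q (a w) (b w) (Pair w -` A) = q_rate q (a w) (b w)" by (simp add: q_rate_def)
  qed
  finally show ?thesis .
qed

lemma emeasure_q_tilde_measurable:
  assumes a[measurable]: "a \<in> L \<rightarrow>\<^sub>M M" and b: "b \<in> L \<rightarrow>\<^sub>M time_space"
    and A[measurable]: "A \<in> sets (L \<Otimes>\<^sub>M M)"
  shows "(\<lambda>w. emeasure (q_tilde M q (a w) (b w)) (Pair w -` A)) \<in> borel_measurable L"
proof -
  \<comment> \<open>Removing the graph of \<open>a\<close> from \<open>A\<close> takes the current
    state out of every section, as in the definition of \<open>q_tilde\<close>.\<close>
  define D where "D = {p \<in> space (L \<Otimes>\<^sub>M M). a (fst p) = snd p}"
  have "Measurable.pred (L \<Otimes>\<^sub>M M) (\<lambda>p. a (fst p) = snd p)"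
    by (rule measurable_eq_diagonal) auto
  then have "A - D \<in> sets (L \<Otimes>\<^sub>M M)" by (simp add: D_def pred_def sets.Diff)
  from q_section_measurable[OF a b this]
  have "(\<lambda>w. ennreal (q (a w) (b w) (Pair w -` (A - D)))) \<in> borel_measurable L" by simp
  also have "?this \<longleftrightarrow> (\<lambda>w. emeasure (q_tilde M q (a w) (b w)) (Pair w -` A)) \<in> borel_measurable L"
  proof (rule measurable_cong)
    fix w assume w: "w \<in> space L"
    have "Pair w -` (A - D) = Pair w -` A - {a w}"
      using w sets.sets_into_space[OF A] measurable_space[OF a w]
      by (auto simp: D_def space_pair_measure)
    then show "ennreal (q (a w) (b w) (Pair w -` (A - D))) = emeasure (q_tilde M q (a w) (b w)) (Pair w -` A)"
      using measurable_space[OF a w] measurable_space[OF b w] sets_Pair1[OF A]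
      by (subst emeasure_q_tilde) auto
  qed
  finally show ?thesis .
qed

text \<open>The mass of \<open>q_tilde\<close> is the exit rate, which may exceed 1, so this is not
  a subprobability kernel; the proof goes by induction over nonnegative measurable
  functions.\<close>

lemma nn_integral_q_tilde_measurable [measurable (raw)]:
  assumes k: "case_prod k \<in> borel_measurable (L \<Otimes>\<^sub>M M)"
    and a[measurable]: "a \<in> L \<rightarrow>\<^sub>M M" and b[measurable]: "b \<in> L \<rightarrow>\<^sub>M time_space"
  shows "(\<lambda>w. \<integral>\<^sup>+y. k w y \<partial>q_tilde M q (a w) (b w)) \<in> borel_measurable L"
proof -
  have "(\<lambda>w. \<integral>\<^sup>+y. h (w, y) \<partial>q_tilde M q (a w) (b w)) \<in> borel_measurable L"
    if "h \<in> borel_measurable (L \<Otimes>\<^sub>M M)" for h :: "'b \<times> 'a \<Rightarrow> ennreal"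
    using that
  proof induct
    case (cong f g)
    then show ?case
      by (subst measurable_cong[where g="\<lambda>w. \<integral>\<^sup>+y. g (w, y) \<partial>q_tilde M q (a w) (b w)"])
         (auto intro!: nn_integral_cong simp: space_pair_measure)
  next
    case (set A)
    have "(\<integral>\<^sup>+y. indicator A (w, y) \<partial>q_tilde M q (a w) (b w))
        = emeasure (q_tilde M q (a w) (b w)) (Pair w -` A)" for w
    proof -
      have "(\<integral>\<^sup>+y. indicator A (w, y) \<partial>q_tilde M q (a w) (b w))
        = (\<integral>\<^sup>+y. indicator (Pair w -` A) y \<partial>q_tilde M q (a w) (b w))"
        by (intro nn_integral_cong) (auto split: split_indicator)
      also have "\<dots> = emeasure (q_tilde M q (a w) (b w)) (Pair w -` A)"
        using sets_Pair1[OF set] by (simp add: nn_integral_indicator)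
      finally show ?thesis .
    qed
    then show ?case using emeasure_q_tilde_measurable[OF a b set] by simp
  next
    case (mult u c)
    then have "(\<lambda>w. c * (\<integral>\<^sup>+y. u (w, y) \<partial>q_tilde M q (a w) (b w))) \<in> borel_measurable L" by simp
    also have "?this \<longleftrightarrow> (\<lambda>w. \<integral>\<^sup>+y. c * u (w, y) \<partial>q_tilde M q (a w) (b w)) \<in> borel_measurable L"
      using mult(2) by (intro measurable_cong nn_integral_cmult[symmetric])
        (auto simp: measurable_cong_sets[OF sets_q_tilde refl] intro: measurable_Pair2)
    finally show ?case .
  next
    case (add u v)
    then have "(\<lambda>w. (\<integral>\<^sup>+y. v (w, y) \<partial>q_tilde M q (a w) (b w))
        + (\<integral>\<^sup>+y. u (w, y) \<partial>q_tilde M q (a w) (b w))) \<in> borel_measurable L" by simp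
    also have "?this \<longleftrightarrow> (\<lambda>w. \<integral>\<^sup>+y. v (w, y) + u (w, y) \<partial>q_tilde M q (a w) (b w)) \<in> borel_measurable L"
      using add(1,4) by (intro measurable_cong nn_integral_add[symmetric])
        (auto simp: measurable_cong_sets[OF sets_q_tilde refl] intro: measurable_Pair2)
    finally show ?case .
  next
    case (seq U)
    then have "(\<lambda>w. SUP i. (\<integral>\<^sup>+y. U i (w, y) \<partial>q_tilde M q (a w) (b w))) \<in> borel_measurable L" by simp
    also have "?this \<longleftrightarrow> (\<lambda>w. \<integral>\<^sup>+y. (SUP i. U i (w, y)) \<partial>q_tilde M q (a w) (b w)) \<in> borel_measurable L"
      using seq(1,4) by (intro measurable_cong nn_integral_monotone_convergence_SUP[symmetric])
        (auto simp: incseq_def le_fun_def measurable_cong_sets[OF sets_q_tilde refl] intro: measurable_Pair2)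
    finally show ?case by (simp add: image_comp)
  qed
  from this[OF k] show ?thesis by simp
qed

lemma q_rate_measurable_time [measurable]:
  "x \<in> space M \<Longrightarrow> q_rate q x \<in> borel_measurable time_space"
  using q_rate_measurable[of "\<lambda>_. x" time_space "\<lambda>s. s"] by simp

section \<open>Survival functions of the exit rate\<close>

lemma survival_measurable [measurable (raw)]:
  assumes [measurable]: "a \<in> L \<rightarrow>\<^sub>M M" and b[measurable]: "b \<in> L \<rightarrow>\<^sub>M time_space"
    and [measurable]: "d \<in> borel_measurable L"
  shows "(\<lambda>w. survival q (a w) (b w) (d w)) \<in> borel_measurable L"
proof -
  \<comment> \<open>The argument \<open>max 0 v\<close> makes the integrand jointly measurable on
    the whole line; on \<open>{b w..d w}\<close> it equals \<open>v\<close> because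
    \<open>b w\<close> is nonnegative.\<close>
  have "(\<lambda>w. \<integral>v. indicator {b w..d w} v *\<^sub>R q_rate q (a w) (max 0 v) \<partial>lborel) \<in> borel_measurable L"
  proof (rule lborel.borel_measurable_lebesgue_integral)
    have [measurable]: "b \<in> borel_measurable L" using b by (rule measurable_time_borel)
    have [measurable]: "(\<lambda>p. q_rate q (a (fst p)) (max 0 (snd p))) \<in> borel_measurable (L \<Otimes>\<^sub>M borel)"
      by (rule q_rate_measurable) measurable
    have "(\<lambda>p. (if b (fst p) \<le> snd p \<and> snd p \<le> d (fst p) then 1 else 0) *\<^sub>R q_rate q (a (fst p)) (max 0 (snd p)))
        \<in> borel_measurable (L \<Otimes>\<^sub>M borel)"
      by measurable
    then show "(\<lambda>(w, v). indicator {b w..d w} v *\<^sub>R q_rate q (a w) (max 0 v)) \<in> borel_measurable (L \<Otimes>\<^sub>M lborel)"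
      by (simp add: indicator_def split_beta' measurable_cong_sets[OF sets_pair_measure_cong[OF refl sets_lborel] refl])
  qed
  then have "(\<lambda>w. exp (- (\<integral>v. indicator {b w..d w} v *\<^sub>R q_rate q (a w) (max 0 v) \<partial>lborel))) \<in> borel_measurable L"
    by measurable
  also have "?this \<longleftrightarrow> ?thesis"
  proof (rule measurable_cong)
    fix w assume "w \<in> space L"
    then have "0 \<le> b w" using measurable_space[OF b] by auto
    then have "(\<integral>v. indicator {b w..d w} v *\<^sub>R q_rate q (a w) (max 0 v) \<partial>lborel)
        = (LBINT v:{b w..d w}. q_rate q (a w) v)"
      unfolding set_lebesgue_integral_def
      by (intro Bochner_Integration.integral_cong) (auto split: split_indicator)
    then show "exp (- (\<integral>v. indicator {b w..d w} v *\<^sub>R q_rate q (a w) (max 0 v) \<partial>lborel))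
        = survival q (a w) (b w) (d w)"
      by (simp add: survival_def)
  qed
  finally show ?thesis .
qed

lemma set_borel_measurable_q_rate:
  assumes "x \<in> space M" "0 \<le> u"
  shows "set_borel_measurable lborel {u..t} (q_rate q x)"
proof -
  have "(\<lambda>v. indicator {u..t} v *\<^sub>R q_rate q x (max 0 v)) \<in> borel_measurable borel"
    using assms(1) by measurable
  also have "(\<lambda>v. indicator {u..t} v *\<^sub>R q_rate q x (max 0 v)) = (\<lambda>v. indicator {u..t} v *\<^sub>R q_rate q x v)"
    using assms(2) by (auto split: split_indicator)
  finally show ?thesis by (simp add: set_borel_measurable_def)
qed

lemma set_integrable_q_rate:
  assumes "x \<in> space M" "0 \<le> u"
  shows "set_integrable lborel {u..t} (q_rate q x)"
proof -
  obtain B where "\<And>s. 0 \<le> s \<Longrightarrow> q_rate q x s \<le> B" using q_rate_bounded[OF assms(1)] by blast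
  then show ?thesis
    using assms q_rate_nonneg[OF assms(1)]
    by (intro set_integrable_bounded[where B=B] set_borel_measurable_q_rate) auto
qed

lemma survival_nonneg [simp]: "0 \<le> survival q x u t"
  by (simp add: survival_def)

text \<open>This is \<open>integral_rate_times_survival\<close> for the rate
  \<open>b + q_rate q x s\<close>: with an independent clock of rate \<open>b\<close> added, either
  a jump or the clock comes first within \<open>[u, t]\<close>, or neither happens. For
  \<open>b = 0\<close> it yields the law of the next jump time, for \<open>b = c\<close> the
  discounted estimates.\<close>

lemma survival_identity:
  assumes x: "x \<in> space M" and u: "0 \<le> u" "u \<le> t" and b: "0 \<le> b"
  shows "(\<integral>\<^sup>+s. ennreal ((b + q_rate q x s) * (exp (- b * (s - u)) * survival q x u s)) * indicator {u..t} s \<partial>halfline)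
      + ennreal (exp (- b * (t - u)) * survival q x u t) = 1"
proof -
  obtain B where B: "\<And>s. 0 \<le> s \<Longrightarrow> q_rate q x s \<le> B" using q_rate_bounded[OF x] by blast
  define r where "r s = b + q_rate q x s" for s
  have meas: "set_borel_measurable lborel {u..t} r"
  proof -
    have "(\<lambda>s. indicator {u..t} s *\<^sub>R b + indicator {u..t} s *\<^sub>R q_rate q x s) \<in> borel_measurable lborel"
      using set_borel_measurable_q_rate[OF x u(1), of t] unfolding set_borel_measurable_def by measurable
    then show ?thesis by (simp add: set_borel_measurable_def r_def algebra_simps)
  qed
  have R: "exp (- (LBINT v:{u..s}. r v)) = exp (- b * (s - u)) * survival q x u s" if "u \<le> s" for s
  proof -
    have "(LBINT v:{u..s}. r v) = (LBINT v:{u..s}. b) + (LBINT v:{u..s}. q_rate q x v)"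
      unfolding r_def by (intro set_integral_add set_integrable_q_rate x u) (auto simp: set_integrable_def that)
    also have "(LBINT v:{u..s}. b) = b * (s - u)"
      using that by (simp add: set_lebesgue_integral_def)
    finally show ?thesis by (simp add: survival_def exp_add[symmetric] algebra_simps)
  qed
  have bound: "0 \<le> r s \<and> r s \<le> b + B" if "s \<in> {u..t}" for s
    using B[of s] q_rate_nonneg[OF x, of s] u b that by (auto simp: r_def)
  note ftc = integral_rate_times_survival[OF meas bound u(2)]
  have "(\<integral>\<^sup>+s. ennreal (r s * (exp (- b * (s - u)) * survival q x u s)) * indicator {u..t} s \<partial>halfline)
      = (\<integral>\<^sup>+s. ennreal (indicator {u..t} s *\<^sub>R (r s * exp (- (LBINT v:{u..s}. r v)))) \<partial>lborel)"
    using u by (subst nn_integral_halfline_restrict)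
      (auto intro!: nn_integral_cong simp: R simp del: mult_minus_left split: split_indicator)
  also have "\<dots> = ennreal (LBINT s:{u..t}. r s * exp (- (LBINT v:{u..s}. r v)))"
    unfolding set_lebesgue_integral_def[of _ _ "\<lambda>s. r s * _ s"]
    using ftc(1) bound unfolding set_integrable_def
    by (intro nn_integral_eq_integral) (auto split: split_indicator)
  also have "\<dots> = ennreal (1 - exp (- b * (t - u)) * survival q x u t)"
    by (simp only: ftc(2) R[OF u(2)])
  finally have *: "(\<integral>\<^sup>+s. ennreal (r s * (exp (- b * (s - u)) * survival q x u s)) * indicator {u..t} s \<partial>halfline)
      = ennreal (1 - exp (- b * (t - u)) * survival q x u t)" .
  have "0 \<le> (LBINT v:{u..t}. r v)"
    unfolding set_lebesgue_integral_def using bound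
    by (intro Bochner_Integration.integral_nonneg) (auto split: split_indicator)
  then have le: "exp (- b * (t - u)) * survival q x u t \<le> 1" using R[OF u(2), symmetric] by simp
  have "ennreal (1 - exp (- b * (t - u)) * survival q x u t) + ennreal (exp (- b * (t - u)) * survival q x u t)
      = ennreal (1 - exp (- b * (t - u)) * survival q x u t + exp (- b * (t - u)) * survival q x u t)"
    using le by (intro ennreal_plus[symmetric]) auto
  then show ?thesis using * by (simp add: r_def)
qed

end

section \<open>The jump kernel as a probability kernel on chain states\<close>

context jump_process
begin

abbreviation "EM \<equiv> time_space \<Otimes>\<^sub>M M"

text \<open>The part of the jump kernel on proper jumps. Membership of \<open>None\<close> in
  \<open>A\<close> is ignored, so the value at the whole chain space is the probability that another
  jump occurs at a finite time.\<close>

definition jump_mass :: "real \<Rightarrow> 'a \<Rightarrow> (real \<times> 'a) option set \<Rightarrow> ennreal" where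
  "jump_mass t x A = (\<integral>\<^sup>+u. indicator {t<..} u * (ennreal (survival q x t u) *
     emeasure (q_tilde M q x u) {y \<in> space M. Some (u, y) \<in> A}) \<partial>halfline)"

lemma jump_kernel_Some:
  assumes "0 \<le> t"
  shows "jump_kernel M q (Some (t, x)) = measure_of (space (chain_space M)) (sets (chain_space M))
    (\<lambda>A. jump_mass t x A + (1 - jump_mass t x (space (chain_space M))) * indicator A None)"
proof -
  have "(\<integral>\<^sup>+u\<in>{t<..}. ennreal (survival q x t u) * emeasure (q_tilde M q x u) {y \<in> space M. Some (u, y) \<in> A} \<partial>lborel)
    = jump_mass t x A" for A
    unfolding jump_mass_def using assms
    by (subst nn_integral_halfline_restrict[symmetric]) (auto simp: mult.commute)
  then show ?thesis unfolding jump_kernel_def by (simp only: Let_def option.case prod.case)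
qed

lemma measurable_survival_time [measurable]:
  assumes "x \<in> space M" "0 \<le> t"
  shows "survival q x t \<in> borel_measurable time_space"
proof -
  have "(\<lambda>w. survival q x t w) \<in> borel_measurable time_space"
    by (rule survival_measurable) (use assms in \<open>auto intro: measurable_restrict_space1\<close>)
  then show ?thesis .
qed

lemma sets_chain_slice:
  assumes A: "A \<in> sets (chain_space M)" and u: "0 \<le> u"
  shows "{y \<in> space M. Some (u, y) \<in> A} \<in> sets M"
proof -
  have "(\<lambda>y. Some (u, y)) \<in> M \<rightarrow>\<^sub>M chain_space M"
    using u by (intro measurable_compose[OF measurable_Pair1' measurable_Some]) simp
  from measurable_sets[OF this A] show ?thesis by (simp add: vimage_def Int_def conj_commute)
qed

lemma slice_measurable:
  assumes [measurable]: "A \<in> sets (chain_space M)" and a[measurable]: "a \<in> L \<rightarrow>\<^sub>M M" and b[measurable]: "b \<in> L \<rightarrow>\<^sub>M time_space"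
  shows "(\<lambda>w. emeasure (q_tilde M q (a w) (b w)) {y \<in> space M. Some (b w, y) \<in> A}) \<in> borel_measurable L"
proof -
  define D where "D = {p \<in> space (L \<Otimes>\<^sub>M M). Some (b (fst p), snd p) \<in> A}"
  have D: "D \<in> sets (L \<Otimes>\<^sub>M M)" unfolding D_def by measurable
  have "(\<lambda>w. emeasure (q_tilde M q (a w) (b w)) (Pair w -` D)) \<in> borel_measurable L"
    by (rule emeasure_q_tilde_measurable[OF a b D])
  also have "?this \<longleftrightarrow> ?thesis"
    by (intro measurable_cong arg_cong2[where f=emeasure]) (auto simp: D_def space_pair_measure)
  finally show ?thesis .
qed

lemma jump_mass_integrand_measurable:
  assumes [measurable]: "A \<in> sets (chain_space M)" and "x \<in> space M" "0 \<le> t"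
  shows "(\<lambda>u. indicator {t<..} u * (ennreal (survival q x t u) *
     emeasure (q_tilde M q x u) {y \<in> space M. Some (u, y) \<in> A})) \<in> borel_measurable time_space"
proof -
  have [measurable]: "(\<lambda>u. emeasure (q_tilde M q x u) {y \<in> space M. Some (u, y) \<in> A}) \<in> borel_measurable time_space"
    by (rule slice_measurable[of A "\<lambda>_. x" time_space "\<lambda>u. u"]) (use assms in auto)
  have [measurable]: "(indicator {t<..} :: real \<Rightarrow> ennreal) \<in> borel_measurable time_space"
    by (rule measurable_restrict_space1) simp
  show ?thesis using assms by measurable
qed

text \<open>On each window \<open>{t..t + real n}\<close> the integrated jump intensity is at most 1
  by \<open>survival_identity\<close> with \<open>b = 0\<close>; monotone convergence in
  \<open>n\<close> removes the bound on time.\<close>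

lemma jump_mass_le_1:
  assumes x: "x \<in> space M" and t: "0 \<le> t"
  shows "jump_mass t x A \<le> 1"
proof -
  let ?f = "\<lambda>u. ennreal (q_rate q x u * survival q x t u)"
  have [measurable]: "(\<lambda>u. ?f u * indicator {t..t + real n} u) \<in> borel_measurable halfline" for n
  proof (rule borel_measurable_halfline)
    have [measurable]: "(indicator {t..t + real n} :: real \<Rightarrow> ennreal) \<in> borel_measurable time_space"
      by (rule measurable_restrict_space1) simp
    show "(\<lambda>u. ?f u * indicator {t..t + real n} u) \<in> borel_measurable time_space"
      using x t by measurable
  qed
  have "jump_mass t x A \<le> (\<integral>\<^sup>+u. (SUP n. ?f u * indicator {t..t + real n} u) \<partial>halfline)"
    unfolding jump_mass_def
  proof (rule nn_integral_halfline_mono)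
    fix u :: real assume u: "0 \<le> u"
    show "indicator {t<..} u * (ennreal (survival q x t u) *
       emeasure (q_tilde M q x u) {y \<in> space M. Some (u, y) \<in> A}) \<le> (SUP n. ?f u * indicator {t..t + real n} u)"
    proof (cases "t < u")
      case True
      obtain n :: nat where n: "u - t \<le> n" using real_arch_simple by blast
      have "emeasure (q_tilde M q x u) {y \<in> space M. Some (u, y) \<in> A} \<le> emeasure (q_tilde M q x u) (space M)"
        using emeasure_space[of "q_tilde M q x u"] by simp
      also have "\<dots> = ennreal (q_rate q x u)" using x u by (rule emeasure_q_tilde_space)
      finally have "ennreal (survival q x t u) *
       emeasure (q_tilde M q x u) {y \<in> space M. Some (u, y) \<in> A} \<le> ennreal (survival q x t u) * ennreal (q_rate q x u)"
        by (intro mult_left_mono) auto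
      also have "\<dots> = ?f u * indicator {t..t + real n} u"
        using True n q_rate_nonneg[OF x u] by (simp add: ennreal_mult mult.commute)
      also have "\<dots> \<le> (SUP n. ?f u * indicator {t..t + real n} u)" by (rule SUP_upper) simp
      finally show ?thesis using True by simp
    qed simp
  qed
  also have "\<dots> = (SUP n. \<integral>\<^sup>+u. ?f u * indicator {t..t + real n} u \<partial>halfline)"
  proof (rule nn_integral_monotone_convergence_SUP)
    show "incseq (\<lambda>n u. ?f u * indicator {t..t + real n} u)"
      by (auto simp: incseq_def le_fun_def split: split_indicator)
  qed measurable
  also have "\<dots> \<le> 1"
  proof (rule SUP_least)
    fix n :: nat
    show "(\<integral>\<^sup>+u. ?f u * indicator {t..t + real n} u \<partial>halfline) \<le> 1"
      using survival_identity[OF x t, of "t + real n" 0] by (simp add: le_iff_add) (metis add.commute)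
  qed
  finally show ?thesis .
qed

lemma sets_jump_kernel: "sets (jump_kernel M q z) = sets (chain_space M)" if chain: "z \<in> space (chain_space M)"
proof (cases z)
  case None
  then show ?thesis by (simp add: jump_kernel_def)
next
  case (Some a)
  then obtain t x where z: "z = Some (t, x)" "0 \<le> t" using chain
    by (cases a) (auto simp: space_pair_measure)
  show ?thesis unfolding z(1) jump_kernel_Some[OF z(2)] by (rule sets.sets_measure_of_eq)
qed

lemma emeasure_jump_kernel:
  assumes x: "x \<in> space M" and t: "0 \<le> t" and A: "A \<in> sets (chain_space M)"
  shows "emeasure (jump_kernel M q (Some (t, x))) A =
    jump_mass t x A + (1 - jump_mass t x (space (chain_space M))) * indicator A None"
  unfolding jump_kernel_Some[OF t]
proof (rule emeasure_measure_of_sigma)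
  let ?\<mu> = "\<lambda>A. jump_mass t x A + (1 - jump_mass t x (space (chain_space M))) * indicator A None"
  show "sigma_algebra (space (chain_space M)) (sets (chain_space M))" by (rule sets.sigma_algebra_axioms)
  show "positive (sets (chain_space M)) ?\<mu>"
    by (simp add: positive_def jump_mass_def)
  show "countably_additive (sets (chain_space M)) ?\<mu>"
  proof (rule countably_additiveI)
    fix A :: "nat \<Rightarrow> (real \<times> 'a) option set"
    assume A: "range A \<subseteq> sets (chain_space M)" "disjoint_family A" "(\<Union>i. A i) \<in> sets (chain_space M)"
    have "(\<Sum>i. jump_mass t x (A i)) = jump_mass t x (\<Union>i. A i)"
      unfolding jump_mass_def
    proof (subst nn_integral_suminf[symmetric])
      show "(\<integral>\<^sup>+u. (\<Sum>i. indicator {t<..} u * (ennreal (survival q x t u) *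
          emeasure (q_tilde M q x u) {y \<in> space M. Some (u, y) \<in> A i})) \<partial>halfline)
        = (\<integral>\<^sup>+u. indicator {t<..} u * (ennreal (survival q x t u) *
          emeasure (q_tilde M q x u) {y \<in> space M. Some (u, y) \<in> (\<Union>i. A i)}) \<partial>halfline)"
      proof (rule nn_integral_halfline_cong)
        fix u :: real assume u: "0 \<le> u"
        have "(\<Sum>i. emeasure (q_tilde M q x u) {y \<in> space M. Some (u, y) \<in> A i})
          = emeasure (q_tilde M q x u) (\<Union>i. {y \<in> space M. Some (u, y) \<in> A i})"
          using A u sets_chain_slice[of _ u]
          by (intro suminf_emeasure) (auto simp: disjoint_family_on_def)
        also have "(\<Union>i. {y \<in> space M. Some (u, y) \<in> A i}) = {y \<in> space M. Some (u, y) \<in> (\<Union>i. A i)}" by auto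
        finally show "(\<Sum>i. indicator {t<..} u * (ennreal (survival q x t u) *
          emeasure (q_tilde M q x u) {y \<in> space M. Some (u, y) \<in> A i}))
          = indicator {t<..} u * (ennreal (survival q x t u) *
          emeasure (q_tilde M q x u) {y \<in> space M. Some (u, y) \<in> (\<Union>i. A i)})"
          by (simp add: ennreal_suminf_cmult)
      qed
    qed (use A in \<open>auto intro!: borel_measurable_halfline jump_mass_integrand_measurable x t\<close>)
    moreover have "(\<Sum>i. (1 - jump_mass t x (space (chain_space M))) * indicator (A i) None)
      = (1 - jump_mass t x (space (chain_space M))) * indicator (\<Union>i. A i) None"
      using suminf_indicator[OF A(2), of None] by (simp only: ennreal_suminf_cmult)
    ultimately show "(\<Sum>i. ?\<mu> (A i)) = ?\<mu> (\<Union>i. A i)"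
      by (simp only: suminf_add[symmetric] summableI)
  qed
qed fact

text \<open>Subtraction in \<open>ennreal\<close> is truncated, so the mass assigned to
  \<open>None\<close> completes the total to 1 precisely because of
  \<open>jump_mass_le_1\<close>.\<close>

lemma prob_space_jump_kernel:
  assumes z: "z \<in> space (chain_space M)" shows "prob_space (jump_kernel M q z)"
proof (cases z)
  case None
  then show ?thesis by (auto simp: jump_kernel_def intro!: prob_space_return)
next
  case (Some a)
  then obtain t x where zx: "z = Some (t, x)" "x \<in> space M" "0 \<le> t"
    using z by (auto simp: space_pair_measure)
  show ?thesis
  proof (rule prob_spaceI)
    have "space (jump_kernel M q z) = space (chain_space M)"
      using sets_jump_kernel[OF z] by (rule sets_eq_imp_space_eq)
    then show "emeasure (jump_kernel M q z) (space (jump_kernel M q z)) = 1"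
      using zx jump_mass_le_1[OF zx(2,3)]
      by (simp add: emeasure_jump_kernel del: space_option_space) (simp add: add_diff_inverse_ennreal)
  qed
qed

lemma jump_mass_measurable:
  assumes A[measurable]: "A \<in> sets (chain_space M)"
  shows "(\<lambda>(t, x). jump_mass t x A) \<in> borel_measurable EM"
  unfolding split_beta' jump_mass_def
proof (rule borel_measurable_nn_integral_halfline)
  let ?L = "EM \<Otimes>\<^sub>M time_space"
  have [measurable]: "snd \<in> borel_measurable ?L" "(\<lambda>p. fst (fst p)) \<in> borel_measurable ?L"
    by (rule measurable_time_borel, measurable)+
  have [measurable]: "(\<lambda>p. emeasure (q_tilde M q (snd (fst p)) (snd p)) {y \<in> space M. Some (snd p, y) \<in> A})
      \<in> borel_measurable ?L"
    by (rule slice_measurable) measurable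
  have [measurable]: "(\<lambda>p. survival q (snd (fst p)) (fst (fst p)) (snd p)) \<in> borel_measurable ?L"
    by (rule survival_measurable) measurable
  have "(\<lambda>p. (if fst (fst p) < snd p then 1 else 0) * (ennreal (survival q (snd (fst p)) (fst (fst p)) (snd p)) *
      emeasure (q_tilde M q (snd (fst p)) (snd p)) {y \<in> space M. Some (snd p, y) \<in> A})) \<in> borel_measurable ?L"
    by measurable
  then show "(\<lambda>(w, u). indicator {fst w<..} u * (ennreal (survival q (snd w) (fst w) u) *
      emeasure (q_tilde M q (snd w) u) {y \<in> space M. Some (u, y) \<in> A})) \<in> borel_measurable ?L"
    by (simp add: indicator_def split_beta' cong: if_cong)
qed

lemma jump_kernel_measurable [measurable]:
  "jump_kernel M q \<in> chain_space M \<rightarrow>\<^sub>M subprob_algebra (chain_space M)"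
proof (rule measurable_subprob_algebra)
  fix A assume A[measurable]: "A \<in> sets (chain_space M)"
  have "(\<lambda>p. jump_mass (fst p) (snd p) A +
      (1 - jump_mass (fst p) (snd p) (space (chain_space M))) * indicator A None) \<in> borel_measurable EM"
    using jump_mass_measurable[OF A] jump_mass_measurable[OF sets.top]
    unfolding split_beta' by measurable
  also have "?this \<longleftrightarrow> (\<lambda>p. emeasure (jump_kernel M q (Some p)) A) \<in> borel_measurable EM"
    by (intro measurable_cong) (auto simp: space_pair_measure emeasure_jump_kernel A)
  finally show "(\<lambda>z. emeasure (jump_kernel M q z) A) \<in> borel_measurable (chain_space M)"
    by (simp add: measurable_option_space_iff)
qed (auto intro: prob_space_imp_subprob_space prob_space_jump_kernel simp: sets_jump_kernel simp del: space_option_space)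

text \<open>Passage from sets to functions by induction over measurable functions. For
  \<open>H None = 0\<close> the defect term disappears and only the integral over the next jump time
  remains.\<close>

lemma nn_integral_jump_kernel:
  assumes H: "H \<in> borel_measurable (chain_space M)" and x: "x \<in> space M" and t: "0 \<le> t"
  shows "(\<integral>\<^sup>+z. H z \<partial>jump_kernel M q (Some (t, x))) =
     (\<integral>\<^sup>+u. indicator {t<..} u * (ennreal (survival q x t u) * (\<integral>\<^sup>+y. H (Some (u, y)) \<partial>q_tilde M q x u)) \<partial>halfline)
     + (1 - jump_mass t x (space (chain_space M))) * H None"
proof -
  let ?K = "jump_kernel M q (Some (t, x))"
  let ?J = "\<lambda>H. (\<integral>\<^sup>+u. indicator {t<..} u * (ennreal (survival q x t u) * (\<integral>\<^sup>+y. H (Some (u, y)) \<partial>q_tilde M q x u)) \<partial>halfline)"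
  define \<kappa> where "\<kappa> = 1 - jump_mass t x (space (chain_space M))"
  have sK [measurable_cong]: "sets ?K = sets (chain_space M)"
    using x t by (intro sets_jump_kernel) (auto simp: space_pair_measure)
  have [measurable]: "(indicator {t<..} :: real \<Rightarrow> ennreal) \<in> borel_measurable time_space"
    by (rule measurable_restrict_space1) simp
  have pair: "(\<lambda>p. Some (fst p, snd p)) \<in> time_space \<Otimes>\<^sub>M M \<rightarrow>\<^sub>M chain_space M" by measurable
  have joint: "(\<lambda>p. F (Some (fst p, snd p))) \<in> borel_measurable EM" if "F \<in> borel_measurable (chain_space M)" for F :: "_ \<Rightarrow> ennreal"
    by (rule measurable_compose[OF pair that])
  have slice: "(\<lambda>y. F (Some (u, y))) \<in> borel_measurable (q_tilde M q x u)"
    if "F \<in> borel_measurable (chain_space M)" "0 \<le> u" for F :: "_ \<Rightarrow> ennreal" and u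
    using measurable_Pair2[OF joint[OF that(1)], of u] that(2) by (simp add: measurable_cong_sets[OF sets_q_tilde refl])
  have int1: "(\<lambda>u. \<integral>\<^sup>+y. F (Some (u, y)) \<partial>q_tilde M q x u) \<in> borel_measurable time_space"
    if "F \<in> borel_measurable (chain_space M)" for F :: "_ \<Rightarrow> ennreal"
    using joint[OF that] x
    by (intro nn_integral_q_tilde_measurable[of "\<lambda>u y. F (Some (u, y))" time_space "\<lambda>_. x" "\<lambda>u. u"])
       (auto simp: split_beta')
  have int: "(\<lambda>u. indicator {t<..} u * (ennreal (survival q x t u) * (\<integral>\<^sup>+y. F (Some (u, y)) \<partial>q_tilde M q x u))) \<in> borel_measurable halfline"
    if "F \<in> borel_measurable (chain_space M)" for F :: "_ \<Rightarrow> ennreal"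
  proof (rule borel_measurable_halfline)
    have [measurable]: "survival q x t \<in> borel_measurable time_space" using x t by (rule measurable_survival_time)
    note int1[OF that, measurable]
    show "(\<lambda>u. indicator {t<..} u * (ennreal (survival q x t u) * (\<integral>\<^sup>+y. F (Some (u, y)) \<partial>q_tilde M q x u))) \<in> borel_measurable time_space"
      by measurable
  qed
  have "(\<integral>\<^sup>+z. H z \<partial>?K) = ?J H + \<kappa> * H None"
    using H
  proof induct
    case (cong f g)
    have "(\<integral>\<^sup>+z. f z \<partial>?K) = (\<integral>\<^sup>+z. g z \<partial>?K)"
      using cong(3) sets_eq_imp_space_eq[OF sK] by (intro nn_integral_cong) simp
    moreover have "?J f = ?J g"
      using cong(3) by (intro nn_integral_cong arg_cong2[where f="(*)"] refl)
        (auto simp: space_pair_measure space_restrict_space)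
    ultimately show ?case using cong by simp
  next
    case (set A)
    have "?J (indicator A) = jump_mass t x A"
      unfolding jump_mass_def
    proof (intro nn_integral_cong arg_cong2[where f="(*)"] refl)
      fix u assume "u \<in> space halfline"
      then have u: "0 \<le> u" by (simp add: space_restrict_space)
      have "(\<integral>\<^sup>+y. indicator A (Some (u, y)) \<partial>q_tilde M q x u)
        = (\<integral>\<^sup>+y. indicator {y \<in> space M. Some (u, y) \<in> A} y \<partial>q_tilde M q x u)"
        by (intro nn_integral_cong) (auto split: split_indicator)
      then show "(\<integral>\<^sup>+y. indicator A (Some (u, y)) \<partial>q_tilde M q x u)
        = emeasure (q_tilde M q x u) {y \<in> space M. Some (u, y) \<in> A}"
        using sets_chain_slice[OF set u] by simp
    qed
    then show ?case
      using set x t by (simp add: emeasure_jump_kernel sK \<kappa>_def del: space_option_space)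
  next
    case (mult F c)
    have "(\<integral>\<^sup>+z. c * F z \<partial>?K) = c * (?J F + \<kappa> * F None)"
      using mult by (subst nn_integral_cmult) auto
    moreover have "?J (\<lambda>z. c * F z) = (\<integral>\<^sup>+u. c * (indicator {t<..} u * (ennreal (survival q x t u) * (\<integral>\<^sup>+y. F (Some (u, y)) \<partial>q_tilde M q x u))) \<partial>halfline)"
      by (intro nn_integral_cong, subst nn_integral_cmult[OF slice[OF mult(2)]])
         (auto simp: space_restrict_space ac_simps)
    moreover have "\<dots> = c * ?J F" by (rule nn_integral_cmult[OF int[OF mult(2)]])
    ultimately show ?case by (simp add: algebra_simps)
  next
    case (add F G)
    have "(\<integral>\<^sup>+z. G z + F z \<partial>?K) = (?J G + \<kappa> * G None) + (?J F + \<kappa> * F None)"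
      using add by (subst nn_integral_add) auto
    moreover have "?J (\<lambda>z. G z + F z) = (\<integral>\<^sup>+u. (indicator {t<..} u * (ennreal (survival q x t u) * (\<integral>\<^sup>+y. G (Some (u, y)) \<partial>q_tilde M q x u)))
        + (indicator {t<..} u * (ennreal (survival q x t u) * (\<integral>\<^sup>+y. F (Some (u, y)) \<partial>q_tilde M q x u))) \<partial>halfline)"
      by (intro nn_integral_cong, subst nn_integral_add[OF slice[OF add(4)] slice[OF add(1)]])
         (auto simp: space_restrict_space distrib_left)
    moreover have "\<dots> = ?J G + ?J F" by (rule nn_integral_add[OF int[OF add(4)] int[OF add(1)]])
    ultimately show ?case by (simp add: algebra_simps)
  next
    case (seq U)
    have "(\<integral>\<^sup>+z. (SUP i. U i z) \<partial>?K) = (SUP i. \<integral>\<^sup>+z. U i z \<partial>?K)"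
      using seq by (intro nn_integral_monotone_convergence_SUP) auto
    also have "\<dots> = (SUP i. ?J (U i) + \<kappa> * U i None)" using seq by simp
    also have "\<dots> = (SUP i. ?J (U i)) + (SUP i. \<kappa> * U i None)"
    proof (rule ennreal_SUP_add)
      show "incseq (\<lambda>i. ?J (U i))"
        using seq(4) by (auto simp: incseq_def le_fun_def intro!: nn_integral_mono mult_left_mono)
      show "incseq (\<lambda>i. \<kappa> * U i None)"
        using seq(4) by (auto simp: incseq_def le_fun_def intro!: mult_left_mono)
    qed
    also have "(SUP i. \<kappa> * U i None) = \<kappa> * (SUP i. U i None)" by (simp add: SUP_mult_left_ennreal)
    also have "(SUP i. ?J (U i)) = (\<integral>\<^sup>+u. (SUP i. indicator {t<..} u * (ennreal (survival q x t u) * (\<integral>\<^sup>+y. U i (Some (u, y)) \<partial>q_tilde M q x u))) \<partial>halfline)"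
      using seq(4) int[OF seq(1)]
      by (intro nn_integral_monotone_convergence_SUP[symmetric])
         (auto simp: incseq_def le_fun_def intro!: nn_integral_mono mult_left_mono)
    also have "\<dots> = ?J (\<lambda>z. SUP i. U i z)"
    proof (rule nn_integral_halfline_cong)
      fix u :: real assume u: "0 \<le> u"
      have "(\<integral>\<^sup>+y. (SUP i. U i (Some (u, y))) \<partial>q_tilde M q x u) = (SUP i. \<integral>\<^sup>+y. U i (Some (u, y)) \<partial>q_tilde M q x u)"
        using seq(4) slice[OF seq(1) u]
        by (intro nn_integral_monotone_convergence_SUP) (auto simp: incseq_def le_fun_def)
      then show "(SUP i. indicator {t<..} u * (ennreal (survival q x t u) * (\<integral>\<^sup>+y. U i (Some (u, y)) \<partial>q_tilde M q x u)))
        = indicator {t<..} u * (ennreal (survival q x t u) * (\<integral>\<^sup>+y. (SUP i. U i (Some (u, y))) \<partial>q_tilde M q x u))"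
        by (simp add: SUP_mult_left_ennreal)
    qed
    finally show ?case by (simp add: image_comp)
  qed
  then show ?thesis by (simp add: \<kappa>_def)
qed

end

section \<open>The embedded chain\<close>

text \<open>\<open>jump_time\<close> read off a single chain state instead of a path, so that
  conditions on two consecutive states become measurable conditions on
  \<open>chain_space\<close>.\<close>

definition entry_time :: "(real \<times> 'a) option \<Rightarrow> ereal" where
  "entry_time z = (case z of None \<Rightarrow> \<infinity> | Some (t, _) \<Rightarrow> ereal t)"

lemma entry_time_simps [simp]: "entry_time None = \<infinity>" "entry_time (Some (t, y)) = ereal t"
  by (simp_all add: entry_time_def)

lemma jump_time_eq: "jump_time \<omega> n = entry_time (\<omega> n)"
  by (simp add: jump_time_def entry_time_def)

lemma entry_time_measurable [measurable]: "entry_time \<in> borel_measurable (chain_space M)"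
proof -
  show ?thesis unfolding entry_time_def split_beta' by measurable
qed

locale started_jump_process = jump_process M q for M :: "'a measure" and q +
  fixes x :: 'a
  assumes x: "x \<in> space M"
begin

abbreviation "P \<equiv> jump_law M q x"

lemma start: "Some (0, x) \<in> space (chain_space M)"
  using x by (simp add: space_pair_measure)

text \<open>Kernel number 0 produces the start; kernel number \<open>Suc m\<close> reads coordinate
  \<open>m\<close> and produces coordinate \<open>Suc m\<close>. It looks at no earlier coordinate,
  which is the Markov property of the chain.\<close>

sublocale IT: Ionescu_Tulcea
  "\<lambda>n \<omega>. case n of 0 \<Rightarrow> return (chain_space M) (Some (0, x)) | Suc m \<Rightarrow> jump_kernel M q (\<omega> m)"
  "\<lambda>_. chain_space M"
proof (rule Ionescu_Tulcea.intro)
  show "(\<lambda>\<omega>. case n of 0 \<Rightarrow> return (chain_space M) (Some (0, x)) | Suc m \<Rightarrow> jump_kernel M q (\<omega> m))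
      \<in> PiM {0..<n} (\<lambda>_. chain_space M) \<rightarrow>\<^sub>M subprob_algebra (chain_space M)" for n
  proof (cases n)
    case 0
    then show ?thesis using measurable_const[OF measurable_space[OF return_measurable start]] by simp
  next
    case (Suc m)
    then show ?thesis
      using measurable_compose[OF measurable_component_singleton[of m "{0..<Suc m}" "\<lambda>_. chain_space M"] jump_kernel_measurable]
      by simp
  qed
next
  fix n :: nat and \<omega> :: "nat \<Rightarrow> (real \<times> 'a) option"
  assume \<omega>: "\<omega> \<in> space (PiM {0..<n} (\<lambda>_. chain_space M))"
  show "prob_space (case n of 0 \<Rightarrow> return (chain_space M) (Some (0, x)) | Suc m \<Rightarrow> jump_kernel M q (\<omega> m))"
  proof (cases n)
    case 0
    then show ?thesis using start by (simp add: prob_space_return)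
  next
    case (Suc m)
    then have "\<omega> m \<in> space (chain_space M)" using \<omega> unfolding space_PiM by (intro PiE_mem[OF \<omega>[unfolded space_PiM]]) auto
    then show ?thesis using Suc by (simp add: prob_space_jump_kernel)
  qed
qed

lemma jump_law_eq: "P = IT.PF.lim"
  by (simp only: jump_law_def)

lemma sets_P [measurable_cong]: "sets P = sets (PiM UNIV (\<lambda>_. chain_space M))"
  unfolding jump_law_eq by (rule IT.PF.sets_lim)

lemma space_P: "space P = (UNIV :: nat set) \<rightarrow>\<^sub>E space (chain_space M)"
  using sets_eq_imp_space_eq[OF sets_P] by (simp only: space_PiM)

lemma path_in_space: "\<omega> \<in> space P \<Longrightarrow> \<omega> n \<in> space (chain_space M)"
  unfolding space_P by (rule PiE_mem) auto

lemma coordinate_measurable [measurable]: "(\<lambda>\<omega>. \<omega> n) \<in> P \<rightarrow>\<^sub>M chain_space M"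
  by (rule measurable_compose[OF _ measurable_component_singleton[of n UNIV]])
     (auto simp: measurable_cong_sets[OF sets_P refl])

lemma restrict_measurable [measurable]: "(\<lambda>\<omega>. restrict \<omega> J) \<in> P \<rightarrow>\<^sub>M PiM J (\<lambda>_. chain_space M)"
  unfolding measurable_cong_sets[OF sets_P refl] by (rule measurable_restrict_subset) simp

text \<open>Connects the projective family behind \<open>jump_law\<close> with the iterated kernels,
  whose integrals can be unfolded step by step.\<close>

lemma CI_eq_C: "IT.CI {0..<n} = IT.C 0 n (\<lambda>_. undefined)"
proof (rule measure_eqI)
  show "sets (IT.CI {0..<n}) = sets (IT.C 0 n (\<lambda>_. undefined))"
    using IT.sets_C[of "\<lambda>_. undefined" 0 n] by (simp add: IT.CI_def)
  fix X assume "X \<in> sets (IT.CI {0..<n})"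
  then have X: "X \<in> sets (PiM {0..<n} (\<lambda>_. chain_space M))" by (simp add: IT.CI_def)
  have "IT.PF.emb {0..<n} {0..<n} X = X"
    using sets.sets_into_space[OF X] unfolding space_PiM by (rule prod_emb_id)
  then show "emeasure (IT.CI {0..<n}) X = emeasure (IT.C 0 n (\<lambda>_. undefined)) X"
    using IT.emeasure_CI[OF subset_refl X] by simp
qed

lemma nn_integral_P_restrict:
  assumes "F \<in> borel_measurable (PiM {0..<n} (\<lambda>_. chain_space M))"
  shows "(\<integral>\<^sup>+\<omega>. F (restrict \<omega> {0..<n}) \<partial>P) = (\<integral>\<^sup>+\<eta>. F \<eta> \<partial>IT.C 0 n (\<lambda>_. undefined))"
proof -
  have "(\<integral>\<^sup>+\<omega>. F (restrict \<omega> {0..<n}) \<partial>P) = (\<integral>\<^sup>+\<eta>. F \<eta> \<partial>distr P (PiM {0..<n} (\<lambda>_. chain_space M)) (\<lambda>\<omega>. restrict \<omega> {0..<n}))"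
    using assms by (subst nn_integral_distr[OF restrict_measurable]) simp_all
  also have "distr P (PiM {0..<n} (\<lambda>_. chain_space M)) (\<lambda>\<omega>. restrict \<omega> {0..<n}) = IT.C 0 n (\<lambda>_. undefined)"
    unfolding jump_law_eq by (subst IT.distr_lim) (simp_all add: CI_eq_C)
  finally show ?thesis .
qed

sublocale P: prob_space P
proof (rule prob_spaceI)
  have "emeasure P (space P) = (\<integral>\<^sup>+\<omega>. 1 \<partial>P)" by simp
  also have "\<dots> = (\<integral>\<^sup>+\<omega>. 1 \<partial>IT.C 0 0 (\<lambda>_. undefined))"
    using nn_integral_P_restrict[of "\<lambda>_. 1" 0] by simp
  also have "\<dots> = emeasure (IT.C 0 0 (\<lambda>_. undefined)) (space (IT.C 0 0 (\<lambda>_. undefined)))" by simp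
  also have "\<dots> = 1"
    by (rule prob_space.emeasure_space_1[OF IT.prob_space_C]) simp
  finally show "emeasure P (space P) = 1" .
qed

text \<open>The law of the first \<open>Suc n\<close> coordinates is the law of the first
  \<open>n\<close> composed with the next kernel.\<close>

lemma nn_integral_P_step:
  assumes F: "F \<in> borel_measurable (PiM {0..<Suc n} (\<lambda>_. chain_space M))"
  shows "(\<integral>\<^sup>+\<omega>. F (restrict \<omega> {0..<Suc n}) \<partial>P) =
    (\<integral>\<^sup>+\<eta>. (\<integral>\<^sup>+z. F (\<eta>(n := z)) \<partial>(case n of 0 \<Rightarrow> return (chain_space M) (Some (0, x)) | Suc m \<Rightarrow> jump_kernel M q (\<eta> m)))
      \<partial>IT.C 0 n (\<lambda>_. undefined))"
proof -
  have u: "(\<lambda>_. undefined) \<in> space (PiM {0..<0::nat} (\<lambda>_. chain_space M))" by simp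
  have "(\<integral>\<^sup>+\<eta>. F \<eta> \<partial>IT.C 0 (Suc n) (\<lambda>_. undefined)) = (\<integral>\<^sup>+\<eta>. (\<integral>\<^sup>+\<zeta>. F \<zeta> \<partial>IT.eP n \<eta>) \<partial>IT.C 0 n (\<lambda>_. undefined))"
    unfolding IT.C.simps add_0
  proof (rule nn_integral_bind[OF F])
    show "IT.eP n \<in> IT.C 0 n (\<lambda>_. undefined) \<rightarrow>\<^sub>M subprob_algebra (PiM {0..<Suc n} (\<lambda>_. chain_space M))"
      using IT.measurable_eP[of n] by (simp add: measurable_cong_sets[OF IT.sets_C[OF u, of n] refl])
  qed
  also have "\<dots> = (\<integral>\<^sup>+\<eta>. (\<integral>\<^sup>+z. F (\<eta>(n := z)) \<partial>(case n of 0 \<Rightarrow> return (chain_space M) (Some (0, x)) | Suc m \<Rightarrow> jump_kernel M q (\<eta> m)))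
      \<partial>IT.C 0 n (\<lambda>_. undefined))"
    by (intro nn_integral_cong IT.nn_integral_eP F) (simp only: IT.space_C[OF u] add_0)
  finally show ?thesis using nn_integral_P_restrict[OF F] by simp
qed

lemma nn_integral_initial:
  assumes H: "H \<in> borel_measurable (chain_space M)"
  shows "(\<integral>\<^sup>+\<omega>. H (\<omega> 0) \<partial>P) = H (Some (0, x))"
proof -
  have "(\<lambda>\<eta>. H (\<eta> 0)) \<in> borel_measurable (PiM {0..<Suc 0} (\<lambda>_. chain_space M))"
    by (rule measurable_compose[OF measurable_component_singleton[of 0 "{0..<Suc 0}" "\<lambda>_. chain_space M"] H]) simp
  from nn_integral_P_step[OF this]
  have "(\<integral>\<^sup>+\<omega>. H (\<omega> 0) \<partial>P) = (\<integral>\<^sup>+\<eta>. H (Some (0, x)) \<partial>IT.C 0 0 (\<lambda>_. undefined))"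
    using H x by (simp add: nn_integral_return space_pair_measure)
  also have "\<dots> = H (Some (0, x)) * emeasure (IT.C 0 0 (\<lambda>_. undefined)) (space (IT.C 0 0 (\<lambda>_. undefined)))"
    by (rule nn_integral_const)
  also have "emeasure (IT.C 0 0 (\<lambda>_. undefined)) (space (IT.C 0 0 (\<lambda>_. undefined))) = 1"
    by (rule prob_space.emeasure_space_1[OF IT.prob_space_C]) simp
  finally show ?thesis by simp
qed

text \<open>The Markov property in the only form that is used. The next kernel reads coordinate
  \<open>n\<close> alone, so integrating out coordinate \<open>Suc n\<close> leaves a function of
  the first \<open>Suc n\<close> coordinates, whose integral is again an expectation under
  \<open>P\<close>.\<close>

lemma nn_integral_consecutive:
  assumes H: "case_prod H \<in> borel_measurable (chain_space M \<Otimes>\<^sub>M chain_space M)"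
  shows "(\<integral>\<^sup>+\<omega>. H (\<omega> n) (\<omega> (Suc n)) \<partial>P) = (\<integral>\<^sup>+\<omega>. (\<integral>\<^sup>+z. H (\<omega> n) z \<partial>jump_kernel M q (\<omega> n)) \<partial>P)"
proof -
  have c: "(\<lambda>\<eta>. \<eta> i) \<in> PiM {0..<k} (\<lambda>_. chain_space M) \<rightarrow>\<^sub>M chain_space M" if "i < k" for i k :: nat
    by (rule measurable_component_singleton) (use that in auto)
  have F: "(\<lambda>\<eta>. H (\<eta> n) (\<eta> (Suc n))) \<in> borel_measurable (PiM {0..<Suc (Suc n)} (\<lambda>_. chain_space M))"
    using measurable_compose[OF measurable_Pair[OF c[of n] c[of "Suc n"]] H] by simp
  have G: "(\<lambda>\<eta>. \<integral>\<^sup>+z. H (\<eta> n) z \<partial>jump_kernel M q (\<eta> n)) \<in> borel_measurable (PiM {0..<Suc n} (\<lambda>_. chain_space M))"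
  proof (rule measurable_compose[OF c[of n]])
    show "(\<lambda>y. \<integral>\<^sup>+z. H y z \<partial>jump_kernel M q y) \<in> borel_measurable (chain_space M)"
      by (rule nn_integral_measurable_subprob_algebra2[OF H jump_kernel_measurable])
  qed simp
  show ?thesis
    using nn_integral_P_step[OF F] nn_integral_P_restrict[OF G] by simp
qed

text \<open>From \<open>(t, y)\<close> the kernel charges only later times and \<open>None\<close>,
  and \<open>None\<close> is never left. The weak inequality also covers consecutive infinite jump
  times.\<close>

lemma AE_jump_time_mono: "AE \<omega> in P. \<forall>n. jump_time \<omega> n \<le> jump_time \<omega> (Suc n)"
  unfolding AE_all_countable
proof
  fix n
  define H :: "(real \<times> 'a) option \<Rightarrow> (real \<times> 'a) option \<Rightarrow> ennreal"
    where "H z w = (if entry_time w < entry_time z then 1 else 0)" for z w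
  have H[measurable]: "case_prod H \<in> borel_measurable (chain_space M \<Otimes>\<^sub>M chain_space M)"
    unfolding H_def split_beta' by measurable
  have "(\<integral>\<^sup>+\<omega>. H (\<omega> n) (\<omega> (Suc n)) \<partial>P) = (\<integral>\<^sup>+\<omega>. 0 \<partial>P)"
    unfolding nn_integral_consecutive[OF H]
  proof (rule nn_integral_cong)
    fix \<omega> assume "\<omega> \<in> space P"
    then have \<omega>: "\<omega> n \<in> space (chain_space M)" by (rule path_in_space)
    have Hz: "H z \<in> borel_measurable (chain_space M)" if "z \<in> space (chain_space M)" for z
      using measurable_Pair2[OF H that] by simp
    show "(\<integral>\<^sup>+z. H (\<omega> n) z \<partial>jump_kernel M q (\<omega> n)) = 0"
    proof (cases "\<omega> n")
      case None
      have "H None \<in> borel_measurable (chain_space M)" by (rule Hz) simp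
      then show ?thesis using None by (simp add: jump_kernel_def nn_integral_return H_def[of None None])
    next
      case (Some a)
      then obtain t y where \<omega>n: "\<omega> n = Some (t, y)" "y \<in> space M" "0 \<le> t"
        using \<omega> by (cases a) (auto simp: space_pair_measure)
      have "(\<lambda>u. indicator {t<..} u * (ennreal (survival q y t u) * (\<integral>\<^sup>+w. H (Some (t, y)) (Some (u, w)) \<partial>q_tilde M q y u)))
        = (\<lambda>u. 0 :: ennreal)"
        by (auto simp: H_def fun_eq_iff split: split_indicator)
      then show ?thesis
        using nn_integral_jump_kernel[OF Hz[OF \<omega>] \<omega>n(2,3)] \<omega>n(1) by (simp add: H_def[of _ None])
    qed
  qed
  then have "AE \<omega> in P. H (\<omega> n) (\<omega> (Suc n)) = 0"
    by (subst nn_integral_0_iff_AE[symmetric]) auto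
  then show "AE \<omega> in P. jump_time \<omega> n \<le> jump_time \<omega> (Suc n)"
    by eventually_elim (auto simp: H_def jump_time_eq split: if_splits)
qed

section \<open>Expectations on the event that the n-th jump takes place\<close>

definition Psi :: "nat \<Rightarrow> (real \<Rightarrow> 'a \<Rightarrow> ennreal) \<Rightarrow> ennreal" where
  "Psi n k = (\<integral>\<^sup>+\<omega>. (case \<omega> n of None \<Rightarrow> 0 | Some p \<Rightarrow> k (fst p) (snd p)) \<partial>P)"

text \<open>The integral of \<open>h\<close> against the summand \<open>P_q^(n)(0, x, s, .)\<close>
  of the q-transition function, realised on paths.\<close>

definition Pn :: "nat \<Rightarrow> real \<Rightarrow> ('a \<Rightarrow> ennreal) \<Rightarrow> ennreal" where
  "Pn n s h = (\<integral>\<^sup>+\<omega>. (if entry_time (\<omega> n) \<le> ereal s \<and> ereal s < entry_time (\<omega> (Suc n))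
     then (case \<omega> n of None \<Rightarrow> 0 | Some p \<Rightarrow> h (snd p)) else 0) \<partial>P)"

lemma Psi_cong:
  assumes "\<And>u y. 0 \<le> u \<Longrightarrow> y \<in> space M \<Longrightarrow> k u y = k' u y"
  shows "Psi n k = Psi n k'"
  unfolding Psi_def
proof (rule nn_integral_cong)
  fix \<omega> assume "\<omega> \<in> space P"
  from path_in_space[OF this, of n] show "(case \<omega> n of None \<Rightarrow> 0 | Some p \<Rightarrow> k (fst p) (snd p)) = (case \<omega> n of None \<Rightarrow> 0 | Some p \<Rightarrow> k' (fst p) (snd p))"
    using assms by (auto simp: space_pair_measure)
qed

lemma Psi_mono:
  assumes "\<And>u y. 0 \<le> u \<Longrightarrow> y \<in> space M \<Longrightarrow> k u y \<le> k' u y"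
  shows "Psi n k \<le> Psi n k'"
  unfolding Psi_def
proof (rule nn_integral_mono)
  fix \<omega> assume "\<omega> \<in> space P"
  from path_in_space[OF this, of n] show "(case \<omega> n of None \<Rightarrow> 0 | Some p \<Rightarrow> k (fst p) (snd p)) \<le> (case \<omega> n of None \<Rightarrow> 0 | Some p \<Rightarrow> k' (fst p) (snd p))"
    using assms by (auto simp: space_pair_measure)
qed

lemma Psi_integrand_measurable [measurable]:
  fixes k :: "real \<Rightarrow> 'a \<Rightarrow> ennreal"
  assumes [measurable]: "case_prod k \<in> borel_measurable EM"
  shows "(\<lambda>\<omega>. case \<omega> n of None \<Rightarrow> 0 | Some p \<Rightarrow> k (fst p) (snd p)) \<in> borel_measurable P"
  by measurable

lemma Psi_add:
  assumes k: "case_prod k \<in> borel_measurable EM" and k': "case_prod k' \<in> borel_measurable EM"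
  shows "Psi n (\<lambda>u y. k u y + k' u y) = Psi n k + Psi n k'"
  unfolding Psi_def nn_integral_add[OF Psi_integrand_measurable[OF k] Psi_integrand_measurable[OF k'], symmetric]
  by (intro nn_integral_cong) (auto split: option.split)

lemma Psi_cmult:
  assumes k: "case_prod k \<in> borel_measurable EM"
  shows "Psi n (\<lambda>u y. c * k u y) = c * Psi n k"
  unfolding Psi_def nn_integral_cmult[OF Psi_integrand_measurable[OF k], symmetric]
  by (intro nn_integral_cong) (auto split: option.split)

lemma Psi_0:
  assumes [measurable]: "case_prod k \<in> borel_measurable EM"
  shows "Psi 0 k = k 0 x"
  unfolding Psi_def by (subst nn_integral_initial) auto

text \<open>Conditioning on the \<open>n\<close>-th state. Paths without a further jump contribute
  0, so the defect mass of the kernel drops out.\<close>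

lemma Psi_Suc:
  assumes k[measurable]: "case_prod k \<in> borel_measurable EM"
  shows "Psi (Suc n) k = Psi n (\<lambda>u y. \<integral>\<^sup>+v. indicator {u<..} v * (ennreal (survival q y u v) * (\<integral>\<^sup>+z. k v z \<partial>q_tilde M q y v)) \<partial>halfline)"
proof -
  define H :: "(real \<times> 'a) option \<Rightarrow> (real \<times> 'a) option \<Rightarrow> ennreal"
    where "H z w = (case w of None \<Rightarrow> 0 | Some p \<Rightarrow> k (fst p) (snd p))" for z w
  have H[measurable]: "case_prod H \<in> borel_measurable (chain_space M \<Otimes>\<^sub>M chain_space M)"
    unfolding H_def split_beta' by measurable
  have Hz: "H z \<in> borel_measurable (chain_space M)" for z
    unfolding H_def by measurable
  show ?thesis
    unfolding Psi_def
    using nn_integral_consecutive[OF H, of n]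
  proof (subst (asm) H_def, elim ssubst, intro nn_integral_cong)
    fix \<omega> assume "\<omega> \<in> space P"
    then have \<omega>: "\<omega> n \<in> space (chain_space M)" by (rule path_in_space)
    show "(\<integral>\<^sup>+z. H (\<omega> n) z \<partial>jump_kernel M q (\<omega> n)) = (case \<omega> n of None \<Rightarrow> 0 | Some p \<Rightarrow>
       \<integral>\<^sup>+v. indicator {fst p<..} v * (ennreal (survival q (snd p) (fst p) v) * (\<integral>\<^sup>+z. k v z \<partial>q_tilde M q (snd p) v)) \<partial>halfline)"
    proof (cases "\<omega> n")
      case None
      then show ?thesis using Hz by (simp add: jump_kernel_def nn_integral_return H_def[of None None])
    next
      case (Some a)
      then obtain t y where \<omega>n: "\<omega> n = Some (t, y)" "y \<in> space M" "0 \<le> t"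
        using \<omega> by (cases a) (auto simp: space_pair_measure)
      show ?thesis
        using nn_integral_jump_kernel[OF Hz[of "\<omega> n"] \<omega>n(2,3)] \<omega>n(1) by (simp add: H_def)
    qed
  qed
qed

text \<open>Jump times are integrated over open half-lines, survival identities over closed
  intervals; the two differ in a single point.\<close>

lemma AE_halfline_neq: "AE v in halfline. v \<noteq> u"
  by (subst AE_restrict_space_iff) (auto intro: AE_mp[OF AE_lborel_singleton[of u]])

text \<open>Given the \<open>n\<close>-th state \<open>(u, y)\<close> with \<open>u \<le> s\<close>,
  the conditional probability of no further jump up to \<open>s\<close> is
  \<open>survival q y u s\<close>.\<close>

lemma Pn_eq:
  assumes h[measurable]: "h \<in> borel_measurable M" and s: "0 \<le> s"
  shows "Pn n s h = Psi n (\<lambda>u y. if u \<le> s then ennreal (survival q y u s) * h y else 0)"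
proof -
  define H :: "(real \<times> 'a) option \<Rightarrow> (real \<times> 'a) option \<Rightarrow> ennreal"
    where "H z w = (if entry_time z \<le> ereal s \<and> ereal s < entry_time w
       then (case z of None \<Rightarrow> 0 | Some p \<Rightarrow> h (snd p)) else 0)" for z w
  have H[measurable]: "case_prod H \<in> borel_measurable (chain_space M \<Otimes>\<^sub>M chain_space M)"
    unfolding H_def split_beta' by measurable
  show ?thesis
    unfolding Psi_def Pn_def
    using nn_integral_consecutive[OF H, of n]
  proof (subst (asm) H_def, elim ssubst, intro nn_integral_cong)
    fix \<omega> assume "\<omega> \<in> space P"
    then have \<omega>: "\<omega> n \<in> space (chain_space M)" by (rule path_in_space)
    show "(\<integral>\<^sup>+z. H (\<omega> n) z \<partial>jump_kernel M q (\<omega> n)) = (case \<omega> n of None \<Rightarrow> 0 | Some p \<Rightarrow>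
       if fst p \<le> s then ennreal (survival q (snd p) (fst p) s) * h (snd p) else 0)"
    proof (cases "\<omega> n")
      case None
      then show ?thesis by (simp add: H_def)
    next
      case (Some a)
      then obtain u y where \<omega>n: "\<omega> n = Some (u, y)" "y \<in> space M" "0 \<le> u"
        using \<omega> by (cases a) (auto simp: space_pair_measure)
      show ?thesis
      proof (cases "u \<le> s")
        case False
        then show ?thesis using \<omega>n by (simp add: H_def)
      next
        case True
        let ?K = "jump_kernel M q (Some (u, y))"
        interpret K: prob_space ?K using prob_space_jump_kernel[OF \<omega>] \<omega>n by simp
        have sK [measurable_cong]: "sets ?K = sets (chain_space M)" using sets_jump_kernel[OF \<omega>] \<omega>n by simp
        \<comment> \<open>The event \<open>after\<close> contains the case of no further jump at
          all, so its probability is obtained as the complement of that of \<open>before\<close>,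
          which is an integral over the bounded interval \<open>{u..s}\<close>.\<close>
        define before where "before w = (if entry_time w \<le> ereal s then 1 else 0 :: ennreal)" for w :: "(real \<times> 'a) option"
        define after where "after w = (if ereal s < entry_time w then 1 else 0 :: ennreal)" for w :: "(real \<times> 'a) option"
        have [measurable]: "before \<in> borel_measurable (chain_space M)" "after \<in> borel_measurable (chain_space M)"
          unfolding before_def after_def by measurable
        have "(\<integral>\<^sup>+w. before w \<partial>?K) = (\<integral>\<^sup>+v. ennreal (q_rate q y v * survival q y u v) * indicator {u..s} v \<partial>halfline)"
          unfolding nn_integral_jump_kernel[OF \<open>before \<in> _\<close> \<omega>n(2,3)]
        proof -
          have "(\<integral>\<^sup>+v. indicator {u<..} v * (ennreal (survival q y u v) * (\<integral>\<^sup>+z. before (Some (v, z)) \<partial>q_tilde M q y v)) \<partial>halfline)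
            = (\<integral>\<^sup>+v. ennreal (q_rate q y v * survival q y u v) * indicator {u..s} v \<partial>halfline)"
          proof (rule nn_integral_cong_AE, use AE_halfline_neq[of u] AE_space[of halfline] in eventually_elim)
            case (elim v)
            then have v: "0 \<le> v" by (simp add: space_restrict_space)
            have "(\<integral>\<^sup>+z. before (Some (v, z)) \<partial>q_tilde M q y v) = (if v \<le> s then ennreal (q_rate q y v) else 0)"
              using emeasure_q_tilde_space[OF \<omega>n(2) v] by (simp add: before_def)
            then show ?case using elim(1) v q_rate_nonneg[OF \<omega>n(2) v]
              by (auto simp: ennreal_mult mult.commute split: split_indicator)
          qed
          then show "(\<integral>\<^sup>+v. indicator {u<..} v * (ennreal (survival q y u v) * (\<integral>\<^sup>+z. before (Some (v, z)) \<partial>q_tilde M q y v)) \<partial>halfline)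
              + (1 - jump_mass u y (space (chain_space M))) * before None
            = (\<integral>\<^sup>+v. ennreal (q_rate q y v * survival q y u v) * indicator {u..s} v \<partial>halfline)"
            by (simp add: before_def[of None])
        qed
        then have 1: "(\<integral>\<^sup>+w. before w \<partial>?K) + ennreal (survival q y u s) = 1"
          using survival_identity[OF \<omega>n(2,3) True, of 0] by simp
        have K: "before \<in> borel_measurable ?K" "after \<in> borel_measurable ?K"
          by (simp_all add: measurable_cong_sets[OF sK refl])
        have "(\<integral>\<^sup>+w. before w \<partial>?K) + (\<integral>\<^sup>+w. after w \<partial>?K) = (\<integral>\<^sup>+w. before w + after w \<partial>?K)"
          by (rule nn_integral_add[symmetric, OF K])
        also have "\<dots> = (\<integral>\<^sup>+w. 1 \<partial>?K)"
          by (intro nn_integral_cong) (auto simp: before_def after_def)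
        also have "\<dots> = 1" using K.emeasure_space_1 by simp
        finally have 2: "(\<integral>\<^sup>+w. before w \<partial>?K) + (\<integral>\<^sup>+w. after w \<partial>?K) = 1" .
        then have "(\<integral>\<^sup>+w. before w \<partial>?K) \<noteq> top" by (metis ennreal_add_eq_top ennreal_one_neq_top)
        then have after: "(\<integral>\<^sup>+w. after w \<partial>?K) = ennreal (survival q y u s)"
          using 1 2 by (metis ennreal_add_left_cancel infinity_ennreal_def)
        have "(\<integral>\<^sup>+z. H (Some (u, y)) z \<partial>?K) = (\<integral>\<^sup>+z. h y * after z \<partial>?K)"
          using True by (intro nn_integral_cong) (simp add: H_def after_def)
        also have "\<dots> = h y * (\<integral>\<^sup>+z. after z \<partial>?K)" by (rule nn_integral_cmult[OF K(2)])
        finally show ?thesis using True after \<omega>n by (simp add: mult.commute)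
      qed
    qed
  qed
qed

lemma Psi_Fubini:
  assumes k: "(\<lambda>(s, u, y). k s u y) \<in> borel_measurable (time_space \<Otimes>\<^sub>M EM)"
  shows "(\<integral>\<^sup>+s. Psi n (k s) \<partial>halfline) = Psi n (\<lambda>u y. \<integral>\<^sup>+s. k s u y \<partial>halfline)"
proof -
  interpret PP: pair_sigma_finite P halfline ..
  have [measurable]: "(\<lambda>p. k (snd (fst p)) (fst (snd p)) (snd (snd p))) \<in> borel_measurable ((P \<Otimes>\<^sub>M time_space) \<Otimes>\<^sub>M EM)"
  proof -
    have "(\<lambda>p. (snd (fst p), snd p)) \<in> (P \<Otimes>\<^sub>M time_space) \<Otimes>\<^sub>M EM \<rightarrow>\<^sub>M time_space \<Otimes>\<^sub>M EM" by measurable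
    from measurable_compose[OF this k] show ?thesis by (simp add: split_beta')
  qed
  have "(\<lambda>p. case fst p n of None \<Rightarrow> 0 | Some r \<Rightarrow> k (snd p) (fst r) (snd r)) \<in> borel_measurable (P \<Otimes>\<^sub>M time_space)"
    by measurable
  then have m: "(\<lambda>p. case fst p n of None \<Rightarrow> 0 | Some r \<Rightarrow> k (snd p) (fst r) (snd r)) \<in> borel_measurable (P \<Otimes>\<^sub>M halfline)"
    by (simp add: measurable_cong_sets[OF sets_pair_measure_cong[OF refl sets_halfline] refl])
  have swap: "(case z of None \<Rightarrow> 0 | Some r \<Rightarrow> \<integral>\<^sup>+s. k s (fst r) (snd r) \<partial>halfline)
      = (\<integral>\<^sup>+s. (case z of None \<Rightarrow> 0 | Some r \<Rightarrow> k s (fst r) (snd r)) \<partial>halfline)" for z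
    by (cases z) auto
  show ?thesis
    unfolding Psi_def swap using PP.Fubini[OF m] by (simp only: fst_conv snd_conv)
qed

lemma measurable_snd_const:
  assumes "case_prod (h :: real \<Rightarrow> 'a \<Rightarrow> ennreal) \<in> borel_measurable EM" "0 \<le> s"
  shows "h s \<in> borel_measurable M"
  using measurable_Pair2[OF assms(1), of s] assms(2) by simp

text \<open>The forward form of \<open>Psi_Suc\<close>: once the expectation over the
  \<open>n\<close>-th state and the integral over the next jump time \<open>v\<close> are exchanged,
  \<open>Pn_eq\<close> absorbs the survival factor into the law of the state at time
  \<open>v\<close> after exactly \<open>n\<close> jumps.\<close>

lemma Psi_Suc':
  assumes k[measurable]: "case_prod k \<in> borel_measurable EM"
  shows "Psi (Suc n) k = (\<integral>\<^sup>+v. Pn n v (\<lambda>y. \<integral>\<^sup>+z. k v z \<partial>q_tilde M q y v) \<partial>halfline)"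
proof -
  let ?h = "\<lambda>v y. \<integral>\<^sup>+z. k v z \<partial>q_tilde M q y v"
  have [measurable]: "(\<lambda>p. k (fst p) (snd p)) \<in> borel_measurable EM" using k by (simp add: split_beta')
  have h[measurable]: "(\<lambda>p. ?h (fst p) (snd p)) \<in> borel_measurable EM"
    by (rule nn_integral_q_tilde_measurable) measurable
  have hv: "?h v \<in> borel_measurable M" if "0 \<le> v" for v
    using measurable_snd_const[of ?h v] h that by (simp add: split_beta')
  have [measurable]: "(\<lambda>p. survival q (snd (snd p)) (fst (snd p)) (fst p)) \<in> borel_measurable (time_space \<Otimes>\<^sub>M EM)"
  proof (rule survival_measurable)
    show "fst \<in> borel_measurable (time_space \<Otimes>\<^sub>M EM)" by (rule measurable_time_borel) measurable
  qed measurable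
  have [measurable]: "fst \<in> borel_measurable (time_space \<Otimes>\<^sub>M EM)" "(\<lambda>p. fst (snd p)) \<in> borel_measurable (time_space \<Otimes>\<^sub>M EM)"
    by (rule measurable_time_borel, measurable)+
  have [measurable]: "(\<lambda>p. ?h (fst p) (snd (snd p))) \<in> borel_measurable (time_space \<Otimes>\<^sub>M EM)"
  proof -
    have "(\<lambda>p. (fst p, snd (snd p))) \<in> time_space \<Otimes>\<^sub>M EM \<rightarrow>\<^sub>M EM" by measurable
    from measurable_compose[OF this h] show ?thesis by simp
  qed
  have "(\<integral>\<^sup>+v. Pn n v (?h v) \<partial>halfline)
    = (\<integral>\<^sup>+v. Psi n (\<lambda>u y. if u \<le> v then ennreal (survival q y u v) * ?h v y else 0) \<partial>halfline)"
    by (intro nn_integral_cong Pn_eq hv) (auto simp: space_restrict_space)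
  also have "\<dots> = Psi n (\<lambda>u y. \<integral>\<^sup>+v. (if u \<le> v then ennreal (survival q y u v) * ?h v y else 0) \<partial>halfline)"
    by (rule Psi_Fubini) (unfold split_beta', measurable)
  also have "\<dots> = Psi n (\<lambda>u y. \<integral>\<^sup>+v. indicator {u<..} v * (ennreal (survival q y u v) * ?h v y) \<partial>halfline)"
  proof (rule Psi_cong, rule nn_integral_cong_AE)
    show "AE v in halfline. (if u \<le> v then ennreal (survival q y u v) * ?h v y else 0)
      = indicator {u<..} v * (ennreal (survival q y u v) * ?h v y)" for u y
      using AE_halfline_neq[of u] by eventually_elim (auto split: split_indicator)
  qed
  finally show ?thesis by (simp add: Psi_Suc[OF k])
qed

text \<open>Both terms on the left are expectations over the \<open>n\<close>-th state
  \<open>(u, y)\<close>; for \<open>u \<le> t\<close> their integrands add up to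
  \<open>exp (- b * u) * h y\<close> by \<open>survival_identity\<close> started at
  \<open>u\<close>.\<close>

lemma Pn_identity:
  assumes h[measurable]: "h \<in> borel_measurable M" and t: "0 \<le> t" and b: "0 \<le> b"
  shows "ennreal (exp (- b * t)) * Pn n t h
      + (\<integral>\<^sup>+s. indicator {..t} s * (ennreal (exp (- b * s)) * Pn n s (\<lambda>y. ennreal (b + q_rate q y s) * h y)) \<partial>halfline)
    = Psi n (\<lambda>u y. if u \<le> t then ennreal (exp (- b * u)) * h y else 0)"
proof -
  define k where "k s u y = indicator {..t} s * (ennreal (exp (- b * s)) *
      (if u \<le> s then ennreal (survival q y u s) * (ennreal (b + q_rate q y s) * h y) else 0))" for s u y
  have [measurable]: "(\<lambda>p. survival q (snd (snd p)) (fst (snd p)) (fst p)) \<in> borel_measurable (time_space \<Otimes>\<^sub>M EM)"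
  proof (rule survival_measurable)
    show "fst \<in> borel_measurable (time_space \<Otimes>\<^sub>M EM)" by (rule measurable_time_borel) measurable
  qed measurable
  have [measurable]: "(\<lambda>p. survival q (snd p) (fst p) t) \<in> borel_measurable EM"
    by (rule survival_measurable) measurable
  have [measurable]: "fst \<in> borel_measurable (time_space \<Otimes>\<^sub>M EM)" "(\<lambda>p. fst (snd p)) \<in> borel_measurable (time_space \<Otimes>\<^sub>M EM)"
    by (rule measurable_time_borel, measurable)+
  have [measurable]: "(\<lambda>p. q_rate q (snd (snd p)) (fst p)) \<in> borel_measurable (time_space \<Otimes>\<^sub>M EM)"
    by (rule q_rate_measurable) measurable
  have k[measurable]: "(\<lambda>(s, u, y). k s u y) \<in> borel_measurable (time_space \<Otimes>\<^sub>M EM)"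
    unfolding k_def split_beta' indicator_def atMost_iff by measurable
  have ks: "(\<lambda>(u, y). if u \<le> s then ennreal (survival q y u s) * (ennreal (b + q_rate q y s) * h y) else 0) \<in> borel_measurable EM"
    if "0 \<le> s" for s
  proof -
    have [measurable]: "(\<lambda>p. survival q (snd p) (fst p) s) \<in> borel_measurable EM"
      by (rule survival_measurable) measurable
    have [measurable]: "(\<lambda>p. q_rate q (snd p) s) \<in> borel_measurable EM"
      by (rule q_rate_measurable) (use that in auto)
    show ?thesis unfolding split_beta' by measurable
  qed
  have "(\<integral>\<^sup>+s. indicator {..t} s * (ennreal (exp (- b * s)) * Pn n s (\<lambda>y. ennreal (b + q_rate q y s) * h y)) \<partial>halfline)
    = (\<integral>\<^sup>+s. Psi n (k s) \<partial>halfline)"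
  proof (rule nn_integral_halfline_cong)
    fix s :: real assume s: "0 \<le> s"
    have [measurable]: "(\<lambda>y. q_rate q y s) \<in> borel_measurable M"
      by (rule q_rate_measurable) (use s in auto)
    show "indicator {..t} s * (ennreal (exp (- b * s)) * Pn n s (\<lambda>y. ennreal (b + q_rate q y s) * h y)) = Psi n (k s)"
      unfolding k_def using ks[OF s]
      by (subst Pn_eq) (auto simp: s mult.assoc[symmetric] Psi_cmult[symmetric] split_beta')
  qed
  also have "\<dots> = Psi n (\<lambda>u y. \<integral>\<^sup>+s. k s u y \<partial>halfline)"
    by (rule Psi_Fubini[OF k])
  finally have 1: "(\<integral>\<^sup>+s. indicator {..t} s * (ennreal (exp (- b * s)) * Pn n s (\<lambda>y. ennreal (b + q_rate q y s) * h y)) \<partial>halfline)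
    = Psi n (\<lambda>u y. \<integral>\<^sup>+s. k s u y \<partial>halfline)" .
  have m1: "(\<lambda>(u, y). if u \<le> t then ennreal (survival q y u t) * h y else 0) \<in> borel_measurable EM"
    unfolding split_beta' by measurable
  have m2: "(\<lambda>(u, y). ennreal (exp (- b * t)) * (if u \<le> t then ennreal (survival q y u t) * h y else 0)) \<in> borel_measurable EM"
    using m1 unfolding split_beta' by measurable
  have m3: "(\<lambda>(u, y). \<integral>\<^sup>+s. k s u y \<partial>halfline) \<in> borel_measurable EM"
    unfolding split_beta'
  proof (rule borel_measurable_nn_integral_halfline)
    have "(\<lambda>p. (snd p, fst p)) \<in> EM \<Otimes>\<^sub>M time_space \<rightarrow>\<^sub>M time_space \<Otimes>\<^sub>M EM" by measurable
    from measurable_compose[OF this k] show "(\<lambda>(w, s). k s (fst w) (snd w)) \<in> borel_measurable (EM \<Otimes>\<^sub>M time_space)"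
      by (simp add: split_beta')
  qed
  have "ennreal (exp (- b * t)) * Pn n t h + Psi n (\<lambda>u y. \<integral>\<^sup>+s. k s u y \<partial>halfline)
    = Psi n (\<lambda>u y. ennreal (exp (- b * t)) * (if u \<le> t then ennreal (survival q y u t) * h y else 0)
        + (\<integral>\<^sup>+s. k s u y \<partial>halfline))"
    unfolding Psi_add[OF m2 m3] Psi_cmult[OF m1] Pn_eq[OF h t] ..
  also have "\<dots> = Psi n (\<lambda>u y. if u \<le> t then ennreal (exp (- b * u)) * h y else 0)"
  proof (rule Psi_cong)
    fix u :: real and y assume u: "0 \<le> u" and y: "y \<in> space M"
    show "ennreal (exp (- b * t)) * (if u \<le> t then ennreal (survival q y u t) * h y else 0)
        + (\<integral>\<^sup>+s. k s u y \<partial>halfline) = (if u \<le> t then ennreal (exp (- b * u)) * h y else 0)"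
    proof (cases "u \<le> t")
      case False
      then have "k s u y = 0" for s by (auto simp: k_def split: split_indicator)
      then show ?thesis using False by simp
    next
      case True
      let ?f = "\<lambda>s. ennreal ((b + q_rate q y s) * (exp (- b * (s - u)) * survival q y u s)) * indicator {u..t} s"
      \<comment> \<open>The discount is split at the jump time \<open>u\<close>, because
        \<open>survival_identity\<close> discounts from \<open>u\<close> on.\<close>
      have e: "ennreal (exp (- (b * s))) = ennreal (exp (- (b * u))) * ennreal (exp (- (b * (s - u))))" for s
        by (simp add: ennreal_mult[symmetric] exp_add[symmetric] algebra_simps)
      have "(\<integral>\<^sup>+s. k s u y \<partial>halfline) = (\<integral>\<^sup>+s. (ennreal (exp (- b * u)) * h y) * ?f s \<partial>halfline)"
      proof (rule nn_integral_halfline_cong)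
        fix s :: real assume s: "0 \<le> s"
        show "k s u y = (ennreal (exp (- b * u)) * h y) * ?f s"
          using q_rate_nonneg[OF y s] b
          by (auto simp: k_def e[of s] ennreal_mult ac_simps split: split_indicator)
      qed
      also have "\<dots> = (ennreal (exp (- b * u)) * h y) * (\<integral>\<^sup>+s. ?f s \<partial>halfline)"
      proof (rule nn_integral_cmult, rule borel_measurable_halfline)
        have [measurable]: "survival q y u \<in> borel_measurable time_space" "q_rate q y \<in> borel_measurable time_space"
          using y u by (auto intro: measurable_survival_time q_rate_measurable_time)
        show "?f \<in> borel_measurable time_space" by measurable
      qed
      finally have "ennreal (exp (- b * t)) * (ennreal (survival q y u t) * h y) + (\<integral>\<^sup>+s. k s u y \<partial>halfline)
        = (ennreal (exp (- b * u)) * h y) * ((\<integral>\<^sup>+s. ?f s \<partial>halfline) + ennreal (exp (- b * (t - u)) * survival q y u t))"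
        by (simp add: e[of t] ennreal_mult distrib_left ac_simps)
      then show ?thesis using True survival_identity[OF y u True b] by simp
    qed
  qed
  finally show ?thesis by (simp only: 1)
qed

end

text \<open>The truncated differences of \<open>ennreal\<close> are the positive and the negative
  part of the difference in \<open>ereal\<close>. There the difference of two infinite values does
  not change its sign when the terms are swapped, hence the condition on \<open>a\<close>.\<close>

lemma e2ennreal_diff:
  assumes "a \<noteq> top"
  shows "e2ennreal (enn2ereal a - enn2ereal b) = a - b"
    and "e2ennreal (- (enn2ereal a - enn2ereal b)) = b - a"
proof -
  have 1: "e2ennreal (enn2ereal a - enn2ereal b) = a - b" for a b
    by (simp add: e2ennreal_def minus_ennreal_def)
  show "e2ennreal (enn2ereal a - enn2ereal b) = a - b" by (rule 1)
  have "- (enn2ereal a - enn2ereal b) = enn2ereal b - enn2ereal a"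
    using assms by (intro ereal_minus_diff_eq) auto
  then show "e2ennreal (- (enn2ereal a - enn2ereal b)) = b - a" by (simp add: 1)
qed

section \<open>Integration over the time interval [0, t]\<close>

definition upto :: "real \<Rightarrow> (real \<Rightarrow> ennreal) \<Rightarrow> ennreal" where
  "upto t \<phi> = (\<integral>\<^sup>+s. indicator {..t} s * \<phi> s \<partial>halfline)"

lemma indicator_measurable_time [measurable]: "(indicator {..t} :: real \<Rightarrow> ennreal) \<in> borel_measurable time_space"
  by (rule measurable_restrict_space1) simp

lemma upto_add:
  assumes "\<phi> \<in> borel_measurable time_space" "\<psi> \<in> borel_measurable time_space"
  shows "upto t (\<lambda>s. \<phi> s + \<psi> s) = upto t \<phi> + upto t \<psi>"
  unfolding upto_def distrib_left
  by (rule nn_integral_add; rule borel_measurable_halfline) (use assms in measurable)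

lemma upto_cmult:
  assumes "\<phi> \<in> borel_measurable time_space"
  shows "upto t (\<lambda>s. a * \<phi> s) = a * upto t \<phi>"
proof -
  have "upto t (\<lambda>s. a * \<phi> s) = (\<integral>\<^sup>+s. a * (indicator {..t} s * \<phi> s) \<partial>halfline)"
    unfolding upto_def by (intro nn_integral_cong) (simp add: ac_simps)
  also have "\<dots> = a * upto t \<phi>"
    unfolding upto_def
    by (rule nn_integral_cmult, rule borel_measurable_halfline) (use assms in measurable)
  finally show ?thesis .
qed

lemma upto_suminf:
  assumes "\<And>n::nat. \<phi> n \<in> borel_measurable time_space"
  shows "upto t (\<lambda>s. \<Sum>n. \<phi> n s) = (\<Sum>n. upto t (\<phi> n))"
proof -
  have "upto t (\<lambda>s. \<Sum>n. \<phi> n s) = (\<integral>\<^sup>+s. (\<Sum>n. indicator {..t} s * \<phi> n s) \<partial>halfline)"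
    unfolding upto_def by (intro nn_integral_cong ennreal_suminf_cmult[symmetric])
  also have "\<dots> = (\<Sum>n. upto t (\<phi> n))"
    unfolding upto_def
    by (rule nn_integral_suminf, rule borel_measurable_halfline) (use assms in measurable)
  finally show ?thesis .
qed

lemma upto_mono:
  "(\<And>s. 0 \<le> s \<Longrightarrow> s \<le> t \<Longrightarrow> \<phi> s \<le> \<psi> s) \<Longrightarrow> upto t \<phi> \<le> upto t \<psi>"
  unfolding upto_def
  by (intro nn_integral_mono) (auto simp: space_restrict_space split: split_indicator)

lemma upto_cong:
  "(\<And>s. 0 \<le> s \<Longrightarrow> s \<le> t \<Longrightarrow> \<phi> s = \<psi> s) \<Longrightarrow> upto t \<phi> = upto t \<psi>"
  by (intro antisym upto_mono) auto

lemma upto_const: "0 \<le> t \<Longrightarrow> upto t (\<lambda>_. a) = a * ennreal t"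
proof -
  assume t: "0 \<le> t"
  have "upto t (\<lambda>_. a) = (\<integral>\<^sup>+s. a * indicator {0..t} s \<partial>lborel)"
    unfolding upto_def
    by (subst nn_integral_restrict_space) (auto intro!: nn_integral_cong split: split_indicator)
  also have "\<dots> = a * ennreal t" using t by (simp add: nn_integral_cmult_indicator)
  finally show ?thesis .
qed

lemma upto_lborel: "upto t \<phi> = (\<integral>\<^sup>+s\<in>{0..t}. \<phi> s \<partial>lborel)"
  unfolding upto_def
  by (subst nn_integral_restrict_space) (auto intro!: nn_integral_cong split: split_indicator)

section \<open>The law of the state at a fixed time\<close>

context started_jump_process
begin

text \<open>The integral of \<open>h\<close> against the transition function
  \<open>P_q(0, x, s, .)\<close>, of which \<open>Pn n s\<close> represents the \<open>n\<close>-th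
  summand.\<close>

definition mean :: "real \<Rightarrow> ('a \<Rightarrow> ennreal) \<Rightarrow> ennreal" where
  "mean s h = (\<integral>\<^sup>+\<omega>. (case jump_state \<omega> s of None \<Rightarrow> 0 | Some y \<Rightarrow> h y) \<partial>P)"

definition now :: "'a chain \<Rightarrow> real \<Rightarrow> nat \<Rightarrow> bool" where
  "now \<omega> s n \<longleftrightarrow> entry_time (\<omega> n) \<le> ereal s \<and> ereal s < entry_time (\<omega> (Suc n))"

lemma jump_state_eq:
  "jump_state \<omega> s = (if \<exists>n. now \<omega> s n
     then (case \<omega> (LEAST n. now \<omega> s n) of None \<Rightarrow> None | Some p \<Rightarrow> Some (snd p)) else None)"
  unfolding jump_state_def Let_def jump_time_eq now_def[symmetric] by (simp split: option.split)

text \<open>Joint measurability in path and time is what the interchange of time integral and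
  expectation requires. The random index is a least element with countably many possible
  values.\<close>

lemma jump_state_measurable:
  "(\<lambda>p. jump_state (fst p) (snd p)) \<in> P \<Otimes>\<^sub>M time_space \<rightarrow>\<^sub>M option_space M"
proof -
  have now[measurable]: "Measurable.pred (P \<Otimes>\<^sub>M time_space) (\<lambda>p. now (fst p) (snd p) n)" for n
    unfolding now_def by measurable
  have "(\<lambda>p. case fst p (LEAST n. now (fst p) (snd p) n) of None \<Rightarrow> None | Some r \<Rightarrow> Some (snd r))
      \<in> P \<Otimes>\<^sub>M time_space \<rightarrow>\<^sub>M option_space M"
  proof (rule measurable_compose_countable[where g="\<lambda>p. LEAST n. now (fst p) (snd p) n"])
    show "(\<lambda>p. case fst p n of None \<Rightarrow> None | Some r \<Rightarrow> Some (snd r)) \<in> P \<Otimes>\<^sub>M time_space \<rightarrow>\<^sub>M option_space M" for n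
      by measurable
    show "(\<lambda>p. LEAST n. now (fst p) (snd p) n) \<in> P \<Otimes>\<^sub>M time_space \<rightarrow>\<^sub>M count_space UNIV"
      by (rule measurable_Least) (rule now)
  qed
  then show ?thesis unfolding jump_state_eq by measurable
qed

lemma jump_state_integrand_measurable:
  assumes h: "case_prod h \<in> time_space \<Otimes>\<^sub>M M \<rightarrow>\<^sub>M N" and [measurable]: "a \<in> space N"
  shows "(\<lambda>p. case jump_state (fst p) (snd p) of None \<Rightarrow> a | Some y \<Rightarrow> h (snd p) y) \<in> P \<Otimes>\<^sub>M time_space \<rightarrow>\<^sub>M N"
proof -
  note jump_state_measurable[measurable]
  have "(\<lambda>p. (snd (fst p), snd p)) \<in> (P \<Otimes>\<^sub>M time_space) \<Otimes>\<^sub>M M \<rightarrow>\<^sub>M time_space \<Otimes>\<^sub>M M" by measurable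
  from measurable_compose[OF this h]
  have [measurable]: "(\<lambda>p. h (snd (fst p)) (snd p)) \<in> (P \<Otimes>\<^sub>M time_space) \<Otimes>\<^sub>M M \<rightarrow>\<^sub>M N" by simp
  show ?thesis by measurable
qed

lemma jump_state_fixed_time:
  assumes h[measurable]: "h \<in> M \<rightarrow>\<^sub>M N" and s: "0 \<le> s" and a: "a \<in> space N"
  shows "(\<lambda>\<omega>. case jump_state \<omega> s of None \<Rightarrow> a | Some y \<Rightarrow> h y) \<in> P \<rightarrow>\<^sub>M N"
proof -
  have "case_prod (\<lambda>s::real. h) \<in> time_space \<Otimes>\<^sub>M M \<rightarrow>\<^sub>M N" by measurable
  from measurable_Pair1[OF jump_state_integrand_measurable[OF this a], of s] s show ?thesis by simp
qed

lemma Pn_integrand_measurable: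
  assumes h: "case_prod h \<in> borel_measurable EM"
  shows "(\<lambda>p. if entry_time (snd p n) \<le> ereal (fst p) \<and> ereal (fst p) < entry_time (snd p (Suc n))
     then (case snd p n of None \<Rightarrow> 0 | Some r \<Rightarrow> h (fst p) (snd r)) else 0 :: ennreal) \<in> borel_measurable (time_space \<Otimes>\<^sub>M P)"
proof -
  have "(\<lambda>p. (fst (fst p), snd (snd p))) \<in> (time_space \<Otimes>\<^sub>M P) \<Otimes>\<^sub>M EM \<rightarrow>\<^sub>M time_space \<Otimes>\<^sub>M M" by measurable
  from measurable_compose[OF this h]
  have [measurable]: "(\<lambda>p. h (fst (fst p)) (snd (snd p))) \<in> borel_measurable ((time_space \<Otimes>\<^sub>M P) \<Otimes>\<^sub>M EM)" by simp
  show ?thesis by measurable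
qed

lemma Pn_measurable:
  assumes h: "case_prod h \<in> borel_measurable EM"
  shows "(\<lambda>s. Pn n s (h s)) \<in> borel_measurable time_space"
  unfolding Pn_def
  by (rule P.borel_measurable_nn_integral) (use Pn_integrand_measurable[OF h, of n] in \<open>simp add: split_beta'\<close>)

lemma Pn_integrand_fixed:
  assumes [measurable]: "h \<in> borel_measurable M"
  shows "(\<lambda>\<omega>. if entry_time (\<omega> n) \<le> ereal s \<and> ereal s < entry_time (\<omega> (Suc n))
     then (case \<omega> n of None \<Rightarrow> 0 | Some r \<Rightarrow> h (snd r)) else 0 :: ennreal) \<in> borel_measurable P"
  by measurable

lemma Pn_add:
  assumes "h \<in> borel_measurable M" "k \<in> borel_measurable M"
  shows "Pn n s (\<lambda>y. h y + k y) = Pn n s h + Pn n s k"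
  unfolding Pn_def nn_integral_add[OF Pn_integrand_fixed[OF assms(1)] Pn_integrand_fixed[OF assms(2)], symmetric]
  by (intro nn_integral_cong) (auto split: option.split)

lemma Pn_cmult:
  assumes "h \<in> borel_measurable M"
  shows "Pn n s (\<lambda>y. a * h y) = a * Pn n s h"
  unfolding Pn_def nn_integral_cmult[OF Pn_integrand_fixed[OF assms(1)], symmetric]
  by (intro nn_integral_cong) (auto split: option.split)

lemma Pn_cong:
  assumes "\<And>y. y \<in> space M \<Longrightarrow> h y = k y"
  shows "Pn n s h = Pn n s k"
  unfolding Pn_def
proof (rule nn_integral_cong)
  fix \<omega> assume "\<omega> \<in> space P"
  from path_in_space[OF this, of n]
  show "(if entry_time (\<omega> n) \<le> ereal s \<and> ereal s < entry_time (\<omega> (Suc n))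
     then (case \<omega> n of None \<Rightarrow> 0 | Some r \<Rightarrow> h (snd r)) else 0) =
    (if entry_time (\<omega> n) \<le> ereal s \<and> ereal s < entry_time (\<omega> (Suc n))
     then (case \<omega> n of None \<Rightarrow> 0 | Some r \<Rightarrow> k (snd r)) else 0)"
    using assms by (auto simp: space_pair_measure)
qed

lemma jump_state_in_space:
  assumes "\<omega> \<in> space P" shows "jump_state \<omega> s \<in> space (option_space M)"
proof -
  have "(case \<omega> n of None \<Rightarrow> None | Some p \<Rightarrow> Some (snd p)) \<in> space (option_space M)" for n
    using path_in_space[OF assms, of n] by (auto simp: space_pair_measure)
  then show ?thesis unfolding jump_state_eq by simp
qed

lemma mean_mono:
  assumes "\<And>y. y \<in> space M \<Longrightarrow> h y \<le> k y"
  shows "mean s h \<le> mean s k"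
  unfolding mean_def
proof (rule nn_integral_mono)
  fix \<omega> assume "\<omega> \<in> space P"
  from jump_state_in_space[OF this, of s] assms
  show "(case jump_state \<omega> s of None \<Rightarrow> 0 | Some y \<Rightarrow> h y) \<le> (case jump_state \<omega> s of None \<Rightarrow> 0 | Some y \<Rightarrow> k y)"
    by auto
qed

lemma mean_cong:
  assumes "\<And>y. y \<in> space M \<Longrightarrow> h y = k y"
  shows "mean s h = mean s k"
  using assms by (intro antisym mean_mono) auto

lemma mean_add:
  assumes "h \<in> borel_measurable M" "k \<in> borel_measurable M" "0 \<le> s"
  shows "mean s (\<lambda>y. h y + k y) = mean s h + mean s k"
  unfolding mean_def
    nn_integral_add[OF jump_state_fixed_time[OF assms(1,3), of 0] jump_state_fixed_time[OF assms(2,3), of 0], simplified, symmetric]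
  by (intro nn_integral_cong) (auto split: option.split)

lemma mean_cmult:
  assumes "h \<in> borel_measurable M" "0 \<le> s"
  shows "mean s (\<lambda>y. a * h y) = a * mean s h"
  unfolding mean_def nn_integral_cmult[OF jump_state_fixed_time[OF assms, of 0], simplified, symmetric]
  by (intro nn_integral_cong) (auto split: option.split)

text \<open>Almost surely the intervals between consecutive jump times are disjoint, so at most one
  summand is nonzero. If \<open>s\<close> lies in none of them, all summands vanish and the state is
  the cemetery with value 0; explosion is therefore allowed.\<close>

lemma mean_eq_suminf:
  assumes h: "h \<in> borel_measurable M"
  shows "mean s h = (\<Sum>n. Pn n s h)"
proof -
  let ?g = "\<lambda>n \<omega>. if entry_time (\<omega> n) \<le> ereal s \<and> ereal s < entry_time (\<omega> (Suc n))
     then (case \<omega> n of None \<Rightarrow> 0 | Some r \<Rightarrow> h (snd r)) else 0"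
  have "mean s h = (\<integral>\<^sup>+\<omega>. (\<Sum>n. ?g n \<omega>) \<partial>P)"
    unfolding mean_def
  proof (rule nn_integral_cong_AE, use AE_jump_time_mono in eventually_elim)
    fix \<omega> :: "'a chain" assume mono: "\<forall>n. jump_time \<omega> n \<le> jump_time \<omega> (Suc n)"
    have le: "entry_time (\<omega> m) \<le> entry_time (\<omega> n)" if "m \<le> n" for m n
      by (rule lift_Suc_mono_le[of "\<lambda>n. entry_time (\<omega> n)", OF _ that]) (use mono in \<open>simp add: jump_time_eq\<close>)
    define g where "g n = ?g n \<omega>" for n
    have g: "g n = (if now \<omega> s n then (case \<omega> n of None \<Rightarrow> 0 | Some r \<Rightarrow> h (snd r)) else 0)" for n
      by (simp only: g_def now_def)
    have "(case jump_state \<omega> s of None \<Rightarrow> 0 | Some y \<Rightarrow> h y) = (\<Sum>n. g n)"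
    proof (cases "\<exists>n. now \<omega> s n")
      case False
      then have "g = (\<lambda>_. 0)" by (simp add: g fun_eq_iff)
      moreover have "jump_state \<omega> s = None" using False by (simp add: jump_state_eq)
      ultimately show ?thesis by simp
    next
      case True
      define i where "i = (LEAST n. now \<omega> s n)"
      have i: "now \<omega> s i" using True unfolding i_def by (metis LeastI)
      have uniq: "n = i" if "now \<omega> s n" for n
      proof (rule ccontr)
        assume "n \<noteq> i"
        then have "Suc n \<le> i \<or> Suc i \<le> n" by auto
        then show False
        proof
          assume "Suc n \<le> i"
          have "ereal s < entry_time (\<omega> (Suc n))" using that by (simp add: now_def)
          also have "\<dots> \<le> entry_time (\<omega> i)" by (rule le) fact
          also have "\<dots> \<le> ereal s" using i by (simp add: now_def)
          finally show False by simp
        next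
          assume "Suc i \<le> n"
          have "ereal s < entry_time (\<omega> (Suc i))" using i by (simp add: now_def)
          also have "\<dots> \<le> entry_time (\<omega> n)" by (rule le) fact
          also have "\<dots> \<le> ereal s" using that by (simp add: now_def)
          finally show False by simp
        qed
      qed
      have "g n = 0" if "n \<noteq> i" for n
        using uniq that by (auto simp: g)
      then have "(\<lambda>n. if n = i then g n else 0) = g" by (intro ext) simp
      from sums_single[of i g, unfolded this] have "g sums g i" .
      then have "(\<Sum>n. g n) = g i" by (rule sums_unique[symmetric])
      also have "\<dots> = (case \<omega> i of None \<Rightarrow> 0 | Some r \<Rightarrow> h (snd r))" using i by (simp add: g)
      also have "\<dots> = (case jump_state \<omega> s of None \<Rightarrow> 0 | Some y \<Rightarrow> h y)"
        using True unfolding jump_state_eq i_def[symmetric] by (simp split: option.split)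
      finally show ?thesis ..
    qed
    then show "(case jump_state \<omega> s of None \<Rightarrow> 0 | Some y \<Rightarrow> h y) = (\<Sum>n. ?g n \<omega>)"
      by (simp only: g_def)
  qed
  also have "\<dots> = (\<Sum>n. Pn n s h)"
    unfolding Pn_def by (rule nn_integral_suminf) (rule Pn_integrand_fixed[OF h])
  finally show ?thesis .
qed

lemma mean_measurable:
  assumes h: "case_prod h \<in> borel_measurable EM"
  shows "(\<lambda>s. mean s (h s)) \<in> borel_measurable time_space"
proof -
  have "(\<lambda>s. \<Sum>n. Pn n s (h s)) \<in> borel_measurable time_space"
    using Pn_measurable[OF h] by measurable
  also have "?this \<longleftrightarrow> ?thesis"
    by (intro measurable_cong mean_eq_suminf[symmetric] measurable_snd_const[OF h]) simp
  finally show ?thesis .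
qed

lemma upto_mean:
  assumes h: "case_prod h \<in> borel_measurable EM"
  shows "upto t (\<lambda>s. mean s (h s)) = (\<Sum>n. upto t (\<lambda>s. Pn n s (h s)))"
proof -
  have "upto t (\<lambda>s. mean s (h s)) = upto t (\<lambda>s. \<Sum>n. Pn n s (h s))"
    by (intro upto_cong mean_eq_suminf measurable_snd_const[OF h]) simp
  also have "\<dots> = (\<Sum>n. upto t (\<lambda>s. Pn n s (h s)))"
    by (rule upto_suminf) (rule Pn_measurable[OF h])
  finally show ?thesis .
qed

section \<open>Discounted expectations at the jump times\<close>

definition WP :: "real \<Rightarrow> nat \<Rightarrow> real \<Rightarrow> ('a \<Rightarrow> ennreal) \<Rightarrow> ennreal" where
  "WP b n t h = Psi n (\<lambda>u y. if u \<le> t then ennreal (exp (- b * u)) * h y else 0)"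

lemma WP_integrand_measurable:
  assumes [measurable]: "h \<in> borel_measurable M"
  shows "(\<lambda>(u, y). if u \<le> t then ennreal (exp (- b * u)) * h y else 0) \<in> borel_measurable EM"
proof -
  show ?thesis unfolding split_beta' by measurable
qed

lemma WP_0: "h \<in> borel_measurable M \<Longrightarrow> 0 \<le> t \<Longrightarrow> WP b 0 t h = h x"
  unfolding WP_def using WP_integrand_measurable[of h t b] by (subst Psi_0) (auto simp: split_beta')

lemma WP_eq:
  assumes "h \<in> borel_measurable M" "0 \<le> t" "0 \<le> b"
  shows "WP b n t h = ennreal (exp (- b * t)) * Pn n t h
      + upto t (\<lambda>s. ennreal (exp (- b * s)) * Pn n s (\<lambda>y. ennreal (b + q_rate q y s) * h y))"
  unfolding WP_def upto_def using Pn_identity[OF assms] by simp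

lemma q_tilde_integral_measurable:
  assumes [measurable]: "h \<in> borel_measurable M"
  shows "(\<lambda>(s, y). \<integral>\<^sup>+z. h z \<partial>q_tilde M q y s) \<in> borel_measurable EM"
  unfolding split_beta' by (rule nn_integral_q_tilde_measurable) measurable

text \<open>An instance of \<open>Psi_Suc'\<close>: the weight depends on the jump time only and
  leaves the integral over the post-jump state.\<close>

lemma WP_Suc:
  assumes h: "h \<in> borel_measurable M"
  shows "WP b (Suc n) t h = upto t (\<lambda>s. ennreal (exp (- b * s)) * Pn n s (\<lambda>y. \<integral>\<^sup>+z. h z \<partial>q_tilde M q y s))"
  unfolding WP_def Psi_Suc'[OF WP_integrand_measurable[OF h, of t b]] upto_def
proof (rule nn_integral_halfline_cong)
  fix s :: real assume s: "0 \<le> s"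
  have m: "(\<lambda>y. \<integral>\<^sup>+z. h z \<partial>q_tilde M q y s) \<in> borel_measurable M"
    using measurable_snd_const[OF q_tilde_integral_measurable[OF h] s] .
  have "Pn n s (\<lambda>y. \<integral>\<^sup>+z. (if s \<le> t then ennreal (exp (- b * s)) * h z else 0) \<partial>q_tilde M q y s)
    = Pn n s (\<lambda>y. (if s \<le> t then ennreal (exp (- b * s)) else 0) * (\<integral>\<^sup>+z. h z \<partial>q_tilde M q y s))"
    using h by (intro Pn_cong) (auto simp: measurable_cong_sets[OF sets_q_tilde refl] nn_integral_cmult)
  also have "\<dots> = indicator {..t} s * (ennreal (exp (- b * s)) * Pn n s (\<lambda>y. \<integral>\<^sup>+z. h z \<partial>q_tilde M q y s))"
    unfolding Pn_cmult[OF m] by (auto split: split_indicator)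
  finally show "Pn n s (\<lambda>y. \<integral>\<^sup>+z. (if s \<le> t then ennreal (exp (- b * s)) * h z else 0) \<partial>q_tilde M q y s)
    = indicator {..t} s * (ennreal (exp (- b * s)) * Pn n s (\<lambda>y. \<integral>\<^sup>+z. h z \<partial>q_tilde M q y s))" .
qed

lemma exp_measurable_time [measurable]: "(\<lambda>s. ennreal (exp (- b * s))) \<in> borel_measurable time_space"
  by (rule measurable_restrict_space1) simp

end

section \<open>The drift function\<close>

lemma ennreal_summand_le:
  fixes a b r :: ennreal
  assumes "a + b = r"
  shows "a \<le> r" "b \<le> r"
  unfolding assms[symmetric] by simp_all

locale drift_process = started_jump_process M q x for M :: "'a measure" and q x +
  fixes c :: real and f :: "'a \<Rightarrow> real"
  assumes c: "0 \<le> c" and drift: "drift_function M q c f"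
begin

abbreviation "qi \<equiv> q_integral M q"
abbreviation "gain g s \<equiv> \<lambda>y. ennreal (qi g s y)"
abbreviation "loss g s \<equiv> \<lambda>y. ennreal (- qi g s y)"
abbreviation "pos g \<equiv> \<lambda>y. ennreal (g y)"
abbreviation "neg g \<equiv> \<lambda>y. ennreal (- g y)"
abbreviation "fe \<equiv> \<lambda>y. ennreal (f y)"

lemma f_measurable [measurable]: "f \<in> borel_measurable M"
  using drift by (simp add: drift_function_def)

lemma fe_measurable: "fe \<in> borel_measurable M"
  by measurable

lemma f_pos: "y \<in> space M \<Longrightarrow> 0 < f y"
  using drift by (simp add: drift_function_def)

lemma nn_integral_f_finite: "y \<in> space M \<Longrightarrow> 0 \<le> s \<Longrightarrow> (\<integral>\<^sup>+z. fe z \<partial>q_tilde M q y s) < top"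
  using drift by (simp add: drift_function_def)

lemma q_integral_f_le: "y \<in> space M \<Longrightarrow> 0 \<le> s \<Longrightarrow> qi f s y \<le> c * f y"
  using drift by (simp add: drift_function_def)

lemma measurable_q_tilde: "h \<in> M \<rightarrow>\<^sub>M N \<Longrightarrow> h \<in> q_tilde M q y s \<rightarrow>\<^sub>M N"
  by (simp add: measurable_cong_sets[OF sets_q_tilde refl])

lemma f_boundedD:
  assumes "f_bounded M f g"
  obtains K where "0 \<le> K" "\<And>y. y \<in> space M \<Longrightarrow> \<bar>g y\<bar> \<le> K * f y"
proof -
  obtain K where K: "\<And>y. y \<in> space M \<Longrightarrow> \<bar>g y\<bar> / f y \<le> K"
    using assms unfolding f_bounded_def bdd_above_def by auto
  show ?thesis
  proof (rule that[of "max 0 K"])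
    fix y assume y: "y \<in> space M"
    have "\<bar>g y\<bar> \<le> K * f y" using K[OF y] f_pos[OF y] by (simp add: divide_le_eq)
    also have "\<dots> \<le> max 0 K * f y" using f_pos[OF y] by (intro mult_right_mono) auto
    finally show "\<bar>g y\<bar> \<le> max 0 K * f y" .
  qed simp
qed

lemma f_bounded_measurable: "f_bounded M f g \<Longrightarrow> g \<in> borel_measurable M"
  by (simp add: f_bounded_def)

lemma f_bounded_self: "f_bounded M f f"
  unfolding f_bounded_def bdd_above_def using f_pos by (auto intro!: exI[of _ 1] simp: less_imp_le)

lemma f_bounded_nn_integral:
  assumes g: "f_bounded M f g" and y: "y \<in> space M" "0 \<le> s"
  shows "(\<integral>\<^sup>+z. ennreal \<bar>g z\<bar> \<partial>q_tilde M q y s) < top"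
proof -
  obtain K where K: "0 \<le> K" "\<And>y. y \<in> space M \<Longrightarrow> \<bar>g y\<bar> \<le> K * f y"
    using f_boundedD[OF g] by blast
  have "(\<integral>\<^sup>+z. ennreal \<bar>g z\<bar> \<partial>q_tilde M q y s) \<le> (\<integral>\<^sup>+z. ennreal K * fe z \<partial>q_tilde M q y s)"
    using K f_pos by (intro nn_integral_mono) (auto simp: ennreal_mult[symmetric] less_imp_le)
  also have "\<dots> = ennreal K * (\<integral>\<^sup>+z. fe z \<partial>q_tilde M q y s)"
    by (rule nn_integral_cmult) (rule measurable_q_tilde[OF fe_measurable])
  also have "\<dots> < top" using nn_integral_f_finite[OF y] by (simp add: ennreal_mult_less_top)
  finally show ?thesis .
qed

lemma f_bounded_integrable:
  assumes g: "f_bounded M f g" and y: "y \<in> space M" "0 \<le> s"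
  shows "integrable (q_tilde M q y s) g"
  using f_bounded_nn_integral[OF assms] measurable_q_tilde[OF f_bounded_measurable[OF g]]
  by (intro integrableI_bounded) auto

lemma f_bounded_parts_finite:
  assumes g: "f_bounded M f g" and y: "y \<in> space M" "0 \<le> s"
  shows "(\<integral>\<^sup>+z. ennreal (g z) \<partial>q_tilde M q y s) < top" "(\<integral>\<^sup>+z. ennreal (- g z) \<partial>q_tilde M q y s) < top"
  by (rule le_less_trans[OF nn_integral_mono f_bounded_nn_integral[OF assms]], simp add: ennreal_leI)+

lemma q_integral_eq:
  assumes g: "f_bounded M f g" and y: "y \<in> space M" "0 \<le> s"
  shows "qi g s y = enn2real (\<integral>\<^sup>+z. ennreal (g z) \<partial>q_tilde M q y s)
     - enn2real (\<integral>\<^sup>+z. ennreal (- g z) \<partial>q_tilde M q y s) - q_rate q y s * g y"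
  unfolding q_integral_def real_lebesgue_integral_def[OF f_bounded_integrable[OF assms]] ..

text \<open>The definition of \<open>q_integral\<close> split into positive and negative parts, each
  subtracted term moved to the other side. In this form it can be integrated further without knowing
  which of the resulting integrals are finite.\<close>

lemma q_integral_parts:
  assumes g: "f_bounded M f g" and y: "y \<in> space M" "0 \<le> s"
  shows "ennreal (qi g s y) + (\<integral>\<^sup>+z. ennreal (- g z) \<partial>q_tilde M q y s) + ennreal (q_rate q y s) * ennreal (g y)
    = ennreal (- qi g s y) + (\<integral>\<^sup>+z. ennreal (g z) \<partial>q_tilde M q y s) + ennreal (q_rate q y s) * ennreal (- g y)"
proof -
  obtain a where a: "0 \<le> a" "(\<integral>\<^sup>+z. ennreal (g z) \<partial>q_tilde M q y s) = ennreal a"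
    using f_bounded_parts_finite(1)[OF assms] by (auto simp: less_top_ennreal)
  obtain b where b: "0 \<le> b" "(\<integral>\<^sup>+z. ennreal (- g z) \<partial>q_tilde M q y s) = ennreal b"
    using f_bounded_parts_finite(2)[OF assms] by (auto simp: less_top_ennreal)
  define r where "r = q_rate q y s"
  have r: "0 \<le> r" using q_rate_nonneg[OF y] by (simp add: r_def)
  define v where "v = qi g s y"
  have v: "v = a - b - r * g y" using q_integral_eq[OF assms] a b by (simp add: v_def r_def)
  \<comment> \<open>\<open>ennreal\<close> sends negative reals to 0, so it computes positive
    parts.\<close>
  have max0: "ennreal z = ennreal (max 0 z)" for z by (simp add: max_def ennreal_neg)
  have "ennreal v + ennreal b + ennreal r * ennreal (g y) = ennreal (max 0 v + b + r * max 0 (g y))"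
    unfolding max0[of v] max0[of "g y"] using b r by (simp add: ennreal_mult)
  also have "max 0 v + b + r * max 0 (g y) = max 0 (- v) + a + r * max 0 (- g y)"
    using r unfolding v by (auto simp: max_def algebra_simps)
  also have "ennreal \<dots> = ennreal (- v) + ennreal a + ennreal r * ennreal (- g y)"
    unfolding max0[of "- v"] max0[of "- g y"] using a r by (simp add: ennreal_mult)
  finally show ?thesis by (simp only: a b v_def r_def)
qed

lemma q_integral_measurable:
  assumes g: "f_bounded M f g"
  shows "(\<lambda>(s, y). qi g s y) \<in> borel_measurable EM"
proof -
  note [measurable] = f_bounded_measurable[OF g]
  have [measurable]: "(\<lambda>p. \<integral>\<^sup>+z. ennreal (g z) \<partial>q_tilde M q (snd p) (fst p)) \<in> borel_measurable EM"
    "(\<lambda>p. \<integral>\<^sup>+z. ennreal (- g z) \<partial>q_tilde M q (snd p) (fst p)) \<in> borel_measurable EM"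
    by (rule nn_integral_q_tilde_measurable; measurable)+
  have [measurable]: "(\<lambda>p. q_rate q (snd p) (fst p)) \<in> borel_measurable EM"
    by (rule q_rate_measurable) measurable
  have "(\<lambda>p. enn2real (\<integral>\<^sup>+z. ennreal (g z) \<partial>q_tilde M q (snd p) (fst p))
     - enn2real (\<integral>\<^sup>+z. ennreal (- g z) \<partial>q_tilde M q (snd p) (fst p)) - q_rate q (snd p) (fst p) * g (snd p)) \<in> borel_measurable EM"
    by measurable
  also have "?this \<longleftrightarrow> ?thesis"
    by (intro measurable_cong) (auto simp: space_pair_measure q_integral_eq[OF g])
  finally show ?thesis .
qed

text \<open>Nonnegative by the drift inequality, so \<open>ennreal\<close> cuts nothing off. It is
  \<open>f y\<close> times the rate at which the transformed process jumps from \<open>y\<close> to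
  its absorbing state.\<close>

definition dr :: "real \<Rightarrow> 'a \<Rightarrow> ennreal" where
  "dr s y = ennreal (c * f y - qi f s y)"

lemma dr_measurable: "case_prod dr \<in> borel_measurable EM"
  using q_integral_measurable[OF f_bounded_self] unfolding dr_def split_beta' by measurable

text \<open>Splits the integrand of \<open>WP_eq\<close> with \<open>b = c\<close> into a surplus
  and the jump gain, the latter being the integrand of \<open>WP_Suc\<close>.\<close>

lemma dr_balance:
  assumes y: "y \<in> space M" "0 \<le> s"
  shows "dr s y + (\<integral>\<^sup>+z. fe z \<partial>q_tilde M q y s) = ennreal (c + q_rate q y s) * fe y"
proof -
  obtain a where a: "0 \<le> a" "(\<integral>\<^sup>+z. fe z \<partial>q_tilde M q y s) = ennreal a"
    using nn_integral_f_finite[OF assms] by (auto simp: less_top_ennreal)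
  have "(\<integral>\<^sup>+z. ennreal (- f z) \<partial>q_tilde M q y s) = (\<integral>\<^sup>+z. 0 \<partial>q_tilde M q y s)"
    using f_pos by (intro nn_integral_cong) (auto intro!: ennreal_neg less_imp_le)
  then have "qi f s y = a - q_rate q y s * f y"
    using q_integral_eq[OF f_bounded_self y] a by simp
  then have d: "dr s y = ennreal ((c + q_rate q y s) * f y - a)" "0 \<le> (c + q_rate q y s) * f y - a"
    using q_integral_f_le[OF y] by (auto simp: dr_def algebra_simps)
  have "dr s y + ennreal a = ennreal ((c + q_rate q y s) * f y)"
    unfolding d(1) using d(2) a(1) by (simp add: ennreal_plus[symmetric] del: ennreal_plus)
  then show ?thesis
    using a q_rate_nonneg[OF y] c f_pos[OF y(1)] by (simp add: ennreal_mult less_imp_le)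
qed

lemma dr_section: "0 \<le> s \<Longrightarrow> dr s \<in> borel_measurable M"
  using measurable_snd_const[OF dr_measurable] .

lemma rate_section:
  assumes "0 \<le> s" shows "(\<lambda>y. q_rate q y s) \<in> borel_measurable M"
  by (rule q_rate_measurable) (use assms in auto)

text \<open>In \<open>WP_eq\<close> with \<open>b = c\<close>, one part of the integrand split by
  \<open>dr_balance\<close> reproduces the next discounted expectation, which makes the identity
  telescope.\<close>

lemma WP_drift_step:
  assumes t: "0 \<le> t"
  shows "ennreal (exp (- c * t)) * Pn n t fe + upto t (\<lambda>s. ennreal (exp (- c * s)) * Pn n s (dr s))
    + WP c (Suc n) t fe = WP c n t fe"
proof -
  note [measurable] = Pn_measurable[OF dr_measurable] Pn_measurable[OF q_tilde_integral_measurable[OF fe_measurable]]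
  have "upto t (\<lambda>s. ennreal (exp (- c * s)) * Pn n s (dr s)) + WP c (Suc n) t fe
    = upto t (\<lambda>s. ennreal (exp (- c * s)) * Pn n s (dr s) + ennreal (exp (- c * s)) * Pn n s (\<lambda>y. \<integral>\<^sup>+z. fe z \<partial>q_tilde M q y s))"
    unfolding WP_Suc[OF fe_measurable]
    by (rule upto_add[symmetric]; measurable)
  also have "\<dots> = upto t (\<lambda>s. ennreal (exp (- c * s)) * Pn n s (\<lambda>y. ennreal (c + q_rate q y s) * fe y))"
  proof (rule upto_cong)
    fix s :: real assume s: "0 \<le> s"
    have "Pn n s (\<lambda>y. ennreal (c + q_rate q y s) * fe y) = Pn n s (\<lambda>y. dr s y + (\<integral>\<^sup>+z. fe z \<partial>q_tilde M q y s))"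
      using s by (intro Pn_cong dr_balance[symmetric])
    also have "\<dots> = Pn n s (dr s) + Pn n s (\<lambda>y. \<integral>\<^sup>+z. fe z \<partial>q_tilde M q y s)"
      by (intro Pn_add dr_section s measurable_snd_const[OF q_tilde_integral_measurable[OF fe_measurable]])
    finally show "ennreal (exp (- c * s)) * Pn n s (dr s) + ennreal (exp (- c * s)) * Pn n s (\<lambda>y. \<integral>\<^sup>+z. fe z \<partial>q_tilde M q y s)
      = ennreal (exp (- c * s)) * Pn n s (\<lambda>y. ennreal (c + q_rate q y s) * fe y)"
      by (simp add: distrib_left)
  qed
  finally show ?thesis using WP_eq[OF fe_measurable t c, of n] by (simp add: add.assoc)
qed

text \<open>All terms are nonnegative, so each is at most \<open>f x\<close>, the value of
  \<open>WP c 0 t fe\<close>. The a priori bounds below start from here.\<close>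

lemma WP_drift_sum:
  assumes t: "0 \<le> t"
  shows "(\<Sum>n<N. ennreal (exp (- c * t)) * Pn n t fe + upto t (\<lambda>s. ennreal (exp (- c * s)) * Pn n s (dr s)))
    + WP c N t fe = fe x"
proof (induction N)
  case 0
  show ?case using WP_0[OF fe_measurable t] by simp
next
  case (Suc N)
  then show ?case using WP_drift_step[OF t, of N] by (simp add: add.assoc)
qed

lemma WP_le: "0 \<le> t \<Longrightarrow> WP c N t fe \<le> fe x"
  by (rule ennreal_summand_le(2)[OF WP_drift_sum])

text \<open>For jump times up to \<open>t\<close> the discount factor is at least
  \<open>exp (- c * t)\<close>. Together with \<open>WP_c_le\<close> this makes the discounted and
  the undiscounted limit vanish simultaneously.\<close>

lemma WP_bound:
  assumes t: "0 \<le> t"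
  shows "WP 0 N t fe \<le> ennreal (exp (c * t)) * WP c N t fe"
proof -
  have "WP 0 N t fe \<le> Psi N (\<lambda>u y. ennreal (exp (c * t)) * (if u \<le> t then ennreal (exp (- c * u)) * fe y else 0))"
    unfolding WP_def
  proof (rule Psi_mono)
    fix u :: real and y assume u: "0 \<le> u" and y: "y \<in> space M"
    have "fe y \<le> ennreal (exp (c * t)) * (ennreal (exp (- c * u)) * fe y)" if "u \<le> t"
    proof -
      have "1 * f y \<le> exp (c * (t - u)) * f y"
        using f_pos[OF y] c that by (intro mult_right_mono) auto
      then show ?thesis
        using f_pos[OF y] by (simp add: ennreal_mult[symmetric] exp_add[symmetric] algebra_simps mult.assoc[symmetric])
    qed
    then show "(if u \<le> t then ennreal (exp (- 0 * u)) * fe y else 0)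
      \<le> ennreal (exp (c * t)) * (if u \<le> t then ennreal (exp (- c * u)) * fe y else 0)" by simp
  qed
  also have "\<dots> = ennreal (exp (c * t)) * WP c N t fe"
    unfolding WP_def using WP_integrand_measurable[OF fe_measurable, of t c] by (rule Psi_cmult)
  finally show ?thesis .
qed

lemma WP_0_finite: "0 \<le> t \<Longrightarrow> WP 0 N t fe < top"
proof -
  assume t: "0 \<le> t"
  have "WP 0 N t fe \<le> ennreal (exp (c * t)) * fe x"
    by (rule order_trans[OF WP_bound[OF t] mult_left_mono[OF WP_le[OF t]]]) simp
  also have "\<dots> < top" by (simp add: ennreal_mult_less_top)
  finally show ?thesis .
qed

text \<open>The first terms in the partial sums of \<open>WP_drift_sum\<close> are bounded by
  \<open>f x\<close> and sum up to the discounted expectation.\<close>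

lemma mean_f_le:
  assumes t: "0 \<le> t" shows "mean t fe \<le> ennreal (exp (c * t) * f x)"
proof -
  have "ennreal (exp (- c * t)) * mean t fe = (\<Sum>n. ennreal (exp (- c * t)) * Pn n t fe)"
    unfolding mean_eq_suminf[OF fe_measurable] by (rule ennreal_suminf_cmult[symmetric])
  also have "\<dots> \<le> fe x"
  proof (rule suminf_le_const[OF summableI])
    fix N
    have "(\<Sum>n<N. ennreal (exp (- c * t)) * Pn n t fe)
      \<le> (\<Sum>n<N. ennreal (exp (- c * t)) * Pn n t fe + upto t (\<lambda>s. ennreal (exp (- c * s)) * Pn n s (dr s)))"
      by (intro sum_mono) simp
    also have "\<dots> \<le> fe x" by (rule ennreal_summand_le(1)[OF WP_drift_sum[OF t]])
    finally show "(\<Sum>n<N. ennreal (exp (- c * t)) * Pn n t fe) \<le> fe x" .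
  qed
  finally have "ennreal (exp (c * t)) * (ennreal (exp (- c * t)) * mean t fe) \<le> ennreal (exp (c * t)) * fe x"
    by (rule mult_left_mono) simp
  then show ?thesis
    using f_pos[OF x] by (simp add: ennreal_mult[symmetric] mult.assoc[symmetric] exp_add[symmetric])
qed

lemma fe_time_measurable: "case_prod (\<lambda>s::real. fe) \<in> borel_measurable EM"
  unfolding split_beta' by measurable

lemma upto_mean_f_finite:
  assumes t: "0 \<le> t" shows "upto t (\<lambda>s. mean s fe) < top"
proof -
  have "upto t (\<lambda>s. mean s fe) \<le> upto t (\<lambda>_. ennreal (exp (c * t) * f x))"
  proof (rule upto_mono)
    fix s assume s: "0 \<le> s" "s \<le> t"
    have "mean s fe \<le> ennreal (exp (c * s) * f x)" by (rule mean_f_le[OF s(1)])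
    also have "\<dots> \<le> ennreal (exp (c * t) * f x)"
      using s c f_pos[OF x] by (intro ennreal_leI mult_right_mono) (auto intro: mult_left_mono)
    finally show "mean s fe \<le> ennreal (exp (c * t) * f x)" .
  qed
  also have "\<dots> < top" by (simp add: upto_const[OF t] ennreal_mult_less_top)
  finally show ?thesis .
qed

text \<open>For \<open>b = 0\<close> only the exit rate appears in \<open>WP_eq\<close>, so the term
  \<open>c f\<close> of \<open>dr_balance\<close> is left over as a source on the right.\<close>

lemma WP_0_step:
  assumes t: "0 \<le> t"
  shows "Pn n t fe + upto t (\<lambda>s. Pn n s (dr s)) + WP 0 (Suc n) t fe
    = WP 0 n t fe + ennreal c * upto t (\<lambda>s. Pn n s fe)"
proof -
  have rate_m: "case_prod (\<lambda>s y. ennreal (q_rate q y s) * fe y) \<in> borel_measurable EM"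
  proof -
    have [measurable]: "(\<lambda>p. q_rate q (snd p) (fst p)) \<in> borel_measurable EM"
      by (rule q_rate_measurable) measurable
    show ?thesis unfolding split_beta' by measurable
  qed
  note [measurable] = Pn_measurable[OF dr_measurable] Pn_measurable[OF q_tilde_integral_measurable[OF fe_measurable]]
    Pn_measurable[OF rate_m] Pn_measurable[OF fe_time_measurable]
  have "upto t (\<lambda>s. Pn n s (dr s)) + WP 0 (Suc n) t fe
    = upto t (\<lambda>s. Pn n s (dr s) + Pn n s (\<lambda>y. \<integral>\<^sup>+z. fe z \<partial>q_tilde M q y s))"
    unfolding WP_Suc[OF fe_measurable] by (simp add: upto_add)
  also have "\<dots> = upto t (\<lambda>s. ennreal c * Pn n s fe + Pn n s (\<lambda>y. ennreal (q_rate q y s) * fe y))"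
  proof (rule upto_cong)
    fix s :: real assume s: "0 \<le> s"
    note [measurable] = rate_section[OF s]
    have "Pn n s (dr s) + Pn n s (\<lambda>y. \<integral>\<^sup>+z. fe z \<partial>q_tilde M q y s) = Pn n s (\<lambda>y. dr s y + (\<integral>\<^sup>+z. fe z \<partial>q_tilde M q y s))"
      by (intro Pn_add[symmetric] dr_section s measurable_snd_const[OF q_tilde_integral_measurable[OF fe_measurable]])
    also have "\<dots> = Pn n s (\<lambda>y. ennreal c * fe y + ennreal (q_rate q y s) * fe y)"
      using s c q_rate_nonneg by (intro Pn_cong) (simp add: dr_balance distrib_right)
    also have "\<dots> = Pn n s (\<lambda>y. ennreal c * fe y) + Pn n s (\<lambda>y. ennreal (q_rate q y s) * fe y)"
      by (rule Pn_add) measurable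
    also have "Pn n s (\<lambda>y. ennreal c * fe y) = ennreal c * Pn n s fe" by (rule Pn_cmult[OF fe_measurable])
    finally show "Pn n s (dr s) + Pn n s (\<lambda>y. \<integral>\<^sup>+z. fe z \<partial>q_tilde M q y s)
      = ennreal c * Pn n s fe + Pn n s (\<lambda>y. ennreal (q_rate q y s) * fe y)" .
  qed
  also have "\<dots> = ennreal c * upto t (\<lambda>s. Pn n s fe) + upto t (\<lambda>s. Pn n s (\<lambda>y. ennreal (q_rate q y s) * fe y))"
    by (subst upto_add) (simp_all add: upto_cmult)
  finally show ?thesis using WP_eq[OF fe_measurable t, of 0 n] by (simp add: ac_simps)
qed

lemma WP_0_sum:
  assumes t: "0 \<le> t"
  shows "(\<Sum>n<N. Pn n t fe) + (\<Sum>n<N. upto t (\<lambda>s. Pn n s (dr s))) + WP 0 N t fe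
    = fe x + ennreal c * (\<Sum>n<N. upto t (\<lambda>s. Pn n s fe))"
proof (induction N)
  case 0
  show ?case using WP_0[OF fe_measurable t] by simp
next
  case (Suc N)
  have "(\<Sum>n<Suc N. Pn n t fe) + (\<Sum>n<Suc N. upto t (\<lambda>s. Pn n s (dr s))) + WP 0 (Suc N) t fe
    = (\<Sum>n<N. Pn n t fe) + (\<Sum>n<N. upto t (\<lambda>s. Pn n s (dr s))) +
      (Pn N t fe + upto t (\<lambda>s. Pn N s (dr s)) + WP 0 (Suc N) t fe)"
    by (simp add: ac_simps)
  also have "\<dots> = ((\<Sum>n<N. Pn n t fe) + (\<Sum>n<N. upto t (\<lambda>s. Pn n s (dr s))) + WP 0 N t fe)
      + ennreal c * upto t (\<lambda>s. Pn N s fe)"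
    unfolding WP_0_step[OF t] by (simp add: ac_simps)
  also have "\<dots> = fe x + ennreal c * (\<Sum>n<Suc N. upto t (\<lambda>s. Pn n s fe))"
    unfolding Suc by (simp add: distrib_left ac_simps)
  finally show ?case .
qed

text \<open>In \<open>WP_0_sum\<close> the surplus is bounded by the initial value and the source
  term, which are finite whether or not the defect \<open>WP 0 N t fe\<close> vanishes in the
  limit.\<close>

lemma upto_mean_dr_finite:
  assumes t: "0 \<le> t" shows "upto t (\<lambda>s. mean s (dr s)) < top"
proof -
  have "upto t (\<lambda>s. mean s (dr s)) = (\<Sum>n. upto t (\<lambda>s. Pn n s (dr s)))"
    by (rule upto_mean[OF dr_measurable])
  also have "\<dots> \<le> fe x + ennreal c * upto t (\<lambda>s. mean s fe)"
  proof (rule suminf_le_const[OF summableI])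
    fix N
    have "(\<Sum>n<N. upto t (\<lambda>s. Pn n s (dr s))) \<le> fe x + ennreal c * (\<Sum>n<N. upto t (\<lambda>s. Pn n s fe))"
      unfolding WP_0_sum[OF t, symmetric] by (rule add_increasing2[OF zero_le add_increasing[OF zero_le order_refl]])
    also have "\<dots> \<le> fe x + ennreal c * upto t (\<lambda>s. mean s fe)"
      unfolding upto_mean[OF fe_time_measurable]
      by (intro add_left_mono mult_left_mono sum_le_suminf summableI) auto
    finally show "(\<Sum>n<N. upto t (\<lambda>s. Pn n s (dr s))) \<le> fe x + ennreal c * upto t (\<lambda>s. mean s fe)" .
  qed
  also have "\<dots> < top" using upto_mean_f_finite[OF t] by (simp add: ennreal_mult_less_top)
  finally show ?thesis .
qed

text \<open>Dynkin's formula for \<open>f\<close> with its defect \<open>L\<close>. The limit exists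
  because the defect is the difference of two sequences of partial sums that converge to finite
  values.\<close>

lemma WP_0_limit:
  assumes t: "0 \<le> t"
  obtains L where "(\<lambda>N. WP 0 N t fe) \<longlonglongrightarrow> L"
    and "mean t fe + upto t (\<lambda>s. mean s (dr s)) + L = fe x + ennreal c * upto t (\<lambda>s. mean s fe)"
proof -
  define a where "a N = (\<Sum>n<N. Pn n t fe) + (\<Sum>n<N. upto t (\<lambda>s. Pn n s (dr s)))" for N
  define r where "r N = fe x + ennreal c * (\<Sum>n<N. upto t (\<lambda>s. Pn n s fe))" for N
  define A where "A = mean t fe + upto t (\<lambda>s. mean s (dr s))"
  define R where "R = fe x + ennreal c * upto t (\<lambda>s. mean s fe)"
  have a: "a \<longlonglongrightarrow> A"
    unfolding a_def[abs_def] A_def mean_eq_suminf[OF fe_measurable] upto_mean[OF dr_measurable]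
    by (intro tendsto_add summable_LIMSEQ summableI)
  have r: "r \<longlonglongrightarrow> R"
    unfolding r_def[abs_def] R_def upto_mean[OF fe_time_measurable]
    by (intro tendsto_add tendsto_const ennreal_tendsto_cmult summable_LIMSEQ summableI) auto
  have sum: "a N + WP 0 N t fe = r N" for N
    using WP_0_sum[OF t, of N] by (simp add: a_def r_def)
  have Rfin: "R < top"
    using upto_mean_f_finite[OF t] by (simp add: R_def ennreal_mult_less_top)
  have Afin: "A < top"
    using mean_f_le[OF t] upto_mean_dr_finite[OF t] by (auto simp: A_def intro: le_less_trans)
  have le: "a N \<le> r N" for N by (rule ennreal_summand_le(1)[OF sum])
  have AR: "A \<le> R" by (rule LIMSEQ_le[OF a r]) (use le in auto)
  \<comment> \<open>Only a finite summand can be cancelled in \<open>ennreal\<close>.\<close>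
  have afin: "a N \<noteq> top" for N
  proof -
    have "a N \<le> A"
      unfolding a_def A_def mean_eq_suminf[OF fe_measurable] upto_mean[OF dr_measurable]
      by (intro add_mono sum_le_suminf summableI) auto
    then show ?thesis using Afin by auto
  qed
  have "WP 0 N t fe = r N - a N" for N
    unfolding sum[of N, symmetric] using afin[of N] by (simp add: ennreal_add_diff_cancel_left)
  then have "(\<lambda>N. WP 0 N t fe) \<longlonglongrightarrow> R - A"
    using tendsto_diff_ennreal[OF r a] Rfin Afin by simp
  moreover have "A + (R - A) = R" using AR by (rule add_diff_inverse_ennreal)
  ultimately show ?thesis using that unfolding A_def R_def by blast
qed

end

section \<open>Expectations of functions extended by 0 at the cemetery\<close>

context started_jump_process
begin

lemma ext0_measurable:
  assumes "h \<in> borel_measurable M" "0 \<le> s"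
  shows "(\<lambda>\<omega>. ext0 h (jump_state \<omega> s)) \<in> borel_measurable P"
  unfolding ext0_def by (rule jump_state_fixed_time[OF assms]) simp

lemma nn_integral_ext0: "(\<integral>\<^sup>+\<omega>. ennreal (ext0 h (jump_state \<omega> s)) \<partial>P) = mean s (\<lambda>y. ennreal (h y))"
  unfolding mean_def by (intro nn_integral_cong) (auto simp: ext0_def split: option.split)

lemma nn_integral_ext0_uminus: "(\<integral>\<^sup>+\<omega>. ennreal (- ext0 h (jump_state \<omega> s)) \<partial>P) = mean s (\<lambda>y. ennreal (- h y))"
  unfolding mean_def by (intro nn_integral_cong) (auto simp: ext0_def split: option.split)

lemma nn_integral_ext0_abs: "(\<integral>\<^sup>+\<omega>. ennreal \<bar>ext0 h (jump_state \<omega> s)\<bar> \<partial>P) = mean s (\<lambda>y. ennreal \<bar>h y\<bar>)"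
  unfolding mean_def by (intro nn_integral_cong) (auto simp: ext0_def split: option.split)

lemma extended_integral_ext0:
  "extended_integral P (\<lambda>\<omega>. ereal (ext0 h (jump_state \<omega> s)))
    = enn2ereal (mean s (\<lambda>y. ennreal (h y))) - enn2ereal (mean s (\<lambda>y. ennreal (- h y)))"
  unfolding extended_integral_def uminus_ereal.simps ennreal.abs_eq[symmetric] e2ennreal_ereal nn_integral_ext0 nn_integral_ext0_uminus ..

lemma set_lebesgue_integral_halfline:
  fixes \<phi> :: "real \<Rightarrow> real"
  shows "(LBINT s:{0..t}. \<phi> s) = (\<integral>s. indicator {..t} s *\<^sub>R \<phi> s \<partial>halfline)"
  unfolding set_lebesgue_integral_def
  by (subst integral_restrict_space) (auto intro!: Bochner_Integration.integral_cong split: split_indicator)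

end

section \<open>Dynkin's formula for f-bounded functions\<close>

context drift_process
begin

lemma WP_0_f_bounded:
  assumes g: "f_bounded M f g" and t: "0 \<le> t"
  obtains K where "0 \<le> K" "\<And>N. WP 0 N t (pos g) \<le> ennreal K * WP 0 N t fe"
    "\<And>N. WP 0 N t (neg g) \<le> ennreal K * WP 0 N t fe"
    "mean t (pos g) \<le> ennreal K * mean t fe" "mean t (neg g) \<le> ennreal K * mean t fe"
proof -
  obtain K where K: "0 \<le> K" "\<And>y. y \<in> space M \<Longrightarrow> \<bar>g y\<bar> \<le> K * f y"
    by (rule f_boundedD[OF g]) (rule that)
  have pt: "ennreal (g y) \<le> ennreal K * fe y" "ennreal (- g y) \<le> ennreal K * fe y" if "y \<in> space M" for y
    using K(2)[OF that] K(1) f_pos[OF that] by (auto simp: ennreal_mult[symmetric] less_imp_le intro!: ennreal_leI)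
  have W: "WP 0 N t h \<le> ennreal K * WP 0 N t fe" if h: "\<And>y. y \<in> space M \<Longrightarrow> h y \<le> ennreal K * fe y" for N h
  proof -
    have "WP 0 N t h \<le> Psi N (\<lambda>u y. ennreal K * (if u \<le> t then ennreal (exp (- 0 * u)) * fe y else 0))"
      unfolding WP_def using h by (intro Psi_mono) auto
    also have "\<dots> = ennreal K * WP 0 N t fe"
      unfolding WP_def using WP_integrand_measurable[OF fe_measurable, of t 0] by (rule Psi_cmult)
    finally show ?thesis .
  qed
  have E: "mean t h \<le> ennreal K * mean t fe" if h: "\<And>y. y \<in> space M \<Longrightarrow> h y \<le> ennreal K * fe y" for h
    using mean_mono[of h "\<lambda>y. ennreal K * fe y" t] h mean_cmult[OF fe_measurable t] by simp
  show ?thesis by (rule that[OF K(1)]) (auto intro!: W E pt)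
qed

text \<open>The signed analogue of \<open>WP_0_step\<close>: \<open>q_integral_parts\<close> is
  integrated over time, and \<open>WP_eq\<close> and \<open>WP_Suc\<close> for the two parts of
  \<open>g\<close> replace the rate and jump terms. In the process
  \<open>Pn n t (pos g) + Pn n t (neg g)\<close> is added to both sides.\<close>

lemma forward_step:
  assumes g: "f_bounded M f g" and t: "0 \<le> t"
  shows "upto t (\<lambda>s. Pn n s (gain g s)) + WP 0 (Suc n) t (neg g)
      + WP 0 n t (pos g) + Pn n t (neg g)
    = upto t (\<lambda>s. Pn n s (loss g s)) + WP 0 (Suc n) t (pos g)
      + WP 0 n t (neg g) + Pn n t (pos g)"
proof -
  note gm[measurable] = f_bounded_measurable[OF g]
  have g1: "(pos g) \<in> borel_measurable M" and g2: "(neg g) \<in> borel_measurable M"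
    by measurable
  define A where "A s y = ennreal (qi g s y)" for s y
  define B where "B s y = ennreal (- qi g s y)" for s y
  define T1 where "T1 s y = (\<integral>\<^sup>+z. ennreal (g z) \<partial>q_tilde M q y s)" for s y
  define T2 where "T2 s y = (\<integral>\<^sup>+z. ennreal (- g z) \<partial>q_tilde M q y s)" for s y
  define R1 where "R1 s y = ennreal (q_rate q y s) * ennreal (g y)" for s y
  define R2 where "R2 s y = ennreal (q_rate q y s) * ennreal (- g y)" for s y
  have A: "case_prod A \<in> borel_measurable EM" and B: "case_prod B \<in> borel_measurable EM"
    using q_integral_measurable[OF g] unfolding A_def[abs_def] B_def[abs_def] split_beta' by measurable
  have T: "case_prod T1 \<in> borel_measurable EM" "case_prod T2 \<in> borel_measurable EM"
    unfolding T1_def[abs_def] T2_def[abs_def]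
    by (rule q_tilde_integral_measurable[OF g1], rule q_tilde_integral_measurable[OF g2])
  have [measurable]: "(\<lambda>p. q_rate q (snd p) (fst p)) \<in> borel_measurable EM"
    by (rule q_rate_measurable) measurable
  have R: "case_prod R1 \<in> borel_measurable EM" "case_prod R2 \<in> borel_measurable EM"
    unfolding R1_def[abs_def] R2_def[abs_def] split_beta' by measurable
  have expand: "upto t (\<lambda>s. Pn n s (\<lambda>y. a s y + b s y + d s y))
    = upto t (\<lambda>s. Pn n s (a s)) + upto t (\<lambda>s. Pn n s (b s)) + upto t (\<lambda>s. Pn n s (d s))"
    if a: "case_prod a \<in> borel_measurable EM" and b: "case_prod b \<in> borel_measurable EM"
      and d: "case_prod d \<in> borel_measurable EM" for a b d
  proof -
    have "upto t (\<lambda>s. Pn n s (\<lambda>y. a s y + b s y + d s y))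
      = upto t (\<lambda>s. Pn n s (a s) + Pn n s (b s) + Pn n s (d s))"
    proof (rule upto_cong)
      fix s :: real assume s: "0 \<le> s"
      note m = measurable_snd_const[OF a s] measurable_snd_const[OF b s] measurable_snd_const[OF d s]
      show "Pn n s (\<lambda>y. a s y + b s y + d s y) = Pn n s (a s) + Pn n s (b s) + Pn n s (d s)"
        using Pn_add[OF borel_measurable_add[OF m(1,2)] m(3)] Pn_add[OF m(1,2)] by simp
    qed
    also have "\<dots> = upto t (\<lambda>s. Pn n s (a s)) + upto t (\<lambda>s. Pn n s (b s)) + upto t (\<lambda>s. Pn n s (d s))"
      using Pn_measurable[OF a, of n] Pn_measurable[OF b, of n] Pn_measurable[OF d, of n]
      by (simp add: upto_add)
    finally show ?thesis .
  qed
  have main: "upto t (\<lambda>s. Pn n s (A s)) + upto t (\<lambda>s. Pn n s (T2 s)) + upto t (\<lambda>s. Pn n s (R1 s))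
    = upto t (\<lambda>s. Pn n s (B s)) + upto t (\<lambda>s. Pn n s (T1 s)) + upto t (\<lambda>s. Pn n s (R2 s))"
    unfolding expand[OF A T(2) R(1), symmetric] expand[OF B T(1) R(2), symmetric]
    by (intro upto_cong Pn_cong) (simp add: A_def B_def T1_def T2_def R1_def R2_def q_integral_parts[OF g])
  have W1: "WP 0 n t (pos g) = Pn n t (pos g) + upto t (\<lambda>s. Pn n s (R1 s))"
    using WP_eq[OF g1 t, of 0 n] by (simp add: R1_def[abs_def])
  have W2: "WP 0 n t (neg g) = Pn n t (neg g) + upto t (\<lambda>s. Pn n s (R2 s))"
    using WP_eq[OF g2 t, of 0 n] by (simp add: R2_def[abs_def])
  have S1: "WP 0 (Suc n) t (pos g) = upto t (\<lambda>s. Pn n s (T1 s))"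
    using WP_Suc[OF g1, of 0 n t] by (simp add: T1_def[abs_def])
  have S2: "WP 0 (Suc n) t (neg g) = upto t (\<lambda>s. Pn n s (T2 s))"
    using WP_Suc[OF g2, of 0 n t] by (simp add: T2_def[abs_def])
  have "upto t (\<lambda>s. Pn n s (A s)) + WP 0 (Suc n) t (neg g)
      + WP 0 n t (pos g) + Pn n t (neg g)
    = (upto t (\<lambda>s. Pn n s (A s)) + upto t (\<lambda>s. Pn n s (T2 s)) + upto t (\<lambda>s. Pn n s (R1 s)))
      + (Pn n t (pos g) + Pn n t (neg g))"
    unfolding W1 S2 by (simp only: ac_simps)
  also have "\<dots> = upto t (\<lambda>s. Pn n s (B s)) + WP 0 (Suc n) t (pos g)
      + WP 0 n t (neg g) + Pn n t (pos g)"
    unfolding W2 S1 main by (simp only: ac_simps)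
  finally show ?thesis by (simp only: A_def[abs_def] B_def[abs_def])
qed

text \<open>Domination by a multiple of \<open>WP 0 N t fe\<close> makes the boundary terms of both
  parts of \<open>g\<close> vanish in the limit. The balance is one in \<open>ennreal\<close> and
  does not presuppose that the drift terms of \<open>g\<close> are finite.\<close>

lemma forward_balance:
  assumes g: "f_bounded M f g" and t: "0 \<le> t" and lim: "(\<lambda>N. WP 0 N t fe) \<longlonglongrightarrow> 0"
  shows "mean t (neg g) + upto t (\<lambda>s. mean s (gain g s)) + ennreal (g x)
    = mean t (pos g) + upto t (\<lambda>s. mean s (loss g s)) + ennreal (- g x)"
proof -
  note gm[measurable] = f_bounded_measurable[OF g]
  let ?g1 = "\<lambda>y. ennreal (g y)" and ?g2 = "\<lambda>y. ennreal (- g y)"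
  have g1: "?g1 \<in> borel_measurable M" and g2: "?g2 \<in> borel_measurable M" by measurable
  let ?A = "\<lambda>s y. ennreal (qi g s y)" and ?B = "\<lambda>s y. ennreal (- qi g s y)"
  have A: "case_prod ?A \<in> borel_measurable EM" and B: "case_prod ?B \<in> borel_measurable EM"
    using q_integral_measurable[OF g] unfolding split_beta' by measurable
  obtain K where K: "0 \<le> K" "\<And>N. WP 0 N t ?g1 \<le> ennreal K * WP 0 N t fe" "\<And>N. WP 0 N t ?g2 \<le> ennreal K * WP 0 N t fe"
    by (rule WP_0_f_bounded[OF g t]) (rule that)
  \<comment> \<open>The induction below adds the \<open>N\<close>-th boundary terms to both sides
    and cancels them afterwards, which needs their finiteness.\<close>
  have fin: "WP 0 N t ?g1 + WP 0 N t ?g2 \<noteq> top" for N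
  proof -
    have "ennreal K * WP 0 N t fe < top" using WP_0_finite[OF t, of N] by (simp add: ennreal_mult_less_top)
    from le_less_trans[OF K(2) this] le_less_trans[OF K(3) this] show ?thesis by (simp add: less_top)
  qed
  have sum: "(\<Sum>n<N. Pn n t ?g2) + (\<Sum>n<N. upto t (\<lambda>s. Pn n s (?A s))) + ?g1 x + WP 0 N t ?g2
    = (\<Sum>n<N. Pn n t ?g1) + (\<Sum>n<N. upto t (\<lambda>s. Pn n s (?B s))) + ?g2 x + WP 0 N t ?g1" for N
  proof (induction N)
    case 0
    show ?case using WP_0[OF g1 t] WP_0[OF g2 t] by (simp add: add.commute)
  next
    case (Suc N)
    let ?a = "\<Sum>n<N. Pn n t ?g2" and ?b = "\<Sum>n<N. upto t (\<lambda>s. Pn n s (?A s))"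
      and ?c = "\<Sum>n<N. Pn n t ?g1" and ?d = "\<Sum>n<N. upto t (\<lambda>s. Pn n s (?B s))"
      and ?w1 = "WP 0 N t ?g1" and ?w2 = "WP 0 N t ?g2" and ?v1 = "WP 0 (Suc N) t ?g1" and ?v2 = "WP 0 (Suc N) t ?g2"
      and ?p1 = "Pn N t ?g1" and ?p2 = "Pn N t ?g2" and ?uA = "upto t (\<lambda>s. Pn N s (?A s))"
      and ?uB = "upto t (\<lambda>s. Pn N s (?B s))"
    have "(?w1 + ?w2) + ((?a + ?p2) + (?b + ?uA) + ?g1 x + ?v2) = (?a + ?b + ?g1 x + ?w2) + (?uA + ?v2 + ?w1 + ?p2)"
      by (simp only: ac_simps)
    also have "\<dots> = (?c + ?d + ?g2 x + ?w1) + (?uB + ?v1 + ?w2 + ?p1)"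
      by (simp only: Suc forward_step[OF g t, of N])
    also have "\<dots> = (?w1 + ?w2) + ((?c + ?p1) + (?d + ?uB) + ?g2 x + ?v1)"
      by (simp only: ac_simps)
    finally have "(?a + ?p2) + (?b + ?uA) + ?g1 x + ?v2 = (?c + ?p1) + (?d + ?uB) + ?g2 x + ?v1"
      using fin[of N] by (simp only: ennreal_add_left_cancel infinity_ennreal_def simp_thms)
    then show ?case by (simp only: sum.lessThan_Suc)
  qed
  have "(\<lambda>N. ennreal K * WP 0 N t fe) \<longlonglongrightarrow> ennreal K * 0"
    by (rule ennreal_tendsto_cmult[OF _ lim]) simp
  then have KW: "(\<lambda>N. ennreal K * WP 0 N t fe) \<longlonglongrightarrow> 0" by simp
  have w: "(\<lambda>N. WP 0 N t ?g1) \<longlonglongrightarrow> 0" "(\<lambda>N. WP 0 N t ?g2) \<longlonglongrightarrow> 0"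
    by (rule tendsto_sandwich[OF _ _ tendsto_const KW]; use K in simp)+
  have l1: "(\<lambda>N. (\<Sum>n<N. Pn n t ?g2) + (\<Sum>n<N. upto t (\<lambda>s. Pn n s (?A s))) + ?g1 x + WP 0 N t ?g2)
    \<longlonglongrightarrow> mean t ?g2 + upto t (\<lambda>s. mean s (?A s)) + ?g1 x + 0"
    unfolding mean_eq_suminf[OF g2] upto_mean[OF A]
    by (intro tendsto_add tendsto_const w summable_LIMSEQ summableI)
  have l2: "(\<lambda>N. (\<Sum>n<N. Pn n t ?g1) + (\<Sum>n<N. upto t (\<lambda>s. Pn n s (?B s))) + ?g2 x + WP 0 N t ?g1)
    \<longlonglongrightarrow> mean t ?g1 + upto t (\<lambda>s. mean s (?B s)) + ?g2 x + 0"
    unfolding mean_eq_suminf[OF g1] upto_mean[OF B]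
    by (intro tendsto_add tendsto_const w summable_LIMSEQ summableI)
  show ?thesis using LIMSEQ_unique[OF l1[unfolded sum] l2] by simp
qed

lemma mean_f_bounded_finite:
  assumes g: "f_bounded M f g" and t: "0 \<le> t"
  shows "mean t (pos g) < top" "mean t (neg g) < top"
proof -
  obtain K where K: "0 \<le> K"
    "mean t (pos g) \<le> ennreal K * mean t fe" "mean t (neg g) \<le> ennreal K * mean t fe"
    by (rule WP_0_f_bounded[OF g t]) (rule that)
  have "mean t fe < top" by (rule le_less_trans[OF mean_f_le[OF t]]) simp
  then have "ennreal K * mean t fe < top" by (simp add: ennreal_mult_less_top)
  from le_less_trans[OF K(2) this] le_less_trans[OF K(3) this]
  show "mean t (pos g) < top" "mean t (neg g) < top" .
qed

lemma integral_ext0: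
  assumes g: "f_bounded M f g" and t: "0 \<le> t"
  shows "(LINT \<omega>|P. ext0 g (jump_state \<omega> t)) = enn2real (mean t (pos g)) - enn2real (mean t (neg g))"
proof -
  have "integrable P (\<lambda>\<omega>. ext0 g (jump_state \<omega> t))"
    using mean_f_bounded_finite[OF g t] nn_integral_ext0[of g t] nn_integral_ext0_uminus[of g t]
    unfolding real_integrable_def
    by (auto intro: ext0_measurable f_bounded_measurable[OF g] t)
  from real_lebesgue_integral_def[OF this] show ?thesis
    by (simp only: nn_integral_ext0 nn_integral_ext0_uminus)
qed

text \<open>Absolute integrability on the product of half-line and path space gives both formulas by
  Fubini: one evaluates the iterated integral through positive and negative parts, the other
  interchanges the order.\<close>

lemma forward_integrals:
  assumes g: "f_bounded M f g"
    and fin: "upto t (\<lambda>s. mean s (\<lambda>y. ennreal \<bar>qi g s y\<bar>)) < top"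
  shows "(LBINT s:{0..t}. (LINT \<omega>|P. ext0 (qi g s) (jump_state \<omega> s)))
      = enn2real (upto t (\<lambda>s. mean s (gain g s)))
        - enn2real (upto t (\<lambda>s. mean s (loss g s)))"
    and "(LINT \<omega>|P. (LBINT s:{0..t}. ext0 (qi g s) (jump_state \<omega> s)))
      = (LBINT s:{0..t}. (LINT \<omega>|P. ext0 (qi g s) (jump_state \<omega> s)))"
proof -
  interpret PP: pair_sigma_finite halfline P ..
  define \<phi> where "\<phi> s \<omega> = indicator {..t} s *\<^sub>R ext0 (qi g s) (jump_state \<omega> s)" for s \<omega>
  have m: "(\<lambda>(s, \<omega>). \<phi> s \<omega>) \<in> borel_measurable (halfline \<Otimes>\<^sub>M P)"
  proof -
    have "(\<lambda>p. ext0 (qi g (snd p)) (jump_state (fst p) (snd p))) \<in> borel_measurable (P \<Otimes>\<^sub>M time_space)"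
      unfolding ext0_def by (rule jump_state_integrand_measurable[OF q_integral_measurable[OF g]]) simp
    from measurable_compose[OF measurable_pair_swap' this]
    have [measurable]: "(\<lambda>p. ext0 (qi g (fst p)) (jump_state (snd p) (fst p))) \<in> borel_measurable (time_space \<Otimes>\<^sub>M P)"
      by (simp add: split_beta')
    have [measurable]: "(indicator {..t} :: real \<Rightarrow> real) \<in> borel_measurable time_space"
      by (rule measurable_restrict_space1) simp
    have "(\<lambda>(s, \<omega>). \<phi> s \<omega>) \<in> borel_measurable (time_space \<Otimes>\<^sub>M P)"
      unfolding \<phi>_def split_beta' by measurable
    then show ?thesis
      by (simp add: measurable_cong_sets[OF sets_pair_measure_cong[OF sets_halfline refl] refl])
  qed
  have scale: "ennreal (indicator {..t} s *\<^sub>R v) = indicator {..t} s * ennreal v"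
    "ennreal (- (indicator {..t} s *\<^sub>R v)) = indicator {..t} s * ennreal (- v)"
    "ennreal \<bar>indicator {..t} s *\<^sub>R v\<bar> = indicator {..t} s * ennreal \<bar>v\<bar>" for s v :: real
    by (auto split: split_indicator)
  have ext_m: "(\<lambda>\<omega>. ennreal (ext0 (qi g s) (jump_state \<omega> s))) \<in> borel_measurable P"
    "(\<lambda>\<omega>. ennreal (- ext0 (qi g s) (jump_state \<omega> s))) \<in> borel_measurable P"
    "(\<lambda>\<omega>. ennreal \<bar>ext0 (qi g s) (jump_state \<omega> s)\<bar>) \<in> borel_measurable P" if "0 \<le> s" for s
  proof -
    have "qi g s \<in> borel_measurable M"
      using measurable_Pair2[OF q_integral_measurable[OF g], of s] that by simp
    from ext0_measurable[OF this that] show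
      "(\<lambda>\<omega>. ennreal (ext0 (qi g s) (jump_state \<omega> s))) \<in> borel_measurable P"
      "(\<lambda>\<omega>. ennreal (- ext0 (qi g s) (jump_state \<omega> s))) \<in> borel_measurable P"
      "(\<lambda>\<omega>. ennreal \<bar>ext0 (qi g s) (jump_state \<omega> s)\<bar>) \<in> borel_measurable P"
      by measurable
  qed
  have nn: "(\<integral>\<^sup>+p. ennreal (case_prod \<phi> p) \<partial>(halfline \<Otimes>\<^sub>M P)) = upto t (\<lambda>s. mean s (gain g s))"
    unfolding upto_def
    by (subst P.nn_integral_fst[symmetric], use m in measurable, intro nn_integral_cong)
      (auto simp: \<phi>_def scale nn_integral_cmult ext_m nn_integral_ext0 space_restrict_space simp del: real_scaleR_def)
  have nn': "(\<integral>\<^sup>+p. ennreal (- case_prod \<phi> p) \<partial>(halfline \<Otimes>\<^sub>M P)) = upto t (\<lambda>s. mean s (loss g s))"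
    unfolding upto_def
    by (subst P.nn_integral_fst[symmetric], use m in measurable, intro nn_integral_cong)
      (auto simp: \<phi>_def scale nn_integral_cmult ext_m nn_integral_ext0_uminus space_restrict_space simp del: real_scaleR_def)
  have nna: "(\<integral>\<^sup>+p. ennreal \<bar>case_prod \<phi> p\<bar> \<partial>(halfline \<Otimes>\<^sub>M P)) = upto t (\<lambda>s. mean s (\<lambda>y. ennreal \<bar>qi g s y\<bar>))"
    unfolding upto_def
    by (subst P.nn_integral_fst[symmetric], use m in measurable, intro nn_integral_cong)
      (auto simp: \<phi>_def scale nn_integral_cmult[OF ext_m(3)] nn_integral_ext0_abs space_restrict_space simp del: real_scaleR_def)
  have int: "integrable (halfline \<Otimes>\<^sub>M P) (case_prod \<phi>)"
    by (rule integrableI_bounded[OF m]) (use fin nna in simp)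
  have lhs: "(LBINT s:{0..t}. (LINT \<omega>|P. ext0 (qi g s) (jump_state \<omega> s))) = (\<integral>s. (\<integral>\<omega>. \<phi> s \<omega> \<partial>P) \<partial>halfline)"
    unfolding set_lebesgue_integral_halfline \<phi>_def by simp
  have rhs: "(LINT \<omega>|P. (LBINT s:{0..t}. ext0 (qi g s) (jump_state \<omega> s))) = (\<integral>\<omega>. (\<integral>s. \<phi> s \<omega> \<partial>halfline) \<partial>P)"
    unfolding set_lebesgue_integral_halfline \<phi>_def ..
  show "(LINT \<omega>|P. (LBINT s:{0..t}. ext0 (qi g s) (jump_state \<omega> s)))
      = (LBINT s:{0..t}. (LINT \<omega>|P. ext0 (qi g s) (jump_state \<omega> s)))"
    unfolding lhs rhs by (rule PP.Fubini_integral[OF int])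
  show "(LBINT s:{0..t}. (LINT \<omega>|P. ext0 (qi g s) (jump_state \<omega> s)))
      = enn2real (upto t (\<lambda>s. mean s (gain g s)))
        - enn2real (upto t (\<lambda>s. mean s (loss g s)))"
    unfolding lhs PP.integral_fst[OF int] real_lebesgue_integral_def[OF int] nn nn' ..
qed

lemma upto_abs_bounds:
  shows "upto t (\<lambda>s. mean s (gain g s)) \<le> upto t (\<lambda>s. mean s (\<lambda>y. ennreal \<bar>qi g s y\<bar>))"
    "upto t (\<lambda>s. mean s (loss g s)) \<le> upto t (\<lambda>s. mean s (\<lambda>y. ennreal \<bar>qi g s y\<bar>))"
  by (intro upto_mono mean_mono ennreal_leI; simp)+

text \<open>The \<open>f\<close>-boundedness of \<open>g\<close> and \<open>fin\<close> make every
  term of \<open>forward_balance\<close> finite, so that it can be rearranged as an identity of real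
  numbers.\<close>

lemma forward_identity_at:
  assumes g: "f_bounded M f g" and t: "0 \<le> t" and lim: "(\<lambda>N. WP 0 N t fe) \<longlonglongrightarrow> 0"
    and fin: "upto t (\<lambda>s. mean s (\<lambda>y. ennreal \<bar>qi g s y\<bar>)) < top"
  shows "(LINT \<omega>|P. ext0 g (jump_state \<omega> t)) - g x
    = (LBINT s:{0..t}. (LINT \<omega>|P. ext0 (qi g s) (jump_state \<omega> s)))"
proof -
  obtain a where a: "0 \<le> a" "mean t (pos g) = ennreal a"
    using mean_f_bounded_finite(1)[OF g t] by (auto simp: less_top_ennreal)
  obtain b where b: "0 \<le> b" "mean t (neg g) = ennreal b"
    using mean_f_bounded_finite(2)[OF g t] by (auto simp: less_top_ennreal)
  obtain A where A: "0 \<le> A" "upto t (\<lambda>s. mean s (gain g s)) = ennreal A"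
    using le_less_trans[OF upto_abs_bounds(1) fin] by (auto simp: less_top_ennreal)
  obtain B where B: "0 \<le> B" "upto t (\<lambda>s. mean s (loss g s)) = ennreal B"
    using le_less_trans[OF upto_abs_bounds(2) fin] by (auto simp: less_top_ennreal)
  have max0: "ennreal z = ennreal (max 0 z)" for z by (simp add: max_def ennreal_neg)
  have "ennreal (b + A + max 0 (g x)) = ennreal (a + B + max 0 (- g x))"
    using forward_balance[OF g t lim] a b A B unfolding max0[of "g x"] max0[of "- g x"] by simp
  then have "b + A + max 0 (g x) = a + B + max 0 (- g x)"
    using a b A B by (subst (asm) ennreal_inj) auto
  then have "a - b - g x = A - B" by (auto simp: max_def split: if_splits)
  then show ?thesis
    unfolding integral_ext0[OF g t] forward_integrals(1)[OF g fin] a b A B using a b A B by simp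
qed

text \<open>Pointwise, the drift of \<open>f\<close> plus the surplus is \<open>c f\<close>; the
  negative part of the drift is moved to the right. This trades the terms of
  \<open>WP_0_limit\<close> for the positive and negative parts of the drift.\<close>

lemma f_parts_balance:
  assumes t: "0 \<le> t"
  shows "upto t (\<lambda>s. mean s (gain f s)) + upto t (\<lambda>s. mean s (dr s))
    = upto t (\<lambda>s. mean s (loss f s)) + ennreal c * upto t (\<lambda>s. mean s fe)"
proof -
  let ?A = "\<lambda>s y. ennreal (qi f s y)" and ?B = "\<lambda>s y. ennreal (- qi f s y)"
  have A: "case_prod ?A \<in> borel_measurable EM" and B: "case_prod ?B \<in> borel_measurable EM"
    using q_integral_measurable[OF f_bounded_self] unfolding split_beta' by measurable
  have "mean s (?A s) + mean s (dr s) = mean s (?B s) + ennreal c * mean s fe" if s: "0 \<le> s" for s :: real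
  proof -
    have "mean s (?A s) + mean s (dr s) = mean s (\<lambda>y. ?A s y + dr s y)"
      by (intro mean_add[symmetric] measurable_snd_const[OF A] dr_section s)
    also have "\<dots> = mean s (\<lambda>y. ?B s y + ennreal c * fe y)"
    proof (rule mean_cong)
      fix y assume y: "y \<in> space M"
      define v where "v = qi f s y"
      have v: "v \<le> c * f y" using q_integral_f_le[OF y s] by (simp add: v_def)
      have cf: "0 \<le> c * f y" using c f_pos[OF y] by simp
      have "ennreal v + ennreal (c * f y - v) = ennreal (- v) + ennreal (c * f y)"
      proof (cases "0 \<le> v")
        case True
        then show ?thesis using v by (simp add: ennreal_neg ennreal_plus[symmetric] del: ennreal_plus)
      next
        case False
        then show ?thesis using v cf by (simp add: ennreal_neg ennreal_plus[symmetric] del: ennreal_plus)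
      qed
      then show "?A s y + dr s y = ?B s y + ennreal c * fe y"
        using c f_pos[OF y] by (simp add: dr_def v_def ennreal_mult less_imp_le)
    qed
    also have "\<dots> = mean s (?B s) + mean s (\<lambda>y. ennreal c * fe y)"
      by (rule mean_add[OF measurable_snd_const[OF B s] _ s]) measurable
    also have "mean s (\<lambda>y. ennreal c * fe y) = ennreal c * mean s fe"
      by (rule mean_cmult[OF fe_measurable s])
    finally show ?thesis .
  qed
  then have "upto t (\<lambda>s. mean s (?A s) + mean s (dr s)) = upto t (\<lambda>s. mean s (?B s) + ennreal c * mean s fe)"
    by (intro upto_cong) simp
  then show ?thesis
    using mean_measurable[OF A] mean_measurable[OF B] mean_measurable[OF dr_measurable] mean_measurable[OF fe_time_measurable]
    by (simp add: upto_add upto_cmult)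
qed

text \<open>The surplus \<open>dr\<close> and \<open>c f\<close> have finite time integrals and
  together dominate the drift of \<open>f\<close>. Hence \<open>f\<close> itself is an admissible
  \<open>g\<close>, which gives the necessity.\<close>

lemma f_abs_finite:
  assumes t: "0 \<le> t"
  shows "upto t (\<lambda>s. mean s (\<lambda>y. ennreal \<bar>qi f s y\<bar>)) < top"
proof -
  have "upto t (\<lambda>s. mean s (\<lambda>y. ennreal \<bar>qi f s y\<bar>))
    \<le> upto t (\<lambda>s. mean s (dr s) + ennreal c * mean s fe)"
  proof (rule upto_mono)
    fix s :: real assume s: "0 \<le> s"
    have "mean s (\<lambda>y. ennreal \<bar>qi f s y\<bar>) \<le> mean s (\<lambda>y. dr s y + ennreal c * fe y)"
    proof (rule mean_mono)
      fix y assume y: "y \<in> space M"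
      have v: "qi f s y \<le> c * f y" by (rule q_integral_f_le[OF y s])
      have cf: "0 \<le> c * f y" using c f_pos[OF y] by simp
      \<comment> \<open>For \<open>v \<le> w\<close> and \<open>0 \<le> w\<close> one has
        \<open>\<bar>v\<bar> \<le> (w - v) + w\<close>, whatever the sign of
        \<open>v\<close>.\<close>
      have "ennreal \<bar>qi f s y\<bar> \<le> ennreal ((c * f y - qi f s y) + c * f y)"
        using v cf by (intro ennreal_leI) auto
      also have "\<dots> = ennreal (c * f y - qi f s y) + ennreal (c * f y)"
        using v cf by (intro ennreal_plus) auto
      also have "\<dots> = dr s y + ennreal c * fe y"
        using c f_pos[OF y] by (simp add: dr_def ennreal_mult less_imp_le)
      finally show "ennreal \<bar>qi f s y\<bar> \<le> dr s y + ennreal c * fe y" .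
    qed
    also have "\<dots> = mean s (dr s) + mean s (\<lambda>y. ennreal c * fe y)"
      by (rule mean_add[OF dr_section[OF s] _ s]) measurable
    also have "mean s (\<lambda>y. ennreal c * fe y) = ennreal c * mean s fe"
      by (rule mean_cmult[OF fe_measurable s])
    finally show "mean s (\<lambda>y. ennreal \<bar>qi f s y\<bar>) \<le> mean s (dr s) + ennreal c * mean s fe" .
  qed
  also have "\<dots> = upto t (\<lambda>s. mean s (dr s)) + ennreal c * upto t (\<lambda>s. mean s fe)"
    using mean_measurable[OF dr_measurable] mean_measurable[OF fe_time_measurable]
    by (simp add: upto_add upto_cmult)
  also have "\<dots> < top"
    using upto_mean_dr_finite[OF t] upto_mean_f_finite[OF t] by (simp add: ennreal_mult_less_top)
  finally show ?thesis .
qed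

text \<open>All terms being finite, \<open>WP_0_limit\<close> reads
  \<open>a + D + l = f x + c * J\<close> and \<open>f_parts_balance\<close> reads
  \<open>A + D = B + c * J\<close>. Subtracting, the defect \<open>l\<close> is exactly
  \<open>(A - B) - (a - f x)\<close>.\<close>

lemma drift_real_iff:
  assumes t: "0 \<le> t"
  obtains a A B where "0 \<le> a" "mean t fe = ennreal a"
    "0 \<le> A" "upto t (\<lambda>s. mean s (gain f s)) = ennreal A"
    "0 \<le> B" "upto t (\<lambda>s. mean s (loss f s)) = ennreal B"
    "a - f x = A - B \<longleftrightarrow> (\<lambda>N. WP 0 N t fe) \<longlonglongrightarrow> 0"
proof -
  obtain a where a: "0 \<le> a" "mean t fe = ennreal a"
    using mean_f_bounded_finite(1)[OF f_bounded_self t] by (auto simp: less_top_ennreal)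
  obtain A where A: "0 \<le> A" "upto t (\<lambda>s. mean s (gain f s)) = ennreal A"
    using le_less_trans[OF upto_abs_bounds(1) f_abs_finite[OF t]] by (auto simp: less_top_ennreal)
  obtain B where B: "0 \<le> B" "upto t (\<lambda>s. mean s (loss f s)) = ennreal B"
    using le_less_trans[OF upto_abs_bounds(2) f_abs_finite[OF t]] by (auto simp: less_top_ennreal)
  obtain D where D: "0 \<le> D" "upto t (\<lambda>s. mean s (dr s)) = ennreal D"
    using upto_mean_dr_finite[OF t] by (auto simp: less_top_ennreal)
  obtain J where J: "0 \<le> J" "upto t (\<lambda>s. mean s fe) = ennreal J"
    using upto_mean_f_finite[OF t] by (auto simp: less_top_ennreal)
  obtain L where L: "(\<lambda>N. WP 0 N t fe) \<longlonglongrightarrow> L"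
    "mean t fe + upto t (\<lambda>s. mean s (dr s)) + L = fe x + ennreal c * upto t (\<lambda>s. mean s fe)"
    by (rule WP_0_limit[OF t]) (rule that)
  have fx: "0 \<le> f x" using f_pos[OF x] by simp
  have eqL: "ennreal (a + D) + L = ennreal (f x + c * J)"
    using L(2) a D J fx c by (simp add: ennreal_mult)
  then have "L \<noteq> top" by auto
  then obtain l where l: "0 \<le> l" "L = ennreal l" by (cases L) auto
  have 1: "a + D + l = f x + c * J"
    using eqL a D l fx c J by (simp add: ennreal_plus[symmetric] del: ennreal_plus)
  have "ennreal (A + D) = ennreal (B + c * J)"
    using f_parts_balance[OF t] A B D J c by (simp add: ennreal_mult)
  then have 2: "A + D = B + c * J" using A B D J c by (subst (asm) ennreal_inj) auto
  have "a - f x = A - B \<longleftrightarrow> l = 0" using 1 2 by auto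
  also have "\<dots> \<longleftrightarrow> (\<lambda>N. WP 0 N t fe) \<longlonglongrightarrow> 0"
    using L(1) l LIMSEQ_unique[OF L(1), of 0] by (auto simp: ennreal_eq_0_iff)
  finally have "a - f x = A - B \<longleftrightarrow> (\<lambda>N. WP 0 N t fe) \<longlonglongrightarrow> 0" .
  with a A B show ?thesis by (rule that)
qed

text \<open>The negative part of \<open>f\<close> contributes 0, so the identity for
  \<open>g = f\<close> is the real equation in \<open>drift_real_iff\<close>.\<close>

lemma forward_identity_f_imp:
  assumes t: "0 \<le> t"
    and eq: "(LINT \<omega>|P. ext0 f (jump_state \<omega> t)) - f x
      = (LBINT s:{0..t}. (LINT \<omega>|P. ext0 (qi f s) (jump_state \<omega> s)))"
  shows "(\<lambda>N. WP 0 N t fe) \<longlonglongrightarrow> 0"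
proof -
  obtain a A B where *: "0 \<le> a" "mean t fe = ennreal a"
    "0 \<le> A" "upto t (\<lambda>s. mean s (gain f s)) = ennreal A"
    "0 \<le> B" "upto t (\<lambda>s. mean s (loss f s)) = ennreal B"
    "a - f x = A - B \<longleftrightarrow> (\<lambda>N. WP 0 N t fe) \<longlonglongrightarrow> 0"
    by (rule drift_real_iff[OF t]) (rule that)
  have "mean t (\<lambda>y. ennreal (- f y)) = mean t (\<lambda>_. 0)"
    using f_pos by (intro mean_cong) (auto intro!: ennreal_neg less_imp_le)
  also have "\<dots> = 0" using mean_cmult[of "\<lambda>_. 0" t 0] t by simp
  finally have neg: "mean t (\<lambda>y. ennreal (- f y)) = 0" .
  have "a - f x = A - B"
    using eq unfolding integral_ext0[OF f_bounded_self t] forward_integrals(1)[OF f_bounded_self f_abs_finite[OF t]] neg *(2,4,6)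
    using * by simp
  then show ?thesis using *(7) by (rule iffD1[rotated])
qed

text \<open>The expectation inside the time integral may be \<open>-\<infinity>\<close> at single
  times. Its positive and negative parts are the truncated differences \<open>p s - m s\<close> and
  \<open>m s - p s\<close>, not \<open>p s\<close> and \<open>m s\<close>; their integrals
  \<open>A'\<close> and \<open>B'\<close> may differ from \<open>A\<close> and \<open>B\<close>, but
  \<open>A' - B' = A - B\<close>.\<close>

lemma drift_identity_at:
  assumes t: "0 \<le> t"
  shows "extended_integral P (\<lambda>\<omega>. ereal (ext0 f (jump_state \<omega> t))) - ereal (f x) =
       extended_integral (restrict_space lborel {0..t}) (\<lambda>s.
         extended_integral P (\<lambda>\<omega>. ereal (ext0 (qi f s) (jump_state \<omega> s))))
    \<longleftrightarrow> (\<lambda>N. WP 0 N t fe) \<longlonglongrightarrow> 0"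
proof -
  obtain a A B where *: "0 \<le> a" "mean t fe = ennreal a"
    "0 \<le> A" "upto t (\<lambda>s. mean s (gain f s)) = ennreal A"
    "0 \<le> B" "upto t (\<lambda>s. mean s (loss f s)) = ennreal B"
    "a - f x = A - B \<longleftrightarrow> (\<lambda>N. WP 0 N t fe) \<longlonglongrightarrow> 0"
    by (rule drift_real_iff[OF t]) (rule that)
  have "mean t (\<lambda>y. ennreal (- f y)) = mean t (\<lambda>_. 0)"
    using f_pos by (intro mean_cong) (auto intro!: ennreal_neg less_imp_le)
  also have "\<dots> = 0" using mean_cmult[of "\<lambda>_. 0" t 0] t by simp
  finally have neg: "mean t (\<lambda>y. ennreal (- f y)) = 0" .
  define p where "p s = mean s (gain f s)" for s
  define m where "m s = mean s (loss f s)" for s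
  have A: "case_prod (\<lambda>s y. ennreal (qi f s y)) \<in> borel_measurable EM"
    and B: "case_prod (\<lambda>s y. ennreal (- qi f s y)) \<in> borel_measurable EM"
    using q_integral_measurable[OF f_bounded_self] unfolding split_beta' by measurable
  have [measurable]: "p \<in> borel_measurable time_space" "m \<in> borel_measurable time_space"
    unfolding p_def[abs_def] m_def[abs_def] by (rule mean_measurable[OF A], rule mean_measurable[OF B])
  \<comment> \<open>The drift inequality bounds the positive part at every single time; for the
    negative part only the time integral is controlled.\<close>
  have pfin: "p s \<noteq> top" if s: "0 \<le> s" for s
  proof -
    have "p s \<le> mean s (\<lambda>y. ennreal c * fe y)"
      unfolding p_def
    proof (rule mean_mono)
      fix y assume y: "y \<in> space M"
      show "ennreal (qi f s y) \<le> ennreal c * fe y"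
        using q_integral_f_le[OF y s] c f_pos[OF y] by (simp add: ennreal_mult[symmetric] less_imp_le ennreal_leI)
    qed
    also have "\<dots> = ennreal c * mean s fe" by (rule mean_cmult[OF fe_measurable s])
    also have "\<dots> < top"
      using le_less_trans[OF mean_f_le[OF s]] by (simp add: ennreal_mult_less_top)
    finally show ?thesis by simp
  qed
  define G where "G s = extended_integral P (\<lambda>\<omega>. ereal (ext0 (qi f s) (jump_state \<omega> s)))" for s
  have G: "G s = enn2ereal (p s) - enn2ereal (m s)" for s
    unfolding G_def extended_integral_ext0 p_def m_def ..
  have restrict: "(\<integral>\<^sup>+s. h s \<partial>restrict_space lborel {0..t}) = upto t h" for h
    unfolding upto_lborel by (subst nn_integral_restrict_space) auto
  have e1: "(\<integral>\<^sup>+s. e2ennreal (G s) \<partial>restrict_space lborel {0..t}) = upto t (\<lambda>s. p s - m s)"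
    unfolding restrict by (intro upto_cong) (simp add: G e2ennreal_diff pfin)
  have e2: "(\<integral>\<^sup>+s. e2ennreal (- G s) \<partial>restrict_space lborel {0..t}) = upto t (\<lambda>s. m s - p s)"
    unfolding restrict by (intro upto_cong) (simp add: G e2ennreal_diff pfin)
  \<comment> \<open>Both integrands are the maximum of \<open>p s\<close> and
    \<open>m s\<close>.\<close>
  have "upto t (\<lambda>s. (p s - m s) + m s) = upto t (\<lambda>s. (m s - p s) + p s)"
  proof (rule upto_cong)
    fix s :: real assume "0 \<le> s"
    then have "p s \<noteq> top" by (rule pfin)
    show "(p s - m s) + m s = (m s - p s) + p s"
    proof (cases "p s \<le> m s")
      case True
      then have "p s - m s = 0" using \<open>p s \<noteq> top\<close> by (intro diff_eq_0_ennreal) (simp_all add: less_top)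
      then show ?thesis using True by (simp add: diff_add_cancel_ennreal)
    next
      case False
      then have "m s \<le> p s" "m s \<noteq> top" using \<open>p s \<noteq> top\<close> by auto
      then show ?thesis by (simp add: diff_add_cancel_ennreal diff_eq_0_ennreal less_top)
    qed
  qed
  then have bal: "upto t (\<lambda>s. p s - m s) + ennreal B = upto t (\<lambda>s. m s - p s) + ennreal A"
    using * by (simp add: upto_add p_def[symmetric] m_def[symmetric])
  have u1: "upto t (\<lambda>s. p s - m s) \<le> ennreal A"
    unfolding *(4)[symmetric] p_def[symmetric] by (intro upto_mono) (simp add: diff_le_self_ennreal)
  have u2: "upto t (\<lambda>s. m s - p s) \<le> ennreal B"
    unfolding *(6)[symmetric] m_def[symmetric] by (intro upto_mono) (simp add: diff_le_self_ennreal)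
  obtain A' where A': "0 \<le> A'" "upto t (\<lambda>s. p s - m s) = ennreal A'"
    using u1 by (cases "upto t (\<lambda>s. p s - m s)") (auto simp: top_unique)
  obtain B' where B': "0 \<le> B'" "upto t (\<lambda>s. m s - p s) = ennreal B'"
    using u2 by (cases "upto t (\<lambda>s. m s - p s)") (auto simp: top_unique)
  have "ennreal (A' + B) = ennreal (B' + A)" using bal A' B' * by simp
  then have AB: "A' + B = B' + A" using A' B' * by (subst (asm) ennreal_inj) auto
  have "extended_integral P (\<lambda>\<omega>. ereal (ext0 f (jump_state \<omega> t))) - ereal (f x) = ereal (a - f x)"
    unfolding extended_integral_ext0 neg *(2) using *(1) by (simp add: zero_ennreal.rep_eq)
  moreover have "extended_integral (restrict_space lborel {0..t}) G = ereal (A' - B')"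
    unfolding extended_integral_def e1 e2 A' B' using A' B' by simp
  ultimately show ?thesis
    using AB *(7) unfolding G_def by auto
qed

end

context jump_process
begin

lemma emeasure_q_tilde_singleton: "y \<in> space M \<Longrightarrow> 0 \<le> s \<Longrightarrow> emeasure (q_tilde M q y s) {y} = 0"
  by (simp add: emeasure_q_tilde sets_singleton q_empty)

end

context started_jump_process
begin

lemma Psi_Suc_integrand_measurable:
  assumes k[measurable]: "case_prod k \<in> borel_measurable EM"
  shows "(\<lambda>(u, y). \<integral>\<^sup>+v. indicator {u<..} v * (ennreal (survival q y u v) * (\<integral>\<^sup>+z. k v z \<partial>q_tilde M q y v)) \<partial>halfline)
    \<in> borel_measurable EM"
  unfolding split_beta'
proof (rule borel_measurable_nn_integral_halfline)
  let ?L = "EM \<Otimes>\<^sub>M time_space"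
  have [measurable]: "snd \<in> borel_measurable ?L" "(\<lambda>p. fst (fst p)) \<in> borel_measurable ?L"
    by (rule measurable_time_borel, measurable)+
  have [measurable]: "(\<lambda>p. survival q (snd (fst p)) (fst (fst p)) (snd p)) \<in> borel_measurable ?L"
    by (rule survival_measurable) measurable
  have "(\<lambda>p. (snd (fst p), snd p)) \<in> ?L \<Otimes>\<^sub>M M \<rightarrow>\<^sub>M EM" by measurable
  from measurable_compose[OF this k]
  have [measurable]: "(\<lambda>p. k (snd (fst p)) (snd p)) \<in> borel_measurable (?L \<Otimes>\<^sub>M M)" by simp
  have [measurable]: "(\<lambda>p. \<integral>\<^sup>+z. k (snd p) z \<partial>q_tilde M q (snd (fst p)) (snd p)) \<in> borel_measurable ?L"
    by (rule nn_integral_q_tilde_measurable) measurable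
  have "(\<lambda>p. (if fst (fst p) < snd p then 1 else 0) * (ennreal (survival q (snd (fst p)) (fst (fst p)) (snd p)) *
      (\<integral>\<^sup>+z. k (snd p) z \<partial>q_tilde M q (snd (fst p)) (snd p)))) \<in> borel_measurable ?L"
    by measurable
  then show "(\<lambda>(w, v). indicator {fst w<..} v * (ennreal (survival q (snd w) (fst w) v) *
      (\<integral>\<^sup>+z. k v z \<partial>q_tilde M q (snd w) v))) \<in> borel_measurable ?L"
    by (simp add: indicator_def split_beta' cong: if_cong)
qed

section \<open>Explosion and the probability of n jumps up to a fixed time\<close>

definition hit :: "nat \<Rightarrow> real \<Rightarrow> ennreal" where
  "hit n t = Psi n (\<lambda>u y. if u \<le> t then 1 else 0)"

lemma hit_eq: "hit n t = (\<integral>\<^sup>+\<omega>. (if jump_time \<omega> n \<le> ereal t then 1 else 0) \<partial>P)"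
  unfolding hit_def Psi_def jump_time_eq by (intro nn_integral_cong) (auto split: option.split)

lemma hit_measurable: "(\<lambda>\<omega>. if jump_time \<omega> n \<le> ereal t then 1 else 0 :: ennreal) \<in> borel_measurable P"
  unfolding jump_time_eq by measurable

lemma hit_indicator_measurable: "(\<lambda>(u, y). if u \<le> t then 1 else 0 :: ennreal) \<in> borel_measurable EM"
proof -
  show ?thesis unfolding split_beta' by measurable
qed

text \<open>The \<open>lim\<close> in the explosion time is meaningful because a monotone sequence
  of extended reals converges to its supremum.\<close>

lemma jump_time_tendsto_explosion_time:
  assumes "\<forall>n. jump_time \<omega> n \<le> jump_time \<omega> (Suc n)"
  shows "jump_time \<omega> \<longlonglongrightarrow> explosion_time \<omega>"
proof -
  have "incseq (jump_time \<omega>)" using assms by (intro incseq_SucI) simp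
  then have "jump_time \<omega> \<longlonglongrightarrow> (SUP n. jump_time \<omega> n)" by (rule LIMSEQ_SUP)
  then show ?thesis unfolding explosion_time_def by (simp add: limI)
qed

text \<open>Explosion means infinitely many jumps in bounded time. One direction is dominated
  convergence; for the other, the event that all jump times are at most \<open>m\<close> is
  contained in every event whose probability is \<open>hit n m\<close>, and countably many
  \<open>m\<close> suffice.\<close>

lemma explosion_time_infinite_iff:
  "(AE \<omega> in P. explosion_time \<omega> = \<infinity>) \<longleftrightarrow> (\<forall>t\<ge>0. (\<lambda>n. hit n t) \<longlonglongrightarrow> 0)"
proof (intro iffI allI impI)
  fix t :: real
  assume ae: "AE \<omega> in P. explosion_time \<omega> = \<infinity>"
  have "(\<lambda>n. hit n t) \<longlonglongrightarrow> (\<integral>\<^sup>+\<omega>. 0 \<partial>P)"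
    unfolding hit_eq
  proof (rule nn_integral_dominated_convergence[where w="\<lambda>_. 1"])
    show "AE \<omega> in P. (\<lambda>n. if jump_time \<omega> n \<le> ereal t then 1 else 0 :: ennreal) \<longlonglongrightarrow> 0"
      using ae AE_jump_time_mono
    proof eventually_elim
      case (elim \<omega>)
      from jump_time_tendsto_explosion_time[OF elim(2)] elim(1)
      have "jump_time \<omega> \<longlonglongrightarrow> \<infinity>" by simp
      then have "eventually (\<lambda>n. ereal t < jump_time \<omega> n) sequentially"
        by (rule order_tendstoD) simp
      then show ?case
        by (intro tendsto_eventually) (auto elim: eventually_mono)
    qed
  qed (auto intro: hit_measurable simp: P.emeasure_space_1)
  then show "(\<lambda>n. hit n t) \<longlonglongrightarrow> 0" by simp
next
  assume lim: "\<forall>t\<ge>0. (\<lambda>n. hit n t) \<longlonglongrightarrow> 0"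
  have "AE \<omega> in P. \<not> (\<forall>n. jump_time \<omega> n \<le> ereal (real m))" for m :: nat
  proof -
    let ?g = "\<lambda>\<omega>. if \<forall>n. jump_time \<omega> n \<le> ereal (real m) then 1 else 0 :: ennreal"
    have gm: "?g \<in> borel_measurable P" unfolding jump_time_eq by measurable
    have "(\<integral>\<^sup>+\<omega>. ?g \<omega> \<partial>P) \<le> hit n (real m)" for n
      unfolding hit_eq by (intro nn_integral_mono) auto
    then have "(\<integral>\<^sup>+\<omega>. ?g \<omega> \<partial>P) \<le> 0"
      using lim by (intro LIMSEQ_le_const[of "\<lambda>n. hit n (real m)"]) auto
    then have "(\<integral>\<^sup>+\<omega>. ?g \<omega> \<partial>P) = 0" by simp
    then have "AE \<omega> in P. ?g \<omega> = 0" by (subst nn_integral_0_iff_AE[OF gm, symmetric])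
    then show ?thesis by eventually_elim (auto split: if_splits)
  qed
  then have "\<forall>m::nat. AE \<omega> in P. \<not> (\<forall>n. jump_time \<omega> n \<le> ereal (real m))" ..
  then have "AE \<omega> in P. \<forall>m::nat. \<not> (\<forall>n. jump_time \<omega> n \<le> ereal (real m))"
    by (rule AE_all_countable[THEN iffD2])
  with AE_jump_time_mono show "AE \<omega> in P. explosion_time \<omega> = \<infinity>"
  proof eventually_elim
    case (elim \<omega>)
    have le: "jump_time \<omega> n \<le> explosion_time \<omega>" for n
    proof (rule incseq_le)
      show "incseq (jump_time \<omega>)" using elim(1) by (intro incseq_SucI) simp
      show "jump_time \<omega> \<longlonglongrightarrow> explosion_time \<omega>" by (rule jump_time_tendsto_explosion_time[OF elim(1)])
    qed
    have "ereal (real m) \<le> explosion_time \<omega>" for m :: nat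
    proof -
      obtain n where "ereal (real m) < jump_time \<omega> n" using elim(2) by (auto simp: not_le)
      with le[of n] show ?thesis by simp
    qed
    note m_le = this
    show ?case
    proof (rule ereal_top)
      fix B :: real
      obtain m :: nat where "B \<le> real m" using real_arch_simple by blast
      then have "ereal B \<le> ereal (real m)" by simp
      then show "ereal B \<le> explosion_time \<omega>" using m_le by (rule order_trans)
    qed
  qed
qed

end

context drift_process
begin

section \<open>The transformed Q-function\<close>

abbreviation "Sd \<equiv> option_space M"
abbreviation "qf \<equiv> f_transform M q c f"
abbreviation "weighted y s \<equiv> density (q_tilde M q y s) fe"

text \<open>The measure with density \<open>f\<close> is finite by the drift condition and has no
  mass at \<open>y\<close>, so removing the current state, as \<open>q_tilde\<close> does for the
  transformed process, does not change it.\<close>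

lemma weighted_facts:
  assumes y: "y \<in> space M" "0 \<le> s"
  shows "finite_measure (weighted y s)"
    and "B \<in> sets M \<Longrightarrow> emeasure (weighted y s) B = (\<integral>\<^sup>+z. fe z * indicator B z \<partial>q_tilde M q y s)"
    and "B \<in> sets M \<Longrightarrow> measure (weighted y s) (B - {y}) = measure (weighted y s) B"
    and "measure (weighted y s) {y} = 0"
    and "measure (weighted y s) (space M) = (LINT z|q_tilde M q y s. f z)"
    and "B \<in> sets M \<Longrightarrow> (LINT z:B|q_tilde M q y s. f z) = measure (weighted y s) B"
proof -
  note fe = measurable_q_tilde[OF fe_measurable, of y s]
  show em: "emeasure (weighted y s) B = (\<integral>\<^sup>+z. fe z * indicator B z \<partial>q_tilde M q y s)" if "B \<in> sets M" for B
    using fe that by (intro emeasure_density) simp_all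
  show fin: "finite_measure (weighted y s)"
  proof (rule finite_measureI)
    have "emeasure (weighted y s) (space M) = (\<integral>\<^sup>+z. fe z * indicator (space M) z \<partial>q_tilde M q y s)"
      by (rule em) simp
    also have "\<dots> = (\<integral>\<^sup>+z. fe z \<partial>q_tilde M q y s)" by (intro nn_integral_cong) simp
    also have "\<dots> < top" by (rule nn_integral_f_finite[OF y])
    finally show "emeasure (weighted y s) (space (weighted y s)) \<noteq> \<infinity>" by simp
  qed
  have point: "emeasure (weighted y s) {y} = 0"
  proof -
    have "emeasure (weighted y s) {y} = (\<integral>\<^sup>+z. fe z * indicator {y} z \<partial>q_tilde M q y s)"
      by (rule em) (rule sets_singleton[OF y(1)])
    also have "\<dots> = (\<integral>\<^sup>+z. fe y * indicator {y} z \<partial>q_tilde M q y s)"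
      by (intro nn_integral_cong) (auto split: split_indicator)
    also have "\<dots> = fe y * emeasure (q_tilde M q y s) {y}"
      by (rule nn_integral_cmult_indicator) (simp add: sets_singleton y)
    finally show ?thesis using emeasure_q_tilde_singleton[OF y] by simp
  qed
  then show "measure (weighted y s) {y} = 0" by (simp add: measure_def)
  show "measure (weighted y s) (B - {y}) = measure (weighted y s) B" if B: "B \<in> sets M" for B
  proof -
    have "{y} \<in> null_sets (weighted y s)" using point sets_singleton[OF y(1)] by (intro null_setsI) simp_all
    then have "emeasure (weighted y s) (B - {y}) = emeasure (weighted y s) B"
      using B by (intro emeasure_Diff_null_set) simp_all
    then show ?thesis by (simp add: measure_def)
  qed
  show li: "(LINT z:B|q_tilde M q y s. f z) = measure (weighted y s) B" if B: "B \<in> sets M" for B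
  proof -
    have "(LINT z:B|q_tilde M q y s. f z) = enn2real (\<integral>\<^sup>+z. ennreal (indicator B z *\<^sub>R f z) \<partial>q_tilde M q y s)"
      unfolding set_lebesgue_integral_def
    proof (rule integral_eq_nn_integral)
      show "(\<lambda>z. indicator B z *\<^sub>R f z) \<in> borel_measurable (q_tilde M q y s)"
      proof (rule measurable_q_tilde)
        note B [measurable]
        show "(\<lambda>z. indicator B z *\<^sub>R f z) \<in> borel_measurable M" by measurable
      qed
      show "AE z in q_tilde M q y s. 0 \<le> indicator B z *\<^sub>R f z"
        using f_pos by (intro AE_I2) (auto simp: less_imp_le split: split_indicator)
    qed
    also have "(\<integral>\<^sup>+z. ennreal (indicator B z *\<^sub>R f z) \<partial>q_tilde M q y s) = emeasure (weighted y s) B"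
      unfolding em[OF B] by (intro nn_integral_cong) (auto split: split_indicator)
    finally show ?thesis by (simp add: measure_def)
  qed
  have "(LINT z|q_tilde M q y s. f z) = (LINT z:space M|q_tilde M q y s. f z)"
    unfolding set_lebesgue_integral_def by (intro Bochner_Integration.integral_cong) simp_all
  then show "measure (weighted y s) (space M) = (LINT z|q_tilde M q y s. f z)" using li[OF sets.top] by simp
qed

lemma qf_None [simp]: "qf None s \<Gamma> = 0"
  by (simp add: f_transform_def)

lemma qf_Some:
  assumes "y \<in> space M" "0 \<le> s" "\<Gamma> \<in> sets Sd"
  shows "qf (Some y) s \<Gamma> = measure (weighted y s) (Some -` \<Gamma>) / f y
     + (c - qi f s y / f y) * indicator \<Gamma> None - (c + q_rate q y s) * indicator \<Gamma> (Some y)"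
  using assms weighted_facts(6)[OF assms(1,2), of "Some -` \<Gamma>"]
  by (simp add: f_transform_def sets_option_space)

lemma killing_nonneg: "y \<in> space M \<Longrightarrow> 0 \<le> s \<Longrightarrow> 0 \<le> c - qi f s y / f y"
  using q_integral_f_le[of y s] f_pos[of y] by (simp add: divide_le_eq)

text \<open>Nonnegativity of the mass at \<open>None\<close> is the drift inequality, total mass 0
  is the definition of \<open>q_integral\<close>, and the exit rate from \<open>Some y\<close> is
  \<open>c + q_rate q y s\<close>, so its bound in time is inherited from \<open>q\<close>.\<close>

lemma Q_function_transform: "Q_function Sd qf"
  unfolding Q_function_def signed_kernel_def
proof (intro conjI ballI allI impI)
  fix z and s :: real and A :: "nat \<Rightarrow> 'a option set"
  assume z: "z \<in> space Sd" and s: "0 \<le> s" and A: "range A \<subseteq> sets Sd" "disjoint_family A"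
  show "(\<lambda>n. qf z s (A n)) sums qf z s (\<Union>n. A n)"
  proof (cases z)
    case None
    then show ?thesis by simp
  next
    case (Some y)
    then have y: "y \<in> space M" using z by auto
    have UA: "(\<Union>n. A n) \<in> sets Sd" using A(1) by auto
    have An: "A n \<in> sets Sd" for n using A(1) by auto
    have dis: "i \<noteq> j \<Longrightarrow> A i \<inter> A j = {}" for i j using A(2) by (auto simp: disjoint_family_on_def)
    have "(\<lambda>n. measure (weighted y s) (Some -` A n)) sums measure (weighted y s) (\<Union>n. Some -` A n)"
    proof (rule finite_measure.finite_measure_UNION[OF weighted_facts(1)[OF y s]])
      show "range (\<lambda>n. Some -` A n) \<subseteq> sets (weighted y s)" using An by (auto simp: sets_option_space)
      show "disjoint_family (\<lambda>n. Some -` A n)" by (rule disjoint_family_on_vimageI[OF A(2)])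
    qed
    then have 1: "(\<lambda>n. measure (weighted y s) (Some -` A n)) sums measure (weighted y s) (Some -` (\<Union>n. A n))"
      by (simp add: vimage_UN)
    have 2: "(\<lambda>n. indicator (A n) w :: real) sums indicator (\<Union>n. A n) w" for w
      by (rule indicator_sums) (rule dis)
    show ?thesis
      unfolding Some qf_Some[OF y s UA] qf_Some[OF y s An]
      by (intro sums_diff sums_add sums_divide sums_mult 1 2)
  qed
next
  fix \<Gamma> assume \<Gamma>: "\<Gamma> \<in> sets Sd"
  then have B: "Some -` \<Gamma> \<in> sets M" by (simp add: sets_option_space)
  note B [measurable]
  \<comment> \<open>The last factor carries the content of a \<open>Some\<close> state, in the form
    that the measurability rule for case distinctions requires.\<close>
  let ?L = "(Sd \<Otimes>\<^sub>M time_space) \<Otimes>\<^sub>M M"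
  have [measurable]: "(\<lambda>p. qi f (snd (fst p)) (snd p)) \<in> borel_measurable ?L"
  proof -
    have "(\<lambda>p. (snd (fst p), snd p)) \<in> ?L \<rightarrow>\<^sub>M EM" by measurable
    from measurable_compose[OF this q_integral_measurable[OF f_bounded_self]] show ?thesis by simp
  qed
  have [measurable]: "(\<lambda>p. q_rate q (snd p) (snd (fst p))) \<in> borel_measurable ?L"
    by (rule q_rate_measurable) measurable
  have [measurable]: "(\<lambda>p. \<integral>\<^sup>+w. fe w * indicator (Some -` \<Gamma>) w \<partial>q_tilde M q (snd p) (snd (fst p))) \<in> borel_measurable ?L"
    by (rule nn_integral_q_tilde_measurable) measurable
  have ind: "(\<lambda>p. indicator \<Gamma> (Some (snd p)) :: real) = (\<lambda>p. indicator (Some -` \<Gamma>) (snd p))"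
    by (auto simp: fun_eq_iff split: split_indicator)
  have "(\<lambda>p. enn2real (\<integral>\<^sup>+w. fe w * indicator (Some -` \<Gamma>) w \<partial>q_tilde M q (snd p) (snd (fst p))) / f (snd p)
     + (c - qi f (snd (fst p)) (snd p) / f (snd p)) * indicator \<Gamma> None
     - (c + q_rate q (snd p) (snd (fst p))) * indicator (Some -` \<Gamma>) (snd p)) \<in> borel_measurable ?L"
    by measurable
  also have "?this \<longleftrightarrow> (\<lambda>p. qf (Some (snd p)) (snd (fst p)) \<Gamma>) \<in> borel_measurable ?L"
  proof (rule measurable_cong)
    fix p assume "p \<in> space ?L"
    then have p: "snd p \<in> space M" "0 \<le> snd (fst p)" by (auto simp: space_pair_measure)
    show "enn2real (\<integral>\<^sup>+w. fe w * indicator (Some -` \<Gamma>) w \<partial>q_tilde M q (snd p) (snd (fst p))) / f (snd p)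
     + (c - qi f (snd (fst p)) (snd p) / f (snd p)) * indicator \<Gamma> None
     - (c + q_rate q (snd p) (snd (fst p))) * indicator (Some -` \<Gamma>) (snd p) = qf (Some (snd p)) (snd (fst p)) \<Gamma>"
      unfolding qf_Some[OF p \<Gamma>] measure_def weighted_facts(2)[OF p B] fun_cong[OF ind, of p] ..
  qed
  finally have [measurable]: "(\<lambda>p. qf (Some (snd p)) (snd (fst p)) \<Gamma>) \<in> borel_measurable ?L" .
  have "(\<lambda>w. case fst w of None \<Rightarrow> 0 | Some y \<Rightarrow> qf (Some y) (snd w) \<Gamma>) \<in> borel_measurable (Sd \<Otimes>\<^sub>M time_space)"
    by measurable
  also have "(\<lambda>w. case fst w of None \<Rightarrow> 0 | Some y \<Rightarrow> qf (Some y) (snd w) \<Gamma>) = (\<lambda>(z, s). qf z s \<Gamma>)"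
    by (auto simp: fun_eq_iff split: option.split)
  finally show "(\<lambda>(z, s). qf z s \<Gamma>) \<in> borel_measurable (Sd \<Otimes>\<^sub>M time_space)" .
next
  fix z \<Gamma> and s :: real assume z: "z \<in> space Sd" and s: "0 \<le> s" and \<Gamma>: "\<Gamma> \<in> sets Sd" "z \<notin> \<Gamma>"
  show "0 \<le> qf z s \<Gamma>"
  proof (cases z)
    case (Some y)
    then have y: "y \<in> space M" using z by auto
    show ?thesis
      unfolding Some qf_Some[OF y s \<Gamma>(1)] using Some \<Gamma>(2) killing_nonneg[OF y s] f_pos[OF y] by simp
  qed simp
next
  fix z and s :: real assume z: "z \<in> space Sd" and s: "0 \<le> s"
  show "qf z s (space Sd) = 0"
  proof (cases z)
    case (Some y)
    then have y: "y \<in> space M" using z by auto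
    have "Some -` space Sd = space M" by auto
    then show ?thesis
      unfolding Some qf_Some[OF y s sets.top] using weighted_facts(5)[OF y s] f_pos[OF y] y
      by (simp add: q_integral_def field_simps)
  qed simp
next
  fix z assume z: "z \<in> space Sd"
  show "bdd_above ((\<lambda>s. qf z s (space Sd - {z})) ` {0..})"
  proof (cases z)
    case None
    then show ?thesis by (auto intro!: bdd_aboveI[of _ 0])
  next
    case (Some y)
    then have y: "y \<in> space M" using z by auto
    obtain B where B: "\<And>s. 0 \<le> s \<Longrightarrow> q_rate q y s \<le> B" using q_rate_bounded[OF y] by blast
    have "qf (Some y) s (space Sd - {Some y}) \<le> c + B" if s: "0 \<le> s" for s
    proof -
      have "{Some y} \<in> sets Sd" using y sets_singleton[OF y] by (auto simp: sets_option_space vimage_def)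
      then have \<Gamma>: "space Sd - {Some y} \<in> sets Sd" by (rule sets.Diff[OF sets.top])
      have eq: "Some -` (space Sd - {Some y}) = space M - {y}" by auto
      have "qf (Some y) s (space Sd - {Some y}) = c + q_rate q y s"
        unfolding qf_Some[OF y s \<Gamma>] eq weighted_facts(3)[OF y s sets.top] weighted_facts(5)[OF y s]
        using f_pos[OF y] by (simp add: q_integral_def field_simps)
      then show ?thesis using B[OF s] by simp
    qed
    then show ?thesis unfolding Some by (auto intro!: bdd_aboveI[of _ "c + B"])
  qed
qed

sublocale T: jump_process Sd qf
proof (rule jump_process.intro)
  show "Q_function Sd qf" by (rule Q_function_transform)
  show "space Sd \<noteq> {}" by simp
  show "{p \<in> space (Sd \<Otimes>\<^sub>M Sd). fst p = snd p} \<in> sets (Sd \<Otimes>\<^sub>M Sd)"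
    by (rule sets_diagonal_option[OF diagonal])
qed

text \<open>The results on a general process now apply to the transformed one with prefix
  \<open>T\<close>, started at a proper state; the start in \<open>None\<close> is treated
  separately.\<close>

sublocale T: started_jump_process Sd qf "Some x"
  by unfold_locales (use x in simp)

lemma q_rate_transform: "y \<in> space M \<Longrightarrow> 0 \<le> s \<Longrightarrow> q_rate qf (Some y) s = c + q_rate q y s"
proof -
  assume y: "y \<in> space M" "0 \<le> s"
  have \<Gamma>: "{Some y} \<in> sets Sd" using sets_singleton[OF y(1)] y by (auto simp: sets_option_space vimage_def)
  have eq: "Some -` {Some y} = {y}" by auto
  show ?thesis unfolding q_rate_def[of qf] qf_Some[OF y \<Gamma>] eq weighted_facts(4)[OF y] by simp
qed

lemma survival_transform:
  assumes y: "y \<in> space M" and u: "0 \<le> u" "u \<le> v"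
  shows "survival qf (Some y) u v = exp (- c * (v - u)) * survival q y u v"
proof -
  have "(LBINT s:{u..v}. q_rate qf (Some y) s) = (LBINT s:{u..v}. c + q_rate q y s)"
    using y u by (intro set_lebesgue_integral_cong) (auto simp: q_rate_transform)
  also have "\<dots> = (LBINT s:{u..v}. c) + (LBINT s:{u..v}. q_rate q y s)"
    by (intro set_integral_add set_integrable_q_rate y u) (auto simp: set_integrable_def u)
  also have "(LBINT s:{u..v}. c) = c * (v - u)"
    using u by (simp add: set_lebesgue_integral_def)
  finally show ?thesis by (simp add: survival_def exp_add[symmetric] algebra_simps)
qed

lemma emeasure_q_tilde_transform:
  assumes y: "y \<in> space M" "0 \<le> s" and \<Gamma>: "\<Gamma> \<in> sets Sd"
  shows "emeasure (q_tilde Sd qf (Some y) s) \<Gamma>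
    = ennreal (1 / f y) * (\<integral>\<^sup>+w. fe w * indicator \<Gamma> (Some w) \<partial>q_tilde M q y s)
      + ennreal (c - qi f s y / f y) * indicator \<Gamma> None"
proof -
  have single: "{Some y} \<in> sets Sd" using sets_singleton[OF y(1)] y by (auto simp: sets_option_space vimage_def)
  have B: "Some -` \<Gamma> \<in> sets M" using \<Gamma> by (simp add: sets_option_space)
  have eq: "Some -` (\<Gamma> - {Some y}) = Some -` \<Gamma> - {y}" by auto
  have "qf (Some y) s (\<Gamma> - {Some y}) = measure (weighted y s) (Some -` \<Gamma>) / f y
     + (c - qi f s y / f y) * indicator \<Gamma> None"
    using qf_Some[OF y sets.Diff[OF \<Gamma> single]] unfolding eq weighted_facts(3)[OF y B]
    by (auto split: split_indicator)
  then have "emeasure (q_tilde Sd qf (Some y) s) \<Gamma> = ennreal (measure (weighted y s) (Some -` \<Gamma>) / f y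
     + (c - qi f s y / f y) * indicator \<Gamma> None)"
    using T.emeasure_q_tilde[OF _ y(2) \<Gamma>, of "Some y"] y by simp
  also have "\<dots> = ennreal (measure (weighted y s) (Some -` \<Gamma>) / f y) + ennreal ((c - qi f s y / f y) * indicator \<Gamma> None)"
    using f_pos[OF y(1)] killing_nonneg[OF y] by (intro ennreal_plus) auto
  also have "ennreal (measure (weighted y s) (Some -` \<Gamma>) / f y) = ennreal (1 / f y) * emeasure (weighted y s) (Some -` \<Gamma>)"
    using finite_measure.emeasure_eq_measure[OF weighted_facts(1)[OF y], of "Some -` \<Gamma>"] f_pos[OF y(1)]
    by (simp add: ennreal_mult[symmetric])
  also have "emeasure (weighted y s) (Some -` \<Gamma>) = (\<integral>\<^sup>+w. fe w * indicator \<Gamma> (Some w) \<partial>q_tilde M q y s)"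
    unfolding weighted_facts(2)[OF y B] by (intro nn_integral_cong) (auto split: split_indicator)
  finally show ?thesis by (auto split: split_indicator)
qed

text \<open>On proper states the new jump measure has density \<open>f w / f y\<close> with respect
  to the old one, and the killing rate sits at \<open>None\<close>. Sets were treated before;
  functions follow by induction.\<close>

lemma nn_integral_q_tilde_transform:
  assumes y: "y \<in> space M" "0 \<le> s" and k: "k \<in> borel_measurable Sd"
  shows "(\<integral>\<^sup>+w. k w \<partial>q_tilde Sd qf (Some y) s)
    = ennreal (1 / f y) * (\<integral>\<^sup>+w. fe w * k (Some w) \<partial>q_tilde M q y s)
      + ennreal (c - qi f s y / f y) * k None"
proof -
  let ?J = "\<lambda>k. \<integral>\<^sup>+w. fe w * k (Some w) \<partial>q_tilde M q y s"
  define a where "a = ennreal (1 / f y)"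
  define b where "b = ennreal (c - qi f s y / f y)"
  have m: "(\<lambda>w. fe w * h (Some w)) \<in> borel_measurable (q_tilde M q y s)" if "h \<in> borel_measurable Sd" for h :: "_ \<Rightarrow> ennreal"
    using measurable_compose[OF measurable_Some that] by (intro measurable_q_tilde) measurable
  have mT: "h \<in> borel_measurable (q_tilde Sd qf (Some y) s)" if "h \<in> borel_measurable Sd" for h :: "_ \<Rightarrow> ennreal"
    using that by (simp add: measurable_cong_sets[OF T.sets_q_tilde refl])
  have "(\<integral>\<^sup>+w. k w \<partial>q_tilde Sd qf (Some y) s) = a * ?J k + b * k None"
    using k
  proof induct
    case (cong g h)
    have "(\<integral>\<^sup>+w. g w \<partial>q_tilde Sd qf (Some y) s) = (\<integral>\<^sup>+w. h w \<partial>q_tilde Sd qf (Some y) s)"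
      using cong(3) by (intro nn_integral_cong) simp
    moreover have "?J g = ?J h" using cong(3) by (intro nn_integral_cong) simp
    ultimately show ?case using cong by simp
  next
    case (set A)
    then show ?case
      using emeasure_q_tilde_transform[OF y set] by (simp add: a_def b_def)
  next
    case (mult h d)
    have "?J (\<lambda>w. d * h w) = (\<integral>\<^sup>+w. d * (fe w * h (Some w)) \<partial>q_tilde M q y s)"
      by (intro nn_integral_cong) (simp add: ac_simps)
    also have "\<dots> = d * ?J h" by (rule nn_integral_cmult[OF m[OF mult(2)]])
    finally show ?case using mult by (simp add: nn_integral_cmult mT distrib_left ac_simps)
  next
    case (add g h)
    have "?J (\<lambda>w. h w + g w) = ?J h + ?J g"
      using nn_integral_add[OF m[OF add(4)] m[OF add(1)]] by (simp add: distrib_left)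
    then show ?case using add by (simp add: nn_integral_add mT distrib_left ac_simps)
  next
    case (seq U)
    have inc: "incseq (\<lambda>i. a * ?J (U i))" "incseq (\<lambda>i. b * U i None)"
      using seq(4) by (auto simp: incseq_def le_fun_def intro!: mult_left_mono nn_integral_mono)
    have "(\<integral>\<^sup>+w. (SUP i. U i w) \<partial>q_tilde Sd qf (Some y) s) = (SUP i. \<integral>\<^sup>+w. U i w \<partial>q_tilde Sd qf (Some y) s)"
      using seq(1,4) by (intro nn_integral_monotone_convergence_SUP mT)
    also have "\<dots> = (SUP i. a * ?J (U i)) + (SUP i. b * U i None)"
      unfolding seq(3) by (rule ennreal_SUP_add[OF inc])
    also have "(SUP i. a * ?J (U i)) = a * (SUP i. ?J (U i))" by (simp add: SUP_mult_left_ennreal)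
    also have "(SUP i. ?J (U i)) = (\<integral>\<^sup>+w. (SUP i. fe w * U i (Some w)) \<partial>q_tilde M q y s)"
      using seq(4) by (intro nn_integral_monotone_convergence_SUP[symmetric] m seq(1))
        (auto simp: incseq_def le_fun_def intro!: mult_left_mono)
    also have "\<dots> = ?J (\<lambda>w. SUP i. U i w)" by (simp add: SUP_mult_left_ennreal)
    also have "(SUP i. b * U i None) = b * (SUP i. U i None)" by (simp add: SUP_mult_left_ennreal)
    finally show ?case by (simp add: image_comp)
  qed
  then show ?thesis by (simp add: a_def b_def)
qed

lemma nn_integral_q_tilde_transform_None: "0 \<le> s \<Longrightarrow> (\<integral>\<^sup>+w. k w \<partial>q_tilde Sd qf None s) = 0"
proof -
  assume s: "0 \<le> s"
  have "emeasure (q_tilde Sd qf None s) (space (q_tilde Sd qf None s)) = 0"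
    using T.emeasure_q_tilde[OF _ s sets.top, of None] by simp
  then have "space (q_tilde Sd qf None s) \<in> null_sets (q_tilde Sd qf None s)" by (rule null_setsI) (rule sets.top)
  then have "AE w in q_tilde Sd qf None s. k w = 0" by (rule AE_I') blast
  then have "(\<integral>\<^sup>+w. k w \<partial>q_tilde Sd qf None s) = (\<integral>\<^sup>+w. 0 \<partial>q_tilde Sd qf None s)"
    by (rule nn_integral_cong_AE)
  then show ?thesis by simp
qed

text \<open>A jump from \<open>(u, y)\<close> to \<open>(v, w)\<close> contributes the factor
  \<open>exp (- c * (v - u)) * f w / f y\<close>, the exponential from the extra exit rate and the
  quotient from the jump measure; along the chain these factors telescope. Only paths that have not
  been killed have such a ratio, hence the condition on \<open>k\<close> at
  \<open>None\<close>.\<close>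

lemma Psi_transform:
  assumes "case_prod k \<in> borel_measurable T.EM" "\<And>u. 0 \<le> u \<Longrightarrow> k u None = 0"
  shows "T.Psi n k = ennreal (1 / f x) * Psi n (\<lambda>u y. ennreal (exp (- c * u)) * (fe y * k u (Some y)))"
  using assms
proof (induction n arbitrary: k)
  case (0 k)
  have [measurable]: "(\<lambda>p. k (fst p) (Some (snd p))) \<in> borel_measurable EM"
  proof -
    have "(\<lambda>p. (fst p, Some (snd p))) \<in> EM \<rightarrow>\<^sub>M T.EM" by measurable
    from measurable_compose[OF this 0(1)] show ?thesis by simp
  qed
  have "(\<lambda>(u, y). ennreal (exp (- c * u)) * (fe y * k u (Some y))) \<in> borel_measurable EM"
    unfolding split_beta' by measurable
  from Psi_0[OF this] T.Psi_0[OF 0(1)] f_pos[OF x] show ?case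
    by (simp add: mult.assoc[symmetric] ennreal_mult[symmetric])
next
  case (Suc n k)
  note km = Suc.prems(1)
  \<comment> \<open>Conditioning replaces \<open>k\<close> by its expectation after one more jump,
    to which the induction hypothesis applies.\<close>
  define k' where "k' u z = (\<integral>\<^sup>+v. indicator {u<..} v * (ennreal (survival qf z u v) * (\<integral>\<^sup>+w. k v w \<partial>q_tilde Sd qf z v)) \<partial>halfline)" for u z
  have k'm: "case_prod k' \<in> borel_measurable T.EM"
    unfolding k'_def by (rule T.Psi_Suc_integrand_measurable[OF km])
  \<comment> \<open>The jump measure of the absorbing state is zero, so the condition at
    \<open>None\<close> is preserved.\<close>
  have k'0: "k' u None = 0" for u
  proof -
    have "k' u None = (\<integral>\<^sup>+v. 0 \<partial>halfline)"
      unfolding k'_def by (intro nn_integral_cong) (simp add: nn_integral_q_tilde_transform_None space_restrict_space)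
    then show ?thesis by simp
  qed
  define h where "h v w = ennreal (exp (- c * v)) * (fe w * k v (Some w))" for v w
  have k1: "(\<lambda>p. k (fst p) (Some (snd p))) \<in> borel_measurable EM"
  proof -
    have "(\<lambda>p. (fst p, Some (snd p))) \<in> EM \<rightarrow>\<^sub>M T.EM" by measurable
    from measurable_compose[OF this km] show ?thesis by simp
  qed
  note k1 [measurable]
  have fk: "(\<lambda>(v, w). fe w * k v (Some w)) \<in> borel_measurable EM"
    unfolding split_beta' by measurable
  have h: "case_prod h \<in> borel_measurable EM"
    unfolding h_def split_beta' by measurable
  have ksec: "k v \<in> borel_measurable Sd" if "0 \<le> v" for v
    using T.measurable_snd_const[OF km that] .
  have "T.Psi (Suc n) k = T.Psi n k'"
    unfolding k'_def by (rule T.Psi_Suc[OF km])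
  also have "\<dots> = ennreal (1 / f x) * Psi n (\<lambda>u y. ennreal (exp (- c * u)) * (fe y * k' u (Some y)))"
    by (rule Suc.IH[OF k'm k'0])
  also have "Psi n (\<lambda>u y. ennreal (exp (- c * u)) * (fe y * k' u (Some y)))
    = Psi n (\<lambda>u y. \<integral>\<^sup>+v. indicator {u<..} v * (ennreal (survival q y u v) * (\<integral>\<^sup>+w. h v w \<partial>q_tilde M q y v)) \<partial>halfline)"
  proof (rule Psi_cong)
    fix u :: real and y assume u: "0 \<le> u" and y: "y \<in> space M"
    let ?e = "ennreal (exp (- c * u)) * fe y"
    have meas: "(\<lambda>v. indicator {u<..} v * (ennreal (survival qf (Some y) u v) * (\<integral>\<^sup>+w. k v w \<partial>q_tilde Sd qf (Some y) v))) \<in> borel_measurable halfline"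
    proof (rule borel_measurable_halfline)
      have y': "Some y \<in> space Sd" using y by simp
      have [measurable]: "survival qf (Some y) u \<in> borel_measurable time_space"
        by (rule T.measurable_survival_time[OF y' u])
      have [measurable]: "(\<lambda>v. \<integral>\<^sup>+w. k v w \<partial>q_tilde Sd qf (Some y) v) \<in> borel_measurable time_space"
        by (rule T.nn_integral_q_tilde_measurable[OF km]) (use y' in auto)
      have [measurable]: "(indicator {u<..} :: real \<Rightarrow> ennreal) \<in> borel_measurable time_space"
        by (rule measurable_restrict_space1) simp
      show "(\<lambda>v. indicator {u<..} v * (ennreal (survival qf (Some y) u v) * (\<integral>\<^sup>+w. k v w \<partial>q_tilde Sd qf (Some y) v))) \<in> borel_measurable time_space"
        by measurable
    qed
    have "ennreal (exp (- c * u)) * (fe y * k' u (Some y)) = ?e * k' u (Some y)" by (simp only: mult.assoc)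
    also have "\<dots> = (\<integral>\<^sup>+v. ?e * (indicator {u<..} v * (ennreal (survival qf (Some y) u v) * (\<integral>\<^sup>+w. k v w \<partial>q_tilde Sd qf (Some y) v))) \<partial>halfline)"
      unfolding k'_def by (rule nn_integral_cmult[symmetric, OF meas])
    also have "\<dots> = (\<integral>\<^sup>+v. indicator {u<..} v * (ennreal (survival q y u v) * (\<integral>\<^sup>+w. h v w \<partial>q_tilde M q y v)) \<partial>halfline)"
    proof (rule nn_integral_halfline_cong)
      fix v :: real assume v: "0 \<le> v"
      show "?e * (indicator {u<..} v * (ennreal (survival qf (Some y) u v) * (\<integral>\<^sup>+w. k v w \<partial>q_tilde Sd qf (Some y) v)))
        = indicator {u<..} v * (ennreal (survival q y u v) * (\<integral>\<^sup>+w. h v w \<partial>q_tilde M q y v))"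
      proof (cases "u < v")
        case True
        define I where "I = (\<integral>\<^sup>+w. fe w * k v (Some w) \<partial>q_tilde M q y v)"
        have i1: "(\<integral>\<^sup>+w. k v w \<partial>q_tilde Sd qf (Some y) v) = ennreal (1 / f y) * I"
          using nn_integral_q_tilde_transform[OF y v ksec[OF v]] Suc.prems(2)[OF v] by (simp add: I_def)
        have i2: "(\<integral>\<^sup>+w. h v w \<partial>q_tilde M q y v) = ennreal (exp (- c * v)) * I"
          unfolding h_def I_def
          by (rule nn_integral_cmult, rule measurable_q_tilde) (use measurable_snd_const[OF fk v] in simp)
        \<comment> \<open>The weight \<open>f y\<close> from the induction hypothesis cancels the
          \<open>1 / f y\<close> of the jump measure, and the two discounts combine to the one at
          time \<open>v\<close>.\<close>
        have "ennreal (exp (- c * u)) * fe y * (ennreal (exp (- c * (v - u)) * survival q y u v) * ennreal (1 / f y))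
          = ennreal (survival q y u v) * ennreal (exp (- c * v))"
        proof -
          have "exp (- c * u) * f y * ((exp (- c * (v - u)) * survival q y u v) * (1 / f y))
            = survival q y u v * (exp (- c * u) * exp (- c * (v - u)))"
            using f_pos[OF y] by simp
          also have "exp (- c * u) * exp (- c * (v - u)) = exp (- c * v)"
            by (simp add: exp_add[symmetric] algebra_simps)
          finally show ?thesis using f_pos[OF y] by (simp add: ennreal_mult[symmetric])
        qed
        then have "?e * (ennreal (survival qf (Some y) u v) * (ennreal (1 / f y) * I))
          = ennreal (survival q y u v) * (ennreal (exp (- c * v)) * I)"
          unfolding survival_transform[OF y u less_imp_le[OF True]] by (simp only: mult.assoc[symmetric])
        then show ?thesis using True by (simp only: i1 i2 indicator_simps greaterThan_iff mult_1)
      qed simp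
    qed
    finally show "ennreal (exp (- c * u)) * (fe y * k' u (Some y))
      = (\<integral>\<^sup>+v. indicator {u<..} v * (ennreal (survival q y u v) * (\<integral>\<^sup>+w. h v w \<partial>q_tilde M q y v)) \<partial>halfline)" .
  qed
  also have "\<dots> = Psi (Suc n) h" by (rule Psi_Suc[OF h, symmetric])
  finally show ?case by (simp only: h_def[abs_def])
qed

text \<open>Here \<open>None\<close> is the absorbing state; chains with no further jump are already
  discarded by \<open>Psi\<close>. Thus \<open>T.Psi n (alive t)\<close> is the probability of
  \<open>n\<close> jumps up to \<open>t\<close> without killing.\<close>

definition alive :: "real \<Rightarrow> real \<Rightarrow> 'a option \<Rightarrow> ennreal" where
  "alive t u z = (case z of None \<Rightarrow> 0 | Some _ \<Rightarrow> if u \<le> t then 1 else 0)"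

lemma alive_measurable: "case_prod (alive t) \<in> borel_measurable T.EM"
proof -
  show ?thesis unfolding alive_def[abs_def] split_beta' by measurable
qed

lemma Psi_alive: "T.Psi n (alive t) = ennreal (1 / f x) * WP c n t fe"
proof -
  have "T.Psi n (alive t) = ennreal (1 / f x) * Psi n (\<lambda>u y. ennreal (exp (- c * u)) * (fe y * alive t u (Some y)))"
    by (rule Psi_transform[OF alive_measurable]) (simp add: alive_def)
  also have "Psi n (\<lambda>u y. ennreal (exp (- c * u)) * (fe y * alive t u (Some y))) = WP c n t fe"
    unfolding WP_def by (rule Psi_cong) (simp add: alive_def)
  finally show ?thesis .
qed

lemma Psi_alive_le_hit: "T.Psi n (alive t) \<le> T.hit n t"
  unfolding T.hit_def by (rule T.Psi_mono) (auto simp: alive_def split: option.split)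

text \<open>A further jump up to \<open>t\<close> is possible only from a state that is not
  absorbing and was entered up to \<open>t\<close>, and then its conditional probability is at most
  1.\<close>

lemma hit_Suc_le_Psi_alive: "T.hit (Suc n) t \<le> T.Psi n (alive t)"
  unfolding T.hit_def T.Psi_Suc[OF T.hit_indicator_measurable]
proof (rule T.Psi_mono)
  fix u :: real and z assume u: "0 \<le> u" and z: "z \<in> space Sd"
  let ?F = "\<lambda>v. indicator {u<..} v * (ennreal (survival qf z u v) * (\<integral>\<^sup>+w. (if v \<le> t then 1 else 0) \<partial>q_tilde Sd qf z v))"
  show "(\<integral>\<^sup>+v. ?F v \<partial>halfline) \<le> alive t u z"
  proof (cases "z = None \<or> t < u")
    case True
    have "(\<integral>\<^sup>+v. ?F v \<partial>halfline) = (\<integral>\<^sup>+v. 0 \<partial>halfline)"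
    proof (rule nn_integral_halfline_cong)
      fix v :: real assume v: "0 \<le> v"
      show "?F v = 0"
      proof (cases "z = None")
        case True
        show ?thesis unfolding True nn_integral_q_tilde_transform_None[OF v] by simp
      next
        case False
        with \<open>z = None \<or> t < u\<close> show ?thesis by (auto split: split_indicator)
      qed
    qed
    then show ?thesis by simp
  next
    case False
    have "(\<integral>\<^sup>+v. ?F v \<partial>halfline) \<le> T.jump_mass u z (space (chain_space Sd))"
      unfolding T.jump_mass_def
    proof (rule nn_integral_halfline_mono)
      fix v :: real assume v: "0 \<le> v"
      have eq: "{y \<in> space Sd. Some (v, y) \<in> space (chain_space Sd)} = space (q_tilde Sd qf z v)"
        using v by (auto simp: space_pair_measure)
      have "(\<integral>\<^sup>+w. (if v \<le> t then 1 else 0) \<partial>q_tilde Sd qf z v) \<le> (\<integral>\<^sup>+w. 1 \<partial>q_tilde Sd qf z v)"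
        by (intro nn_integral_mono) auto
      also have "\<dots> = emeasure (q_tilde Sd qf z v) {y \<in> space Sd. Some (v, y) \<in> space (chain_space Sd)}"
        unfolding eq by simp
      finally show "?F v \<le> indicator {u<..} v * (ennreal (survival qf z u v) *
          emeasure (q_tilde Sd qf z v) {y \<in> space Sd. Some (v, y) \<in> space (chain_space Sd)})"
        by (intro mult_left_mono) auto
    qed
    also have "\<dots> \<le> 1" by (rule T.jump_mass_le_1[OF z u])
    finally show ?thesis using False by (auto simp: alive_def split: option.split)
  qed
qed

lemma WP_c_le: "WP c n t fe \<le> WP 0 n t fe"
  unfolding WP_def
proof (rule Psi_mono)
  fix u :: real and y assume "0 \<le> u"
  then have "exp (- c * u) \<le> 1" using c by simp
  then have "ennreal (exp (- c * u)) * fe y \<le> 1 * fe y"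
    by (intro mult_right_mono) (auto simp flip: ennreal_1 intro: ennreal_leI)
  then show "(if u \<le> t then ennreal (exp (- c * u)) * fe y else 0) \<le> (if u \<le> t then ennreal (exp (- 0 * u)) * fe y else 0)"
    by simp
qed

text \<open>Having jumped \<open>n\<close> times without being killed and jumping for the \<open>(n + 1)\<close>-st time are
  interleaved events, because the absorbing state admits no further jump.\<close>

lemma explosion_transform_iff:
  "(AE \<omega> in jump_law Sd qf (Some x). explosion_time \<omega> = \<infinity>) \<longleftrightarrow> (\<forall>t\<ge>0. (\<lambda>N. WP 0 N t fe) \<longlonglongrightarrow> 0)"
  unfolding T.explosion_time_infinite_iff
proof (intro all_cong1 imp_cong refl)
  fix t :: real assume t: "0 \<le> t"
  show "(\<lambda>n. T.hit n t) \<longlonglongrightarrow> 0 \<longleftrightarrow> (\<lambda>N. WP 0 N t fe) \<longlonglongrightarrow> 0"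
  proof
    assume hit: "(\<lambda>n. T.hit n t) \<longlonglongrightarrow> 0"
    have "(\<lambda>n. T.Psi n (alive t)) \<longlonglongrightarrow> 0"
      by (rule tendsto_sandwich[OF _ _ tendsto_const hit]) (simp_all add: Psi_alive_le_hit)
    \<comment> \<open>The constant compensates the discount, as in \<open>WP_bound\<close>, and the
      factor \<open>1 / f x\<close> of \<open>Psi_alive\<close>.\<close>
    from ennreal_tendsto_cmult[OF _ this, of "ennreal (exp (c * t) * f x)"]
    have lim: "(\<lambda>n. ennreal (exp (c * t) * f x) * T.Psi n (alive t)) \<longlonglongrightarrow> 0" by simp
    have "WP 0 n t fe \<le> ennreal (exp (c * t) * f x) * T.Psi n (alive t)" for n
    proof -
      have "WP 0 n t fe \<le> ennreal (exp (c * t)) * WP c n t fe" by (rule WP_bound[OF t])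
      also have "\<dots> = ennreal (exp (c * t) * f x) * T.Psi n (alive t)"
        using f_pos[OF x] unfolding Psi_alive mult.assoc[symmetric] by (simp add: ennreal_mult[symmetric])
      finally show ?thesis .
    qed
    then show "(\<lambda>N. WP 0 N t fe) \<longlonglongrightarrow> 0"
      by (intro tendsto_sandwich[OF _ _ tendsto_const lim]) simp_all
  next
    assume WP: "(\<lambda>N. WP 0 N t fe) \<longlonglongrightarrow> 0"
    from ennreal_tendsto_cmult[OF _ this, of "ennreal (1 / f x)"]
    have lim: "(\<lambda>n. ennreal (1 / f x) * WP 0 n t fe) \<longlonglongrightarrow> 0" by simp
    have "T.hit (Suc n) t \<le> ennreal (1 / f x) * WP 0 n t fe" for n
    proof -
      have "T.hit (Suc n) t \<le> ennreal (1 / f x) * WP c n t fe"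
        using hit_Suc_le_Psi_alive[of n t] unfolding Psi_alive .
      also have "\<dots> \<le> ennreal (1 / f x) * WP 0 n t fe" by (rule mult_left_mono[OF WP_c_le]) simp
      finally show ?thesis .
    qed
    then have "(\<lambda>n. T.hit (Suc n) t) \<longlonglongrightarrow> 0"
      by (intro tendsto_sandwich[OF _ _ tendsto_const lim]) simp_all
    then show "(\<lambda>n. T.hit n t) \<longlonglongrightarrow> 0" by (rule LIMSEQ_imp_Suc)
  qed
qed

text \<open>\<open>nonexplosive\<close> also quantifies over the start in the absorbing state. No
  jump leads out of it, so \<open>hit n t\<close> is 0 from \<open>n = 1\<close> on.\<close>

lemma AE_explosion_time_absorbed: "AE \<omega> in jump_law Sd qf None. explosion_time \<omega> = \<infinity>"
proof -
  interpret N: started_jump_process Sd qf None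
    by unfold_locales simp
  show ?thesis
    unfolding N.explosion_time_infinite_iff
  proof (intro allI impI)
    fix t :: real
    have "N.hit (Suc 0) t = (\<integral>\<^sup>+v. indicator {0<..} v * (ennreal (survival qf None 0 v) *
        (\<integral>\<^sup>+w. (if v \<le> t then 1 else 0) \<partial>q_tilde Sd qf None v)) \<partial>halfline)"
      unfolding N.hit_def N.Psi_Suc[OF N.hit_indicator_measurable]
      by (rule N.Psi_0[OF N.Psi_Suc_integrand_measurable[OF N.hit_indicator_measurable]])
    also have "\<dots> = (\<integral>\<^sup>+v. 0 \<partial>halfline)"
      by (intro nn_integral_cong) (simp only: nn_integral_q_tilde_transform_None space_restrict_space Int_iff atLeast_iff mult_zero_right)
    finally have 0: "N.hit (Suc 0) t = 0" by simp
    have "N.hit (Suc n) t = 0" for n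
    proof (induction n)
      case (Suc n)
      have "N.hit (Suc (Suc n)) t \<le> N.hit (Suc n) t"
        unfolding N.hit_eq
      proof (rule nn_integral_mono_AE, use N.AE_jump_time_mono in eventually_elim)
        fix \<omega> :: "'a option chain" assume "\<forall>n. jump_time \<omega> n \<le> jump_time \<omega> (Suc n)"
        then have "jump_time \<omega> (Suc n) \<le> jump_time \<omega> (Suc (Suc n))" by (rule spec)
        then show "(if jump_time \<omega> (Suc (Suc n)) \<le> ereal t then 1 else 0) \<le> (if jump_time \<omega> (Suc n) \<le> ereal t then 1 else 0 :: ennreal)"
          by auto
      qed
      then show ?case using Suc by simp
    qed (rule 0)
    then have "(\<lambda>n. N.hit (Suc n) t) \<longlonglongrightarrow> 0" by simp
    then show "(\<lambda>n. N.hit n t) \<longlonglongrightarrow> 0" by (rule LIMSEQ_imp_Suc)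
  qed
qed

end

text \<open>The diagonal of a Hausdorff space is closed, and second countability identifies the
  Borel sets of the product with the product of the Borel sets; the inclusion of \<open>S\<close>
  pulls this back.\<close>

lemma sets_diagonal_restrict_borel:
  fixes S :: "'a :: polish_space set"
  assumes "M = restrict_space borel S"
  shows "{p \<in> space (M \<Otimes>\<^sub>M M). fst p = snd p} \<in> sets (M \<Otimes>\<^sub>M M)"
proof -
  have "closed {p :: 'a \<times> 'a. fst p = snd p}"
    by (intro closed_Collect_eq continuous_intros)
  then have D: "{p :: 'a \<times> 'a. fst p = snd p} \<in> sets (borel \<Otimes>\<^sub>M borel)"
    unfolding borel_prod by (rule borel_closed)
  have [measurable]: "(\<lambda>x. x) \<in> M \<rightarrow>\<^sub>M borel"
    unfolding assms by (rule measurable_restrict_space1) simp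
  have "(\<lambda>p. (fst p, snd p)) \<in> M \<Otimes>\<^sub>M M \<rightarrow>\<^sub>M borel \<Otimes>\<^sub>M borel" by measurable
  from measurable_sets[OF this D] show ?thesis
    by (simp add: vimage_def Int_def conj_commute)
qed

theorem theorem4p3:
  fixes S :: "'a :: polish_space set"
    and q :: "'a \<Rightarrow> real \<Rightarrow> 'a set \<Rightarrow> real"
    and c :: real and f :: "'a \<Rightarrow> real" and M :: "'a measure"
  assumes "S \<in> sets borel" and "S \<noteq> {}" and "M = restrict_space borel S"
    and "Q_function M q" and "0 \<le> c" and "drift_function M q c f"
  shows "((\<forall>g. f_bounded M f g \<longrightarrow> forward_integrable M q g \<longrightarrow> forward_identity M q g)
            \<longleftrightarrow> drift_identity M q f)
       \<and> (drift_identity M q f \<longleftrightarrow> nonexplosive (option_space M) (f_transform M q c f))"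
proof -
  have ne: "space M \<noteq> {}" using assms(2,3) by (simp add: space_restrict_space)
  have D: "drift_process M q x c f" if "x \<in> space M" for x
    using assms ne that sets_diagonal_restrict_borel[OF assms(3)]
    by (simp add: drift_process_def drift_process_axioms_def started_jump_process_def
        started_jump_process_axioms_def jump_process_def)
  \<comment> \<open>The vanishing of the defect at all initial states and times is the condition
    with which all three statements are compared.\<close>
  define vanish where "vanish \<longleftrightarrow> (\<forall>x\<in>space M. \<forall>t\<ge>0.
    (\<lambda>N. started_jump_process.WP M q x 0 N t (\<lambda>y. ennreal (f y))) \<longlonglongrightarrow> 0)"
  have drift: "drift_identity M q f \<longleftrightarrow> vanish"
    unfolding drift_identity_def vanish_def
    by (intro ball_cong refl all_cong1 imp_cong drift_process.drift_identity_at[OF D])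
  have nonexpl: "nonexplosive (option_space M) (f_transform M q c f) \<longleftrightarrow> vanish"
  proof -
    \<comment> \<open>Any point of \<open>M\<close> serves to enter the locale; the fact obtained
      concerns the start in \<open>None\<close>.\<close>
    obtain x0 where "x0 \<in> space M" using ne by blast
    note absorbed = drift_process.AE_explosion_time_absorbed[OF D[OF this]]
    have "nonexplosive (option_space M) (f_transform M q c f) \<longleftrightarrow>
        (\<forall>x\<in>space M. AE \<omega> in jump_law (option_space M) (f_transform M q c f) (Some x). explosion_time \<omega> = \<infinity>)"
      unfolding nonexplosive_def space_option_space ball_simps using absorbed by simp
    also have "\<dots> \<longleftrightarrow> vanish"
      unfolding vanish_def by (intro ball_cong refl drift_process.explosion_transform_iff[OF D])
    finally show ?thesis .
  qed
  have mean_abs: "(\<integral>\<^sup>+s\<in>{0..t}. (\<integral>\<^sup>+\<omega>. ennreal \<bar>ext0 (q_integral M q g s) (jump_state \<omega> s)\<bar> \<partial>jump_law M q x) \<partial>lborel)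
      = upto t (\<lambda>s. started_jump_process.mean M q x s (\<lambda>y. ennreal \<bar>q_integral M q g s y\<bar>))"
    if "x \<in> space M" for x t g
  proof -
    interpret drift_process M q x c f by (rule D[OF that])
    show ?thesis unfolding upto_lborel nn_integral_ext0_abs ..
  qed
  have "(\<forall>g. f_bounded M f g \<longrightarrow> forward_integrable M q g \<longrightarrow> forward_identity M q g) \<longleftrightarrow> vanish"
  proof
    assume all: "\<forall>g. f_bounded M f g \<longrightarrow> forward_integrable M q g \<longrightarrow> forward_identity M q g"
    \<comment> \<open>Necessity: \<open>f\<close> is \<open>f\<close>-bounded and satisfies the
      integrability condition, so it may be taken for \<open>g\<close>.\<close>
    obtain x0 where "x0 \<in> space M" using ne by blast
    then have "f_bounded M f f" by (rule drift_process.f_bounded_self[OF D])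
    moreover have "forward_integrable M q f"
      unfolding forward_integrable_def
    proof (intro ballI allI impI)
      fix x and t :: real assume x: "x \<in> space M" and t: "0 \<le> t"
      show "(\<integral>\<^sup>+s\<in>{0..t}. (\<integral>\<^sup>+\<omega>. ennreal \<bar>ext0 (q_integral M q f s) (jump_state \<omega> s)\<bar> \<partial>jump_law M q x) \<partial>lborel) < \<infinity>"
        unfolding mean_abs[OF x] using drift_process.f_abs_finite[OF D[OF x] t] by simp
    qed
    ultimately have id: "forward_identity M q f" by (rule all[rule_format])
    show vanish
      unfolding vanish_def
    proof (intro ballI allI impI)
      fix x and t :: real assume x: "x \<in> space M" and t: "0 \<le> t"
      show "(\<lambda>N. started_jump_process.WP M q x 0 N t (\<lambda>y. ennreal (f y))) \<longlonglongrightarrow> 0"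
        by (rule drift_process.forward_identity_f_imp[OF D[OF x] t])
          (rule id[unfolded forward_identity_def, rule_format, OF x t, THEN conjunct1])
    qed
  next
    assume vanish: vanish
    show "\<forall>g. f_bounded M f g \<longrightarrow> forward_integrable M q g \<longrightarrow> forward_identity M q g"
      unfolding forward_identity_def
    proof (intro allI impI ballI)
      fix g x and t :: real
      assume g: "f_bounded M f g" and fin: "forward_integrable M q g" and x: "x \<in> space M" and t: "0 \<le> t"
      interpret drift_process M q x c f by (rule D[OF x])
      have lim: "(\<lambda>N. WP 0 N t (\<lambda>y. ennreal (f y))) \<longlonglongrightarrow> 0"
        using vanish x t by (simp add: vanish_def)
      have fin': "upto t (\<lambda>s. mean s (\<lambda>y. ennreal \<bar>q_integral M q g s y\<bar>)) < top"
        using fin x t unfolding mean_abs[OF x, symmetric] forward_integrable_def by simp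
      show "(LINT \<omega>|jump_law M q x. ext0 g (jump_state \<omega> t)) - g x =
          (LBINT s:{0..t}. (LINT \<omega>|jump_law M q x. ext0 (q_integral M q g s) (jump_state \<omega> s))) \<and>
        (LBINT s:{0..t}. (LINT \<omega>|jump_law M q x. ext0 (q_integral M q g s) (jump_state \<omega> s))) =
          (LINT \<omega>|jump_law M q x. (LBINT s:{0..t}. ext0 (q_integral M q g s) (jump_state \<omega> s)))"
        using forward_identity_at[OF g t lim fin'] forward_integrals(2)[OF g fin', symmetric] by (rule conjI)
    qed
  qed
  then show ?thesis using drift nonexpl by (simp only: simp_thms)
qed

end
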